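(* Let $\Gamma$ be a left cell of $W$ (for the basis $\{C^{\dagger}_w\}_{w\in W}$ of $H(W)$) such that $\Gamma\cap X_{JJ}\neq\emptyset$, and assume that the cell representation $V^{\dagger}_{\Gamma}$ of $H(W)$ is irreducible over $\mathbb{C}(q)$ (so that $\Gamma\cap X_{JJ}$ is a left cell in $W_J\backslash W/W_J$). As representations of $H^J(W)$, we have $$V^{\dagger}_{\Gamma\cap X_{JJ}}=e_J(V^{\dagger}_{\Gamma})\ ,$$ where equality of representations means isomorphism of $H^J(W)$-modules.
   Context: $(W,S)$ is a Coxeter system with length function $\ell$ and Bruhat order $\leq$; $J\subseteq S$ is non-empty and the parabolic subgroup $W_J$ is assumed finite. Each double coset $\mathcal{D}\in W_J\backslash W/W_J$ has a unique element $r^-(\mathcal{D})$ of minimal length; $X_{JJ}$ is the set of all $r^-(\mathcal{D})$, and double cosets are identified with their minimal-length representatives. Let $W_J(q^2)=\sum_{w\in W_J}q^{2\ell(w)}$ and $A=\mathbb{Z}[q,q^{-1},W_J(q^2)^{-1}]$. The Hecke algebra $H(W)$ is the $A$-algebra with basis $\{T_w\}_{w\in W}$ and, for $s\in S$: $T_sT_w=T_{sw}$ if $\ell(sw)>\ell(w)$, $T_sT_w=(q-q^{-1})T_w+T_{sw}$ if $\ell(sw)<\ell(w)$. The bar involution is the ring automorphism with $\overline{q}=q^{-1}$, $\overline{T_s}=T_s^{-1}$. $\{C_w\}$ is the unique basis with $\overline{C_w}=C_w$ and $C_w=T_w+\sum_{x<w}p_{x,w}T_x$, $p_{x,w}\in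 q^{-1}\mathbb{Z}[q^{-1}]$, and $\{C^\dagger_w\}$ is its image under the ring automorphism $T_s\mapsto -T_s$, $q\mapsto q^{-1}$. Let $e_J=\frac{1}{W_J(q^2)}\sum_{w\in W_J}q^{\ell(w)}T_w$ (an idempotent) and $H^J(W)=e_JH(W)e_J$. The elements $e_JC^\dagger_{r^-(\mathcal{D})}e_J$, $\mathcal{D}\in W_J\backslash W/W_J$, form a basis of $H^J(W)$. Cells: given an algebra $H$ with a basis $\{B_i\}_{i\in I}$, write $i'\preceq_{\mathcal{L}}i$ if there is a finite sequence $i=i_0,i_1,\dots,i_p=i'$ and $h_1,\dots,h_p\in H$ such that $B_{i_k}$ appears with non-zero coefficient in the expansion of $h_kB_{i_{k-1}}$ in the basis, for each $k$. The left cells are the classes of the equivalence relation ($i\preceq_{\mathcal{L}}i'$ and $i'\preceq_{\mathcal{L}}i$); $i'\prec_{\mathcal{L}}i$ means $i'\preceq_{\mathcal{L}}i$ and $i,i'$ are not equivalent. For a left cell $\Gamma$ with $y\in\Gamma$, the cell representation is the left $H$-module $I_{\preceq_{\mathcal{L}}\Gamma}/I_{\prec_{\mathcal{L}}\Gamma}$, where $I_{\preceq_{\mathcal{L}}\Gamma}$ (resp. $I_{\prec_{\mathcal{L}}\Gamma}$) is the left ideal spanned by the $B_i$ with $i\preceq_{\mathcal{L}}y$ (resp. $i\prec_{\mathcal{L}}y$). For $W$, this is applied to $H(W)$ with the basis $\{C^\dagger_w\}$, and the cell representation is denoted $V^\dagger_\Gamma$. For $W_J\backslash W/W_J$, this is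 applied to $H^J(W)$ with the basis $\{e_JC^\dagger_{r^-(\mathcal{D})}e_J\}$; when $\Gamma\cap X_{JJ}$ is a left cell in $W_J\backslash W/W_J$, the associated representation of $H^J(W)$ is denoted $V^{\dagger}_{\Gamma\cap X_{JJ}}$. For a representation $V$ of $H(W)$, $e_J(V)$ carries the natural action of $H^J(W)=e_JH(W)e_J$. *)

theory Defs
  imports
    "HOL-Algebra.Generated_Groups"
    "HOL-Algebra.Multiplicative_Group"
    "HOL-Library.Set_Algebras"
    "HOL-Computational_Algebra.Fraction_Field"
    "HOL-Computational_Algebra.Polynomial"
begin

section \<open>Coxeter systems\<close>

definition word_prod :: "('w, 'z) monoid_scheme \<Rightarrow> 'w list \<Rightarrow> 'w" where
  "word_prod W ws = foldr (\<lambda>s w. s \<otimes>\<^bsub>W\<^esub> w) ws \<one>\<^bsub>W\<^esub>"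

text \<open>The congruence on words in \<open>S\<close> generated by the Coxeter relations
  \<open>(s t)\<^sup>m\<^sup>(\<^sup>s\<^sup>,\<^sup>t\<^sup>) = 1\<close>, where \<open>m(s,t)\<close> is the order of \<open>s t\<close>.  Since \<open>group.ord\<close> is \<open>0\<close> on
  elements of infinite order, the relator is then the empty word, i.e. there is no relation;
  for \<open>s = t\<close> the relator is \<open>[s, s]\<close>.\<close>

inductive coxeter_congruence :: "('w, 'z) monoid_scheme \<Rightarrow> 'w set \<Rightarrow> 'w list \<Rightarrow> 'w list \<Rightarrow> bool"
  for W S where
    relator: "\<lbrakk>s \<in> S; t \<in> S; xs \<in> lists S; ys \<in> lists S\<rbrakk> \<Longrightarrow>
      coxeter_congruence W S
        (xs @ concat (replicate (group.ord W (s \<otimes>\<^bsub>W\<^esub> t)) [s, t]) @ ys) (xs @ ys)"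
  | refl: "xs \<in> lists S \<Longrightarrow> coxeter_congruence W S xs xs"
  | sym: "coxeter_congruence W S xs ys \<Longrightarrow> coxeter_congruence W S ys xs"
  | trans: "\<lbrakk>coxeter_congruence W S xs ys; coxeter_congruence W S ys zs\<rbrakk> \<Longrightarrow>
      coxeter_congruence W S xs zs"

text \<open>\<open>W\<close> is presented by the generators \<open>S\<close> and the Coxeter relations: \<open>S\<close> generates \<open>W\<close>, and
  a word in \<open>S\<close> is trivial in \<open>W\<close> only if the Coxeter relations make it so.\<close>

locale coxeter_system = group W
  for W :: "('w, 'z) monoid_scheme" (structure) and S :: "'w set" +
  assumes generators: "S \<subseteq> carrier W" "generate W S = carrier W"
    and involutions: "s \<in> S \<Longrightarrow> ord s = 2"
    and presentation: "\<lbrakk>ws \<in> lists S; word_prod W ws = \<one>\<rbrakk> \<Longrightarrow> coxeter_congruence W S ws []"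

definition cox_length :: "('w, 'z) monoid_scheme \<Rightarrow> 'w set \<Rightarrow> 'w \<Rightarrow> nat" where
  "cox_length W S w = (LEAST n. \<exists>ws \<in> lists S. length ws = n \<and> word_prod W ws = w)"

definition reflections :: "('w, 'z) monoid_scheme \<Rightarrow> 'w set \<Rightarrow> 'w set" where
  "reflections W S = {g \<otimes>\<^bsub>W\<^esub> s \<otimes>\<^bsub>W\<^esub> inv\<^bsub>W\<^esub> g | g s. g \<in> carrier W \<and> s \<in> S}"

text \<open>The strict Bruhat order.\<close>

definition bruhat_less :: "('w, 'z) monoid_scheme \<Rightarrow> 'w set \<Rightarrow> 'w \<Rightarrow> 'w \<Rightarrow> bool" where
  "bruhat_less W S = (\<lambda>x y. x \<in> carrier W \<and>
     (\<exists>t \<in> reflections W S. y = x \<otimes>\<^bsub>W\<^esub> t \<and> cox_length W S x < cox_length W S y))\<^sup>+\<^sup>+"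

definition double_cosets :: "('w, 'z) monoid_scheme \<Rightarrow> 'w set \<Rightarrow> 'w set set" where
  "double_cosets W J =
     {(generate W J #>\<^bsub>W\<^esub> w) <#>\<^bsub>W\<^esub> generate W J | w. w \<in> carrier W}"

definition min_rep :: "('w, 'z) monoid_scheme \<Rightarrow> 'w set \<Rightarrow> 'w set \<Rightarrow> 'w" where
  "min_rep W S D = (THE d. d \<in> D \<and> (\<forall>w \<in> D. cox_length W S d \<le> cox_length W S w))"

text \<open>\<open>X\<^sub>J\<^sub>J\<close>, which also serves as the index set \<open>W\<^sub>J\<setminus>W/W\<^sub>J\<close>.\<close>

definition min_reps :: "('w, 'z) monoid_scheme \<Rightarrow> 'w set \<Rightarrow> 'w set \<Rightarrow> 'w set" where
  "min_reps W S J = min_rep W S ` double_cosets W J"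


section \<open>Scalars\<close>

type_synonym ratfun = "complex poly fract"

definition q :: ratfun where
  "q = Fract [:0, 1:] 1"

inductive_set subring_gen :: "'a::ring_1 set \<Rightarrow> 'a set" for X where
    one: "1 \<in> subring_gen X"
  | incl: "x \<in> X \<Longrightarrow> x \<in> subring_gen X"
  | diff: "\<lbrakk>x \<in> subring_gen X; y \<in> subring_gen X\<rbrakk> \<Longrightarrow> x - y \<in> subring_gen X"
  | mult: "\<lbrakk>x \<in> subring_gen X; y \<in> subring_gen X\<rbrakk> \<Longrightarrow> x * y \<in> subring_gen X"

definition poincare :: "('w, 'z) monoid_scheme \<Rightarrow> 'w set \<Rightarrow> 'w set \<Rightarrow> ratfun" where
  "poincare W S J = (\<Sum>w \<in> generate W J. q ^ (2 * cox_length W S w))"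

text \<open>The ring \<open>A = \<int>[q, q\<^sup>-\<^sup>1, W\<^sub>J(q\<^sup>2)\<^sup>-\<^sup>1]\<close>, as a subring of \<open>\<complex>(q)\<close>.\<close>

definition coeff_ring :: "('w, 'z) monoid_scheme \<Rightarrow> 'w set \<Rightarrow> 'w set \<Rightarrow> ratfun set" where
  "coeff_ring W S J = subring_gen {q, inverse q, inverse (poincare W S J)}"

text \<open>\<open>q\<^sup>-\<^sup>1 \<int>[q\<^sup>-\<^sup>1]\<close>.\<close>

definition neg_coeffs :: "ratfun set" where
  "neg_coeffs = (\<lambda>p. inverse q * p) ` subring_gen {inverse q}"

text \<open>Linear combinations of a family \<open>B\<close> indexed by \<open>I\<close>, with coefficients in \<open>R \<subseteq> \<complex>(q)\<close>.\<close>

definition lincombs :: "ratfun set \<Rightarrow> (ratfun \<Rightarrow> 'h \<Rightarrow> 'h::ab_group_add) \<Rightarrow> ('i \<Rightarrow> 'h) \<Rightarrow> 'i set \<Rightarrow> 'h set"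
  where "lincombs R scale B I =
    {(\<Sum>i \<in> F. scale (c i) (B i)) | F c. finite F \<and> F \<subseteq> I \<and> c ` F \<subseteq> R}"


section \<open>The Hecke algebra\<close>

text \<open>The type \<open>'h\<close> carries the Hecke algebra over \<open>\<complex>(q)\<close>, with basis \<open>T\<^sub>w\<close>.  The Hecke algebra
  \<open>H(W)\<close> over \<open>A\<close> is the \<open>A\<close>-form \<open>hecke_form\<close> below, the \<open>A\<close>-subalgebra with basis \<open>T\<^sub>w\<close>;
  the ambient algebra is its scalar extension to \<open>\<complex>(q)\<close>.\<close>

locale hecke_algebra = vector_space scale
  for W :: "('w, 'z) monoid_scheme" (structure) and S :: "'w set"
    and scale :: "ratfun \<Rightarrow> 'h \<Rightarrow> 'h::ring_1" and T :: "'w \<Rightarrow> 'h" +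
  assumes algebra: "scale a x * y = scale a (x * y)" "x * scale a y = scale a (x * y)"
    and T_basis: "inj_on T (carrier W)" "independent (T ` carrier W)" "span (T ` carrier W) = UNIV"
    and T_up: "\<lbrakk>s \<in> S; w \<in> carrier W; cox_length W S (s \<otimes> w) > cox_length W S w\<rbrakk> \<Longrightarrow>
      T s * T w = T (s \<otimes> w)"
    and T_down: "\<lbrakk>s \<in> S; w \<in> carrier W; cox_length W S (s \<otimes> w) < cox_length W S w\<rbrakk> \<Longrightarrow>
      T s * T w = scale (q - inverse q) (T w) + T (s \<otimes> w)"

definition hecke_form ::
    "('w, 'z) monoid_scheme \<Rightarrow> 'w set \<Rightarrow> 'w set \<Rightarrow> (ratfun \<Rightarrow> 'h \<Rightarrow> 'h::ring_1) \<Rightarrow> ('w \<Rightarrow> 'h) \<Rightarrow> 'h set"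
  where "hecke_form W S J scale T = lincombs (coeff_ring W S J) scale T (carrier W)"

definition ring_automorphism_on :: "'h::ring_1 set \<Rightarrow> ('h \<Rightarrow> 'h) \<Rightarrow> bool" where
  "ring_automorphism_on H f \<longleftrightarrow> bij_betw f H H \<and> f 1 = 1 \<and>
     (\<forall>x \<in> H. \<forall>y \<in> H. f (x + y) = f x + f y \<and> f (x * y) = f x * f y)"

definition bar_involution ::
    "'h set \<Rightarrow> 'w set \<Rightarrow> (ratfun \<Rightarrow> 'h \<Rightarrow> 'h::ring_1) \<Rightarrow> ('w \<Rightarrow> 'h) \<Rightarrow> ('h \<Rightarrow> 'h) \<Rightarrow> bool"
  where "bar_involution H S scale T bar \<longleftrightarrow> ring_automorphism_on H bar \<and>
    bar (scale q 1) = scale (inverse q) 1 \<and>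
    (\<forall>s \<in> S. bar (T s) * T s = 1 \<and> T s * bar (T s) = 1)"

definition dagger_automorphism ::
    "'h set \<Rightarrow> 'w set \<Rightarrow> (ratfun \<Rightarrow> 'h \<Rightarrow> 'h::ring_1) \<Rightarrow> ('w \<Rightarrow> 'h) \<Rightarrow> ('h \<Rightarrow> 'h) \<Rightarrow> bool"
  where "dagger_automorphism H S scale T dagger \<longleftrightarrow> ring_automorphism_on H dagger \<and>
    dagger (scale q 1) = scale (inverse q) 1 \<and>
    (\<forall>s \<in> S. dagger (T s) = - T s)"

definition kazhdan_lusztig_basis ::
    "('w, 'z) monoid_scheme \<Rightarrow> 'w set \<Rightarrow> (ratfun \<Rightarrow> 'h \<Rightarrow> 'h::ring_1) \<Rightarrow> ('w \<Rightarrow> 'h) \<Rightarrow>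
      ('h \<Rightarrow> 'h) \<Rightarrow> ('w \<Rightarrow> 'h) \<Rightarrow> bool"
  where "kazhdan_lusztig_basis W S scale T bar C \<longleftrightarrow> (\<forall>w \<in> carrier W.
    bar (C w) = C w \<and>
    C w - T w \<in> lincombs neg_coeffs scale T {x \<in> carrier W. bruhat_less W S x w})"

definition idem ::
    "('w, 'z) monoid_scheme \<Rightarrow> 'w set \<Rightarrow> 'w set \<Rightarrow> (ratfun \<Rightarrow> 'h \<Rightarrow> 'h::ring_1) \<Rightarrow> ('w \<Rightarrow> 'h) \<Rightarrow> 'h"
  where "idem W S J scale T = scale (inverse (poincare W S J))
    (\<Sum>w \<in> generate W J. scale (q ^ cox_length W S w) (T w))"

text \<open>The algebra \<open>e H e\<close> for an idempotent \<open>e\<close>, with unit \<open>e\<close>.\<close>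

definition corner :: "'h::ring_1 \<Rightarrow> 'h set \<Rightarrow> 'h set" where
  "corner e H = (\<lambda>h. e * h * e) ` H"


section \<open>Representations and cells\<close>

record ('h, 'v) rep = "'v partial_object" +
  vzero :: 'v
  vadd :: "'v \<Rightarrow> 'v \<Rightarrow> 'v"
  act :: "'h \<Rightarrow> 'v \<Rightarrow> 'v"

definition irreducible_rep :: "'h set \<Rightarrow> ('h, 'v) rep \<Rightarrow> bool" where
  "irreducible_rep H V \<longleftrightarrow> carrier V \<noteq> {vzero V} \<and>
     (\<forall>U \<subseteq> carrier V. vzero V \<in> U \<and> (\<forall>u \<in> U. \<forall>v \<in> U. vadd V u v \<in> U) \<and>
        (\<forall>h \<in> H. \<forall>u \<in> U. act V h u \<in> U) \<longrightarrow> U = {vzero V} \<or> U = carrier V)"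

text \<open>Isomorphism of modules over the algebra \<open>H\<close>.  Linearity over the scalars is part of
  \<open>H\<close>-equivariance, as scalars act through multiples of the unit of \<open>H\<close>.\<close>

definition rep_iso :: "'h set \<Rightarrow> ('h, 'v) rep \<Rightarrow> ('h, 'u) rep \<Rightarrow> bool" where
  "rep_iso H V U \<longleftrightarrow> (\<exists>f. bij_betw f (carrier V) (carrier U) \<and>
     (\<forall>v \<in> carrier V. \<forall>v' \<in> carrier V. f (vadd V v v') = vadd U (f v) (f v')) \<and>
     (\<forall>h \<in> H. \<forall>v \<in> carrier V. f (act V h v) = act U h (f v)))"

text \<open>\<open>e(V)\<close>, on which \<open>e H e\<close> acts by restriction of the action on \<open>V\<close>.\<close>

definition idem_image :: "'h \<Rightarrow> ('h, 'v) rep \<Rightarrow> ('h, 'v) rep" where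
  "idem_image e V = V\<lparr>carrier := act V e ` carrier V\<rparr>"

text \<open>The quotient \<open>M/N\<close> of left ideals \<open>N \<subseteq> M\<close>; its elements are the cosets \<open>x + N\<close>, and
  \<open>h \<cdot> (x + N) = h (x + N) + N = h x + N\<close>.\<close>

definition quotient_rep :: "'h::ring_1 set \<Rightarrow> 'h set \<Rightarrow> ('h, 'h set) rep" where
  "quotient_rep M N = \<lparr>carrier = (\<lambda>x. x +o N) ` M, vzero = N, vadd = (\<lambda>X Y. X + Y),
     act = (\<lambda>h X. h *o X + N)\<rparr>"

text \<open>\<open>B\<^sub>j\<close> appears in \<open>h B\<^sub>i\<close>.  Coefficients in a basis of an \<open>A\<close>-form are computed
  in the ambient \<open>\<complex>(q)\<close>-algebra.\<close>

definition cell_step ::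
    "(ratfun \<Rightarrow> 'h \<Rightarrow> 'h::ring_1) \<Rightarrow> 'h set \<Rightarrow> ('i \<Rightarrow> 'h) \<Rightarrow> 'i set \<Rightarrow> 'i \<Rightarrow> 'i \<Rightarrow> bool"
  where "cell_step scale H B I j i \<longleftrightarrow> i \<in> I \<and> j \<in> I \<and>
    (\<exists>h \<in> H. module.representation scale (B ` I) (h * B i) (B j) \<noteq> 0)"

definition cell_le ::
    "(ratfun \<Rightarrow> 'h \<Rightarrow> 'h::ring_1) \<Rightarrow> 'h set \<Rightarrow> ('i \<Rightarrow> 'h) \<Rightarrow> 'i set \<Rightarrow> 'i \<Rightarrow> 'i \<Rightarrow> bool"
  where "cell_le scale H B I = (cell_step scale H B I)\<^sup>*\<^sup>*"

definition left_cells ::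
    "(ratfun \<Rightarrow> 'h \<Rightarrow> 'h::ring_1) \<Rightarrow> 'h set \<Rightarrow> ('i \<Rightarrow> 'h) \<Rightarrow> 'i set \<Rightarrow> 'i set set"
  where "left_cells scale H B I =
    I // {(i, j) \<in> I \<times> I. cell_le scale H B I i j \<and> cell_le scale H B I j i}"

text \<open>The cell representation of \<open>\<Gamma>\<close>, with scalars \<open>R\<close>.  The preorder always refers to the algebra
  \<open>H\<close> over \<open>A\<close>.  For \<open>R = A\<close> this is the cell representation itself; for \<open>R = UNIV\<close> it is
  its scalar extension to \<open>\<complex>(q)\<close>.\<close>

definition cell_rep ::
    "ratfun set \<Rightarrow> (ratfun \<Rightarrow> 'h \<Rightarrow> 'h::ring_1) \<Rightarrow> 'h set \<Rightarrow> ('i \<Rightarrow> 'h) \<Rightarrow> 'i set \<Rightarrow> 'i set \<Rightarrow>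
      ('h, 'h set) rep"
  where "cell_rep R scale H B I \<Gamma> = quotient_rep
    (lincombs R scale B {i \<in> I. \<exists>y \<in> \<Gamma>. cell_le scale H B I i y})
    (lincombs R scale B {i \<in> I. \<exists>y \<in> \<Gamma>. cell_le scale H B I i y \<and> \<not> cell_le scale H B I y i})"

end

theory Submission
  imports Defs
begin

text \<open>Write \<open>e = e\<^sub>J\<close> and \<open>B\<^sub>w = C\<^sup>\<dagger>\<^sub>w\<close>. If \<open>s\<close> is a descent of \<open>w\<close>, then \<open>C\<^sub>w\<close> is an
  eigenvector of \<open>T\<^sub>s\<close> for the eigenvalue \<open>q\<close>, so \<open>B\<^sub>w\<close> is one for \<open>-q\<^sup>-\<^sup>1\<close>; conversely,
  every eigenvector for \<open>-q\<^sup>-\<^sup>1\<close> is a combination of those \<open>B\<^sub>w\<close> with descent \<open>s\<close>. Since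
  \<open>1 - e\<close> lies in the sum of the \<open>H (T\<^sub>s - q)\<close>, \<open>s \<in> J\<close>, it follows that \<open>h e = 0\<close> iff \<open>h\<close>
  is supported on the \<open>w\<close> with a right descent in \<open>J\<close>, and \<open>e h e = 0\<close> iff it is supported
  off \<open>X\<^sub>J\<^sub>J\<close>. Hence the \<open>e B\<^sub>d e\<close>, \<open>d \<in> X\<^sub>J\<^sub>J\<close>, are independent, and for \<open>h \<in> e H e\<close> the
  coefficient of \<open>e B\<^sub>x e\<close> in \<open>h (e B\<^sub>d e)\<close> is that of \<open>B\<^sub>x\<close> in \<open>h B\<^sub>d\<close>. Right descents are
  constant on left cells, so no element of \<open>\<Gamma>\<close> has a right descent in \<open>J\<close> and right
  multiplication by \<open>e\<close> is injective modulo the smaller cells: it identifies \<open>e(V\<^sub>\<Gamma>)\<close> with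
  the cell module of \<open>\<Gamma> \<inter> X\<^sub>J\<^sub>J\<close>. Irreducibility enters only to show that \<open>\<Gamma> \<inter> X\<^sub>J\<^sub>J\<close> is a
  single cell: each class \<open>e B\<^sub>d\<close> is non-zero and generates \<open>V\<^sub>\<Gamma>\<close>.\<close>


section \<open>Lengths in Coxeter systems\<close>

text \<open>Two discrepancies shape the proof. The preorder on \<open>X\<close> defined by the
  corner algebra may be finer than the restriction of the preorder on \<open>W\<close>, so the spans
  of the \<open>e B_d e\<close> up to and below the cell need not be \<open>e M e\<close> and
  \<open>e N e\<close>, where \<open>M\<close> and \<open>N\<close> are the left ideals defining the
  cell module. Only the quotients are compared: indices of \<open>M\<close> outside
  \<open>\<Gamma> \<inter> X\<close> contribute to \<open>e M\<close> nothing beyond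
  \<open>N\<close>. Moreover, irreducibility is a statement over C(q), while cells are defined by
  multipliers from the \<open>A\<close>-form. A coefficient of \<open>e h e B_d\<close> is linear in
  \<open>h\<close>, so if some \<open>h\<close> over C(q) makes it non-zero, some \<open>T_w\<close>
  does. The set \<open>X\<close> is defined by minimal length but used through the absence of
  descents in \<open>J\<close>. That an element without descents is the minimal one rests on the
  exchange condition, which is drawn from the Hecke algebra and the parity of lengths; hence the
  Hecke algebra appears before the double cosets. The bar and dagger maps are given on
  \<open>q\<close> and the \<open>T_s\<close> only, so their effect on scalars is followed inside
  Z[q, q^-1], where the Kazhdan-Lusztig coefficients live.\<close>

lemma (in group) word_prod_in_carrier:
  assumes "S \<subseteq> carrier G" "ws \<in> lists S"
  shows "word_prod G ws \<in> carrier G"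
  using assms(2,1) by (induction ws) (auto simp: word_prod_def)

lemma (in group) word_prod_append:
  assumes "S \<subseteq> carrier G" "xs \<in> lists S" "ys \<in> lists S"
  shows "word_prod G (xs @ ys) = word_prod G xs \<otimes> word_prod G ys"
  using assms(2)
proof (induction xs)
  case (Cons x xs)
  have "x \<in> carrier G" "word_prod G xs \<in> carrier G" "word_prod G ys \<in> carrier G"
    using assms Cons word_prod_in_carrier by auto
  then show ?case
    using Cons by (simp add: word_prod_def m_assoc)
qed (use assms word_prod_in_carrier[OF assms(1,3)] in \<open>simp add: word_prod_def\<close>)

context coxeter_system
begin

abbreviation len ("\<ell>") where "\<ell> \<equiv> cox_length W S"

lemma S_carrier: "s \<in> S \<Longrightarrow> s \<in> carrier W"
  using generators by auto

lemma S_square: assumes "s \<in> S" shows "s \<otimes> s = \<one>"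
  using pow_ord_eq_1[OF S_carrier[OF assms]] involutions[OF assms] S_carrier[OF assms]
  by (simp add: numeral_2_eq_2)

lemma S_inv: assumes "s \<in> S" shows "inv s = s"
  using S_square[OF assms] S_carrier[OF assms] inv_equality by blast

lemma S_cancel_left: "s \<in> S \<Longrightarrow> w \<in> carrier W \<Longrightarrow> s \<otimes> (s \<otimes> w) = w"
  using S_square S_carrier by (metis l_one m_assoc)

lemma S_cancel_right: "s \<in> S \<Longrightarrow> w \<in> carrier W \<Longrightarrow> w \<otimes> s \<otimes> s = w"
  using S_square S_carrier by (metis r_one m_assoc)

lemma word_prod_simps [simp]:
  "word_prod W [] = \<one>" "word_prod W (s # ws) = s \<otimes> word_prod W ws"
  by (auto simp: word_prod_def)

lemma word_prod_closed: "ws \<in> lists S \<Longrightarrow> word_prod W ws \<in> carrier W"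
  using word_prod_in_carrier generators(1) by blast

lemma word_prod_append':
  "xs \<in> lists S \<Longrightarrow> ys \<in> lists S \<Longrightarrow> word_prod W (xs @ ys) = word_prod W xs \<otimes> word_prod W ys"
  using word_prod_append generators(1) by blast

lemma word_prod_rev:
  assumes "xs \<in> lists S" shows "word_prod W (rev xs) = inv (word_prod W xs)"
  using assms
proof (induction xs)
  case (Cons x xs)
  then have "word_prod W (rev (x # xs)) = word_prod W (rev xs) \<otimes> x"
    using S_carrier word_prod_append'[of "rev xs" "[x]"] by (auto simp: in_lists_conv_set)
  then show ?case
    using Cons S_carrier S_inv word_prod_closed[of xs] by (auto simp: inv_mult_group)
qed simp

text \<open>Generators are their own inverses, so words without inverse letters suffice.\<close>

lemma generate_word:
  assumes "J \<subseteq> S" "u \<in> generate W J"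
  obtains ws where "ws \<in> lists J" "u = word_prod W ws"
proof -
  have "\<exists>ws \<in> lists J. u = word_prod W ws"
    using assms(2)
  proof induction
    case one
    show ?case by (rule bexI[of _ "[]"]) auto
  next
    case (incl h)
    then show ?case using assms(1) S_carrier by (intro bexI[of _ "[h]"]) auto
  next
    case (inv h)
    then show ?case using assms(1) S_carrier S_inv by (intro bexI[of _ "[h]"]) auto
  next
    case (eng h1 h2)
    then obtain w1 w2 where w: "w1 \<in> lists J" "h1 = word_prod W w1" "w2 \<in> lists J" "h2 = word_prod W w2"
      by blast
    moreover have "w1 \<in> lists S" "w2 \<in> lists S"
      using w assms(1) by auto
    ultimately show ?case
      using word_prod_append'[of w1 w2] by (intro bexI[of _ "w1 @ w2"]) auto
  qed
  then show thesis using that by blast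
qed

lemma word_generate:
  assumes "J \<subseteq> S" "ws \<in> lists J"
  shows "word_prod W ws \<in> generate W J"
  using assms(2) by (induction ws) (auto intro: generate.intros)

lemma length_word_prod_le: "ws \<in> lists S \<Longrightarrow> \<ell> (word_prod W ws) \<le> length ws"
  unfolding cox_length_def by (rule Least_le) blast

lemma reduced_word:
  assumes "w \<in> carrier W"
  obtains ws where "ws \<in> lists S" "length ws = \<ell> w" "word_prod W ws = w"
proof -
  obtain vs where "vs \<in> lists S" "w = word_prod W vs"
    using generate_word[of S w] generators assms by auto
  then have "\<exists>n. \<exists>ws \<in> lists S. length ws = n \<and> word_prod W ws = w"
    by blast
  from LeastI_ex[OF this] show thesis
    using that unfolding cox_length_def by blast
qed

lemma length_one [simp]: "\<ell> \<one> = 0"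
  using length_word_prod_le[of "[]"] by simp

lemma length_eq_0: assumes "w \<in> carrier W" "\<ell> w = 0" shows "w = \<one>"
  using reduced_word[OF assms(1)] assms(2) by (metis length_0_conv word_prod_simps(1))

lemma length_left_le: assumes "s \<in> S" "w \<in> carrier W" shows "\<ell> (s \<otimes> w) \<le> Suc (\<ell> w)"
proof -
  obtain ws where "ws \<in> lists S" "length ws = \<ell> w" "word_prod W ws = w"
    using reduced_word[OF assms(2)] .
  then show ?thesis
    using assms length_word_prod_le[of "s # ws"] by auto
qed

lemma length_right_le: assumes "s \<in> S" "w \<in> carrier W" shows "\<ell> (w \<otimes> s) \<le> Suc (\<ell> w)"
proof -
  obtain ws where "ws \<in> lists S" "length ws = \<ell> w" "word_prod W ws = w"
    using reduced_word[OF assms(2)] .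
  then show ?thesis
    using assms length_word_prod_le[of "ws @ [s]"] word_prod_append'[of ws "[s]"] S_carrier by auto
qed

text \<open>A relator has length twice the order of \<open>s \<otimes> t\<close>, an even number
  also when infinite order is recorded as 0. Parity of word length thus descends to
  \<open>W\<close>: it is the sign character in disguise.\<close>

lemma congruence_parity:
  "coxeter_congruence W S xs ys \<Longrightarrow> even (length xs) = even (length ys)"
proof (induction rule: coxeter_congruence.induct)
  case (relator s t xs ys)
  have "even (length (concat (replicate n [s, t])))" for n
    by (induction n) auto
  then show ?case by simp
qed auto

lemma word_parity:
  assumes "xs \<in> lists S" "ys \<in> lists S" "word_prod W xs = word_prod W ys"
  shows "even (length xs) = even (length ys)"
proof -
  have "word_prod W (xs @ rev ys) = \<one>"
    using assms word_prod_append'[of xs "rev ys"] word_prod_rev[of ys] word_prod_closed[of ys]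
    by (auto simp: in_lists_conv_set)
  moreover have "xs @ rev ys \<in> lists S"
    using assms by auto
  ultimately have "even (length (xs @ rev ys))"
    using congruence_parity[OF presentation[of "xs @ rev ys"]] by simp
  then show ?thesis by auto
qed

lemma length_left_parity: assumes "s \<in> S" "w \<in> carrier W" shows "even (\<ell> (s \<otimes> w)) \<noteq> even (\<ell> w)"
proof -
  obtain ws where ws: "ws \<in> lists S" "length ws = \<ell> w" "word_prod W ws = w"
    using reduced_word[OF assms(2)] .
  have "s \<otimes> w \<in> carrier W" using assms S_carrier by auto
  then obtain vs where vs: "vs \<in> lists S" "length vs = \<ell> (s \<otimes> w)" "word_prod W vs = s \<otimes> w"
    using reduced_word by blast
  show ?thesis
    using word_parity[of vs "s # ws"] ws vs assms by auto
qed

lemma length_right_parity: assumes "s \<in> S" "w \<in> carrier W" shows "even (\<ell> (w \<otimes> s)) \<noteq> even (\<ell> w)"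
proof -
  obtain ws where ws: "ws \<in> lists S" "length ws = \<ell> w" "word_prod W ws = w"
    using reduced_word[OF assms(2)] .
  have "w \<otimes> s \<in> carrier W" using assms S_carrier by auto
  then obtain vs where vs: "vs \<in> lists S" "length vs = \<ell> (w \<otimes> s)" "word_prod W vs = w \<otimes> s"
    using reduced_word by blast
  show ?thesis
    using word_parity[of vs "ws @ [s]"] word_prod_append'[of ws "[s]"] S_carrier ws vs assms by auto
qed

text \<open>A generator changes the length by at most one, and parity excludes no change. Later case
  distinctions on descents rest on this dichotomy.\<close>

lemma length_left_cases:
  assumes "s \<in> S" "w \<in> carrier W"
  shows "\<ell> (s \<otimes> w) = Suc (\<ell> w) \<or> \<ell> w = Suc (\<ell> (s \<otimes> w))"
proof -
  have "\<ell> w \<le> Suc (\<ell> (s \<otimes> w))"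
    using length_left_le[of s "s \<otimes> w"] assms S_carrier S_cancel_left by auto
  moreover have "\<ell> (s \<otimes> w) \<noteq> \<ell> w"
    using length_left_parity[OF assms] by metis
  ultimately show ?thesis
    using length_left_le[OF assms] by linarith
qed

lemma length_right_cases:
  assumes "s \<in> S" "w \<in> carrier W"
  shows "\<ell> (w \<otimes> s) = Suc (\<ell> w) \<or> \<ell> w = Suc (\<ell> (w \<otimes> s))"
proof -
  have "\<ell> w \<le> Suc (\<ell> (w \<otimes> s))"
    using length_right_le[of s "w \<otimes> s"] assms S_carrier S_cancel_right by auto
  moreover have "\<ell> (w \<otimes> s) \<noteq> \<ell> w"
    using length_right_parity[OF assms] by metis
  ultimately show ?thesis
    using length_right_le[OF assms] by linarith
qed

lemma length_gen: assumes "s \<in> S" shows "\<ell> s = 1"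
  using length_left_cases[OF assms one_closed] S_carrier[OF assms] by auto

text \<open>Drives the inductions on length: with \<open>w = s \<otimes> v\<close> and additive
  lengths, \<open>T w = T s * T v\<close>.\<close>

lemma left_descent_exists:
  assumes "w \<in> carrier W" "w \<noteq> \<one>"
  obtains s v where "s \<in> S" "v \<in> carrier W" "w = s \<otimes> v" "\<ell> w = Suc (\<ell> v)"
proof -
  obtain ws where ws: "ws \<in> lists S" "length ws = \<ell> w" "word_prod W ws = w"
    using reduced_word[OF assms(1)] .
  then obtain s vs where e: "ws = s # vs"
    using assms(2) by (cases ws) auto
  then have "\<ell> (word_prod W vs) \<le> length vs" "s \<in> S" "word_prod W vs \<in> carrier W"
    using ws length_word_prod_le[of vs] word_prod_closed[of vs] by auto
  then show thesis
    using that[of s "word_prod W vs"] ws e length_left_le[of s "word_prod W vs"] by auto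
qed

end


section \<open>Scalars and linear combinations\<close>

text \<open>One notion for \<open>A\<close>, for C(q) and for the polynomial and Laurent subrings,
  so that facts about spans are proved once for all of them.\<close>

definition scalar_ring :: "'a::ring_1 set \<Rightarrow> bool" where
  "scalar_ring R \<longleftrightarrow> 1 \<in> R \<and> (\<forall>x \<in> R. \<forall>y \<in> R. x - y \<in> R \<and> x * y \<in> R)"

lemma scalar_ring_UNIV [simp]: "scalar_ring UNIV"
  by (simp add: scalar_ring_def)

lemma scalar_ring_subring_gen [simp]: "scalar_ring (subring_gen X)"
  by (auto simp: scalar_ring_def intro: subring_gen.intros)

lemma scalar_ring_0: "scalar_ring R \<Longrightarrow> 0 \<in> R"
  unfolding scalar_ring_def by (metis diff_self)

lemma scalar_ring_1: "scalar_ring R \<Longrightarrow> 1 \<in> R"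
  by (simp add: scalar_ring_def)

lemma scalar_ring_diff: "scalar_ring R \<Longrightarrow> x \<in> R \<Longrightarrow> y \<in> R \<Longrightarrow> x - y \<in> R"
  by (simp add: scalar_ring_def)

lemma scalar_ring_mult: "scalar_ring R \<Longrightarrow> x \<in> R \<Longrightarrow> y \<in> R \<Longrightarrow> x * y \<in> R"
  by (simp add: scalar_ring_def)

lemma scalar_ring_uminus: "scalar_ring R \<Longrightarrow> x \<in> R \<Longrightarrow> - x \<in> R"
  using scalar_ring_diff[of R 0 x] scalar_ring_0 by auto

lemma scalar_ring_add: "scalar_ring R \<Longrightarrow> x \<in> R \<Longrightarrow> y \<in> R \<Longrightarrow> x + y \<in> R"
  using scalar_ring_diff[of R x "- y"] scalar_ring_uminus by auto

lemma scalar_ring_power: "scalar_ring R \<Longrightarrow> x \<in> R \<Longrightarrow> x ^ n \<in> R"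
  by (induction n) (auto simp: scalar_ring_1 scalar_ring_mult)

lemmas scalar_ring_intros = scalar_ring_0 scalar_ring_1 scalar_ring_add scalar_ring_diff
  scalar_ring_mult scalar_ring_uminus scalar_ring_power

lemma subring_gen_subset:
  assumes "scalar_ring R" "X \<subseteq> R" shows "subring_gen X \<subseteq> R"
proof
  fix x assume "x \<in> subring_gen X"
  then show "x \<in> R"
    by induction (use assms in \<open>auto simp: scalar_ring_intros\<close>)
qed

section \<open>Polynomiality and degrees in \<open>q\<close>\<close>

lemma q_nonzero [simp]: "q \<noteq> 0"
  by (simp add: q_def Zero_fract_def eq_fract)

lemma q_power: "q ^ n = Fract (monom 1 n) 1"
proof (induction n)
  case (Suc n)
  then show ?case by (simp add: q_def monom_Suc)
qed (simp add: One_fract_def)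

lemma subring_gen_q: "p \<in> subring_gen {q} \<Longrightarrow> \<exists>f. p = Fract f 1"
proof (induction rule: subring_gen.induct)
  case (incl x) then show ?case by (auto simp: q_def)
qed (auto simp: One_fract_def)

text \<open>Elements of Z[q^-1] are regular at infinity. The bound \<open>degree f \<le> n\<close>
  after clearing denominators by \<open>q ^ n\<close> says this in terms of polynomials.\<close>

lemma subring_gen_inverse_q:
  "p \<in> subring_gen {inverse q} \<Longrightarrow> \<exists>f n. p * q ^ n = Fract f 1 \<and> degree f \<le> n"
proof (induction rule: subring_gen.induct)
  case one
  then show ?case by (intro exI[of _ 1] exI[of _ 0]) (simp add: One_fract_def)
next
  case (incl x)
  then show ?case by (intro exI[of _ 1] exI[of _ 1]) (simp add: One_fract_def)
next
  case (diff x y)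
  then obtain f n g m where *: "x * q ^ n = Fract f 1" "degree f \<le> n"
    "y * q ^ m = Fract g 1" "degree g \<le> m" by blast
  have "(x - y) * q ^ (n + m) = (x * q ^ n) * q ^ m - (y * q ^ m) * q ^ n"
    by (simp add: power_add algebra_simps)
  also have "\<dots> = Fract (f * monom 1 m - g * monom 1 n) 1"
    by (simp only: *) (simp add: q_power)
  finally show ?case
    using * degree_mult_le[of f "monom 1 m"] degree_mult_le[of g "monom 1 n"]
    by (intro exI[of _ "f * monom 1 m - g * monom 1 n"] exI[of _ "n + m"] conjI degree_diff_le)
      (auto simp: degree_monom_eq)
next
  case (mult x y)
  then obtain f n g m where *: "x * q ^ n = Fract f 1" "degree f \<le> n"
    "y * q ^ m = Fract g 1" "degree g \<le> m" by blast
  have "(x * y) * q ^ (n + m) = (x * q ^ n) * (y * q ^ m)"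
    by (simp add: power_add algebra_simps)
  also have "\<dots> = Fract (f * g) 1"
    by (simp only: *) simp
  finally show ?case
    using * degree_mult_le[of f g] by (intro exI[of _ "f * g"] exI[of _ "n + m"]) auto
qed

text \<open>A function vanishing at infinity and polynomial in \<open>q\<close> is zero; the proof
  compares degrees. It is the source of all uniqueness in Kazhdan-Lusztig arguments.\<close>

lemma neg_coeffs_inter_nonneg:
  assumes "p \<in> neg_coeffs" "p \<in> subring_gen {q}"
  shows "p = 0"
proof -
  obtain r where r: "p = inverse q * r" "r \<in> subring_gen {inverse q}"
    using assms(1) by (auto simp: neg_coeffs_def)
  obtain f n where f: "r * q ^ n = Fract f 1" "degree f \<le> n"
    using subring_gen_inverse_q[OF r(2)] by blast
  obtain g where g: "p = Fract g 1"
    using subring_gen_q[OF assms(2)] by blast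
  have "p * q ^ Suc n = (inverse q * q) * (r * q ^ n)"
    by (simp add: r(1) ac_simps)
  then have "p * q ^ Suc n = Fract f 1"
    by (simp add: f(1))
  then have "g * monom 1 (Suc n) = f"
    unfolding g q_power by (simp add: eq_fract)
  then have "degree g + Suc n \<le> n" if "g \<noteq> 0"
    using f(2) that by (auto simp: degree_mult_eq degree_monom_eq)
  then have "g = 0" by fastforce
  then show ?thesis by (simp add: g Zero_fract_def)
qed

text \<open>The sum is a polynomial with value \<open>card A\<close> at 1, non-zero in
  characteristic zero. This makes the Poincare polynomial invertible in C(q).\<close>

lemma sum_q_powers_nonzero:
  assumes "finite A" "A \<noteq> {}"
  shows "(\<Sum>a \<in> A. q ^ f a) \<noteq> 0"
proof -
  have "(\<Sum>a \<in> A. q ^ f a) = Fract (\<Sum>a \<in> A. monom 1 (f a)) 1"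
    using assms(1)
  proof induction
    case (insert x F) then show ?case by (simp add: q_power)
  qed (simp add: Zero_fract_def)
  moreover have "poly (\<Sum>a \<in> A. monom 1 (f a)) (1 :: complex) = of_nat (card A)"
    by (simp add: poly_sum poly_monom)
  then have "(\<Sum>a \<in> A. monom 1 (f a)) \<noteq> (0 :: complex poly)"
    using assms by (metis card_eq_0_iff of_nat_eq_0_iff poly_0)
  ultimately show ?thesis
    by (simp add: Zero_fract_def eq_fract)
qed

lemma coeff_ring_ring: "scalar_ring (coeff_ring W S J)"
  by (simp add: coeff_ring_def)

lemma q_coeff_ring: "q \<in> coeff_ring W S J" "inverse q \<in> coeff_ring W S J"
  and inverse_poincare_coeff_ring: "inverse (poincare W S J) \<in> coeff_ring W S J"
  by (auto simp: coeff_ring_def intro: subring_gen.intros)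

lemma laurent_subset_coeff_ring: "subring_gen {q, inverse q} \<subseteq> coeff_ring W S J"
  by (intro subring_gen_subset coeff_ring_ring) (simp add: q_coeff_ring)

lemma neg_coeffs_subset: "neg_coeffs \<subseteq> subring_gen {inverse q}"
  by (auto simp: neg_coeffs_def intro: subring_gen.intros)

lemma neg_coeffs_0: "0 \<in> neg_coeffs"
  using scalar_ring_0[of "subring_gen {inverse q}"] by (auto simp: neg_coeffs_def image_iff)

lemma neg_coeffs_mult: "p \<in> subring_gen {inverse q} \<Longrightarrow> inverse q * p \<in> neg_coeffs"
  by (auto simp: neg_coeffs_def)

lemma neg_coeffs_diff: "x \<in> neg_coeffs \<Longrightarrow> y \<in> neg_coeffs \<Longrightarrow> x - y \<in> neg_coeffs"
  unfolding neg_coeffs_def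
  by (auto simp: right_diff_distrib[symmetric] intro!: imageI subring_gen.diff)

section \<open>Linear combinations and coordinates over subrings of C(q)\<close>

locale ratfun_space = vector_space scale
  for scale :: "ratfun \<Rightarrow> 'h \<Rightarrow> 'h::ab_group_add"
begin

lemma lincombs_zero: "0 \<in> lincombs R scale B I"
  unfolding lincombs_def by (rule CollectI) (rule exI[of _ "{}"], simp)

lemma lincombs_incl: "scalar_ring R \<Longrightarrow> i \<in> I \<Longrightarrow> B i \<in> lincombs R scale B I"
  unfolding lincombs_def
  by (rule CollectI, intro exI[of _ "{i}"] exI[of _ "\<lambda>_. 1"]) (auto simp: scalar_ring_1)

lemma lincombs_mono: "R \<subseteq> R' \<Longrightarrow> I \<subseteq> I' \<Longrightarrow> lincombs R scale B I \<subseteq> lincombs R' scale B I'"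
  unfolding lincombs_def
  by (rule Collect_mono) (intro impI, elim exE conjE, intro exI conjI, assumption+, (rule subset_trans, assumption+)+)

lemma lincombs_add:
  assumes "scalar_ring R" "x \<in> lincombs R scale B I" "y \<in> lincombs R scale B I"
  shows "x + y \<in> lincombs R scale B I"
proof -
  obtain F c G d where x: "x = (\<Sum>i \<in> F. scale (c i) (B i))" "finite F" "F \<subseteq> I" "c ` F \<subseteq> R"
    and y: "y = (\<Sum>i \<in> G. scale (d i) (B i))" "finite G" "G \<subseteq> I" "d ` G \<subseteq> R"
    using assms(2,3) unfolding lincombs_def by blast
  define a where "a i = (if i \<in> F then c i else 0) + (if i \<in> G then d i else 0)" for i
  have "x = (\<Sum>i \<in> F \<union> G. scale (if i \<in> F then c i else 0) (B i))"
    unfolding x(1) by (rule sum.mono_neutral_cong_left) (use x y in auto)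
  moreover have "y = (\<Sum>i \<in> F \<union> G. scale (if i \<in> G then d i else 0) (B i))"
    unfolding y(1) by (rule sum.mono_neutral_cong_left) (use x y in auto)
  ultimately have "x + y = (\<Sum>i \<in> F \<union> G. scale (a i) (B i))"
    by (simp add: sum.distrib scale_left_distrib a_def)
  moreover have "a i \<in> R" if "i \<in> F \<union> G" for i
    using x(4) y(4) unfolding a_def by (intro scalar_ring_add assms) (auto simp: scalar_ring_0 assms)
  ultimately show ?thesis
    unfolding lincombs_def using x y by (intro CollectI exI[of _ "F \<union> G"] exI[of _ a]) auto
qed

lemma lincombs_scale:
  assumes "scalar_ring R" "a \<in> R" "x \<in> lincombs R scale B I"
  shows "scale a x \<in> lincombs R scale B I"
proof -
  obtain F c where x: "x = (\<Sum>i \<in> F. scale (c i) (B i))" "finite F" "F \<subseteq> I" "c ` F \<subseteq> R"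
    using assms(3) unfolding lincombs_def by blast
  show ?thesis
    unfolding lincombs_def using x assms
    by (intro CollectI exI[of _ F] exI[of _ "\<lambda>i. a * c i"])
      (auto simp: scale_sum_right scalar_ring_mult)
qed

lemma lincombs_uminus:
  "scalar_ring R \<Longrightarrow> x \<in> lincombs R scale B I \<Longrightarrow> - x \<in> lincombs R scale B I"
  using lincombs_scale[of R "-1" x B I] by (simp add: scalar_ring_intros)

lemma lincombs_diff:
  "scalar_ring R \<Longrightarrow> x \<in> lincombs R scale B I \<Longrightarrow> y \<in> lincombs R scale B I \<Longrightarrow>
    x - y \<in> lincombs R scale B I"
  using lincombs_add[of R x B I "- y"] lincombs_uminus[of R y B I] by simp

lemma lincombs_sum:
  "scalar_ring R \<Longrightarrow> (\<And>i. i \<in> F \<Longrightarrow> f i \<in> lincombs R scale B I) \<Longrightarrow>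
    (\<Sum>i \<in> F. f i) \<in> lincombs R scale B I"
  by (induction F rule: infinite_finite_induct) (auto simp: lincombs_zero lincombs_add)

lemma lincombs_induct [consumes 1, case_names zero add scale base]:
  assumes "h \<in> lincombs R scale B I"
    and "P 0" and "\<And>x y. P x \<Longrightarrow> P y \<Longrightarrow> P (x + y)"
    and "\<And>a x. a \<in> R \<Longrightarrow> P x \<Longrightarrow> P (scale a x)" and "\<And>i. i \<in> I \<Longrightarrow> P (B i)"
  shows "P h"
proof -
  obtain F c where x: "h = (\<Sum>i \<in> F. scale (c i) (B i))" "finite F" "F \<subseteq> I" "c ` F \<subseteq> R"
    using assms(1) unfolding lincombs_def by blast
  show ?thesis
    unfolding x(1) using x(2-4) by induction (use assms in auto)
qed

lemma lincombs_subset: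
  assumes "scalar_ring R" "\<And>i. i \<in> I \<Longrightarrow> B i \<in> lincombs R scale B' I'"
  shows "lincombs R scale B I \<subseteq> lincombs R scale B' I'"
proof
  fix x assume "x \<in> lincombs R scale B I"
  then show "x \<in> lincombs R scale B' I'"
    by (induction rule: lincombs_induct)
      (auto simp: assms lincombs_zero lincombs_add lincombs_scale)
qed

lemma lincombs_UNIV: "lincombs UNIV scale B I = span (B ` I)"
proof
  show "lincombs UNIV scale B I \<subseteq> span (B ` I)"
    by (auto simp: lincombs_def intro!: span_sum span_scale intro: span_base)
  show "span (B ` I) \<subseteq> lincombs UNIV scale B I"
    by (rule span_minimal)
      (auto intro!: subspaceI lincombs_incl lincombs_zero lincombs_add lincombs_scale)
qed

lemma lincombs_subset_span: "lincombs R scale B I \<subseteq> span (B ` I)"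
  using lincombs_mono[of R UNIV I I B] lincombs_UNIV by auto

text \<open>Injectivity is demanded separately because independence of the image says nothing about
  repetitions in the family.\<close>

definition basis_on :: "('i \<Rightarrow> 'h) \<Rightarrow> 'i set \<Rightarrow> bool" where
  "basis_on B I \<longleftrightarrow> inj_on B I \<and> independent (B ` I)"

text \<open>Coefficients are addressed by indices instead of vectors, so that coordinates in
  \<open>T\<close>, in the dagger basis and in the corner basis can be compared at the same
  \<open>w\<close>.\<close>

definition coord :: "('i \<Rightarrow> 'h) \<Rightarrow> 'i set \<Rightarrow> 'h \<Rightarrow> 'i \<Rightarrow> ratfun" where
  "coord B I h i = representation (B ` I) h (B i)"

lemma basis_onI:
  assumes "\<And>F c. \<lbrakk>finite F; F \<subseteq> I; (\<Sum>i \<in> F. scale (c i) (B i)) = 0\<rbrakk> \<Longrightarrow> \<forall>i \<in> F. c i = 0"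
  shows "basis_on B I"
proof -
  have inj: "inj_on B I"
  proof (rule inj_onI, rule ccontr)
    fix i j assume *: "i \<in> I" "j \<in> I" "B i = B j" "i \<noteq> j"
    \<comment> \<open>A repeated vector gives the relation \<open>B i - B j = 0\<close>, with
      coefficients 1 and -1.\<close>
    then have "\<forall>k \<in> {i, j}. (if k = i then 1 else -1 :: ratfun) = 0"
      by (intro assms) auto
    then show False by simp
  qed
  have "independent (B ` I)"
  proof
    assume "dependent (B ` I)"
    then obtain t u where t: "finite t" "t \<subseteq> B ` I" "\<exists>v \<in> t. u v \<noteq> 0"
      "(\<Sum>v \<in> t. scale (u v) v) = 0"
      unfolding dependent_explicit by blast
    obtain F where F: "F \<subseteq> I" "t = B ` F"
      using t(2) by (meson subset_imageE)
    have inj': "inj_on B F" using inj F(1) inj_on_subset by blast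
    then have "(\<Sum>i \<in> F. scale (u (B i)) (B i)) = 0"
      using t(4) F by (simp add: sum.reindex)
    moreover have "finite F" using t(1) F(2) inj' by (simp add: finite_image_iff)
    ultimately have "\<forall>i \<in> F. u (B i) = 0" using F by (intro assms)
    then show False using t(3) F by auto
  qed
  then show ?thesis using inj by (simp add: basis_on_def)
qed

context
  fixes B :: "'i \<Rightarrow> 'h" and I :: "'i set"
  assumes basis: "basis_on B I"
begin

lemma coord_add:
  "x \<in> span (B ` I) \<Longrightarrow> y \<in> span (B ` I) \<Longrightarrow> coord B I (x + y) i = coord B I x i + coord B I y i"
  using basis by (simp add: coord_def basis_on_def representation_add)

lemma coord_diff:
  "x \<in> span (B ` I) \<Longrightarrow> y \<in> span (B ` I) \<Longrightarrow> coord B I (x - y) i = coord B I x i - coord B I y i"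
  using basis by (simp add: coord_def basis_on_def representation_diff)

lemma coord_scale: "x \<in> span (B ` I) \<Longrightarrow> coord B I (scale a x) i = a * coord B I x i"
  using basis by (simp add: coord_def basis_on_def representation_scale)

lemma coord_zero [simp]: "coord B I 0 i = 0"
  using basis by (simp add: coord_def basis_on_def representation_zero)

lemma coord_base: "i \<in> I \<Longrightarrow> j \<in> I \<Longrightarrow> coord B I (B j) i = (if i = j then 1 else 0)"
  using basis by (auto simp: coord_def basis_on_def representation_basis inj_on_def)

lemma coord_sum:
  "(\<And>j. j \<in> F \<Longrightarrow> f j \<in> span (B ` I)) \<Longrightarrow> coord B I (\<Sum>j \<in> F. f j) i = (\<Sum>j \<in> F. coord B I (f j) i)"
  by (induction F rule: infinite_finite_induct) (auto simp: coord_add span_sum)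

lemma coord_lincomb:
  assumes "finite F" "F \<subseteq> I" "i \<in> I"
  shows "coord B I (\<Sum>j \<in> F. scale (c j) (B j)) i = (if i \<in> F then c i else 0)"
proof -
  have *: "B j \<in> span (B ` I)" if "j \<in> F" for j
    using that assms by (auto intro: span_base)
  have "coord B I (\<Sum>j \<in> F. scale (c j) (B j)) i = (\<Sum>j \<in> F. coord B I (scale (c j) (B j)) i)"
    by (rule coord_sum) (simp add: * span_scale)
  also have "\<dots> = (\<Sum>j \<in> F. if i = j then c j else 0)"
    by (rule sum.cong) (use assms * in \<open>auto simp: coord_scale coord_base subset_iff\<close>)
  finally show ?thesis using assms by simp
qed

lemma coord_finite: "finite {i \<in> I. coord B I x i \<noteq> 0}"
proof (rule finite_imageD)
  have "B ` {i \<in> I. coord B I x i \<noteq> 0} \<subseteq> {v. representation (B ` I) x v \<noteq> 0}"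
    by (auto simp: coord_def)
  then show "finite (B ` {i \<in> I. coord B I x i \<noteq> 0})"
    using finite_representation finite_subset by blast
  show "inj_on B {i \<in> I. coord B I x i \<noteq> 0}"
    using basis by (auto simp: basis_on_def inj_on_def)
qed

lemma coord_expand:
  assumes "x \<in> span (B ` I)"
  shows "x = (\<Sum>i | i \<in> I \<and> coord B I x i \<noteq> 0. scale (coord B I x i) (B i))"
proof -
  obtain F c where F: "x = (\<Sum>i \<in> F. scale (c i) (B i))" "finite F" "F \<subseteq> I"
    using assms unfolding lincombs_UNIV[symmetric] lincombs_def by blast
  have "coord B I x i = (if i \<in> F then c i else 0)" if "i \<in> I" for i
    unfolding F(1) using F(2,3) that by (rule coord_lincomb)
  then show ?thesis
    by (subst F(1), intro sum.mono_neutral_cong_right) (use F(2,3) in \<open>auto split: if_splits\<close>)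
qed

text \<open>Membership in a span over \<open>R\<close> becomes a pointwise condition. Indices
  outside the support have coordinate 0, whence \<open>0 \<in> R\<close>.\<close>

lemma lincombs_iff:
  assumes "I' \<subseteq> I" "0 \<in> R"
  shows "h \<in> lincombs R scale B I' \<longleftrightarrow>
    h \<in> span (B ` I) \<and> (\<forall>i \<in> I. coord B I h i \<in> R \<and> (coord B I h i \<noteq> 0 \<longrightarrow> i \<in> I'))"
proof
  assume "h \<in> lincombs R scale B I'"
  then obtain F c where F: "h = (\<Sum>i \<in> F. scale (c i) (B i))" "finite F" "F \<subseteq> I'" "c ` F \<subseteq> R"
    unfolding lincombs_def by blast
  have "coord B I h i = (if i \<in> F then c i else 0)" if "i \<in> I" for i
    unfolding F(1) using F(2,3) assms(1) that by (intro coord_lincomb) auto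
  moreover have "h \<in> span (B ` I)"
    unfolding F(1) by (intro span_sum span_scale span_base) (use F assms in auto)
  ultimately show "h \<in> span (B ` I) \<and> (\<forall>i \<in> I. coord B I h i \<in> R \<and> (coord B I h i \<noteq> 0 \<longrightarrow> i \<in> I'))"
    using F assms by auto
next
  assume *: "h \<in> span (B ` I) \<and> (\<forall>i \<in> I. coord B I h i \<in> R \<and> (coord B I h i \<noteq> 0 \<longrightarrow> i \<in> I'))"
  then show "h \<in> lincombs R scale B I'"
    unfolding lincombs_def
    by (intro CollectI exI[of _ "{i \<in> I. coord B I h i \<noteq> 0}"] exI[of _ "coord B I h"])
      (use coord_expand coord_finite in auto)
qed

end

end


section \<open>The exchange condition and minimal double coset representatives\<close>

text \<open>The multiplication rules only concern products with a left factor \<open>T s\<close>, so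
  for empty \<open>S\<close> they would leave \<open>T \<one>\<close> an arbitrary non-zero scalar.
  In the application \<open>S\<close> contains the non-empty \<open>J\<close>.\<close>

locale coxeter_hecke = coxeter_system W S + hecke_algebra W S scale T
  for W :: "('w, 'z) monoid_scheme" (structure) and S :: "'w set"
    and scale :: "ratfun \<Rightarrow> 'h \<Rightarrow> 'h::ring_1" and T :: "'w \<Rightarrow> 'h" +
  assumes S_nonempty: "S \<noteq> {}"
begin

sublocale ratfun_space scale ..

lemma basis_T: "basis_on T (carrier W)"
  using T_basis by (simp add: basis_on_def)

lemma T_induct [case_names zero add scale base]:
  assumes "P 0" and "\<And>x y. P x \<Longrightarrow> P y \<Longrightarrow> P (x + y)"
    and "\<And>a x. P x \<Longrightarrow> P (scale a x)" and "\<And>w. w \<in> carrier W \<Longrightarrow> P (T w)"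
  shows "P h"
proof -
  have "h \<in> lincombs UNIV scale T (carrier W)"
    by (simp add: lincombs_UNIV T_basis)
  then show ?thesis by (induction rule: lincombs_induct) (use assms in auto)
qed

lemma scale_one_mult: "scale a 1 * x = scale a x" "x * scale a 1 = scale a x"
  by (simp_all add: algebra)

lemma T_left:
  assumes "s \<in> S" "w \<in> carrier W"
  shows "T s * T w = T (s \<otimes> w) + (if \<ell> (s \<otimes> w) < \<ell> w then scale (q - inverse q) (T w) else 0)"
  using T_up[OF assms] T_down[OF assms] length_left_cases[OF assms] by auto

text \<open>That \<open>T \<one>\<close> is the unit has to be derived: splitting off left descents
  shows that it is a right identity on each \<open>T w\<close>, hence on the whole algebra, and a
  right identity equals 1.\<close>

lemma T_one: "T \<one> = 1"
proof -
  have gen: "T s * T \<one> = T s" if "s \<in> S" for s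
    using T_up[of s \<one>] that S_carrier length_gen by auto
  have ne: "T w * T \<one> = T w" if "w \<in> carrier W" "w \<noteq> \<one>" for w
    using that
  proof (induction "\<ell> w" arbitrary: w)
    case 0 then show ?case using length_eq_0 by auto
  next
    case (Suc n)
    obtain s v where sv: "s \<in> S" "v \<in> carrier W" "w = s \<otimes> v" "\<ell> w = Suc (\<ell> v)"
      using left_descent_exists[OF Suc.prems] .
    have Tw: "T w = T s * T v" using T_up[of s v] sv by auto
    show ?case
    proof (cases "v = \<one>")
      case True
      then show ?thesis using sv gen S_carrier by auto
    next
      case False
      then have "T v * T \<one> = T v" using Suc sv by auto
      then show ?thesis by (simp add: Tw mult.assoc)
    qed
  qed
  obtain s where s: "s \<in> S" using S_nonempty by auto
  \<comment> \<open>\<open>T \<one>\<close> itself is reached through \<open>T s\<close>, on which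
    right multiplication by \<open>T \<one>\<close> is already known to be trivial.\<close>
  have "T \<one> = T s * T s - scale (q - inverse q) (T s)"
    using T_down[of s s] s S_square length_gen S_carrier by auto
  then have "T \<one> * T \<one> = T \<one>"
    using gen[OF s] by (metis algebra(1) left_diff_distrib mult.assoc)
  then have base: "T w * T \<one> = T w" if "w \<in> carrier W" for w
    using ne that by blast
  have "h * T \<one> = h" for h
    by (induction h rule: T_induct) (auto simp: base algebra distrib_right)
  from this[of 1] show ?thesis by simp
qed

text \<open>The rules give left multiplication only. Peeling a left descent \<open>t\<close> off
  \<open>w\<close> reduces to \<open>v \<otimes> s\<close>; since
  \<open>\<ell> (w \<otimes> s)\<close> exceeds \<open>\<ell> w\<close>, no length is lost on the
  way.\<close>

lemma T_right_up:
  assumes "s \<in> S" "w \<in> carrier W" "\<ell> w < \<ell> (w \<otimes> s)"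
  shows "T w * T s = T (w \<otimes> s)"
  using assms(2,3)
proof (induction "\<ell> w" arbitrary: w)
  case 0
  then have "w = \<one>" using length_eq_0 by auto
  then show ?case using assms S_carrier by (simp add: T_one)
next
  case (Suc n)
  then have "w \<noteq> \<one>" by auto
  then obtain t v where tv: "t \<in> S" "v \<in> carrier W" "w = t \<otimes> v" "\<ell> w = Suc (\<ell> v)"
    using left_descent_exists Suc.prems by metis
  have c: "v \<otimes> s \<in> carrier W" "t \<in> carrier W" "s \<in> carrier W" using tv assms S_carrier by auto
  have e: "w \<otimes> s = t \<otimes> (v \<otimes> s)" using tv c by (simp add: m_assoc)
  have "\<ell> (w \<otimes> s) \<le> Suc (\<ell> (v \<otimes> s))"
    unfolding e using length_left_le tv c by auto
  then have l: "\<ell> (v \<otimes> s) > \<ell> v"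
    using Suc.prems tv by auto
  then have "T v * T s = T (v \<otimes> s)"
    using Suc.hyps tv by auto
  moreover have "T w = T t * T v" using T_up[of t v] tv by auto
  moreover have "T t * T (v \<otimes> s) = T (w \<otimes> s)"
    unfolding e using T_up[of t "v \<otimes> s"] tv c l Suc.prems length_right_cases[OF assms(1) tv(2)] e by auto
  ultimately show ?case by (simp add: mult.assoc)
qed

lemma T_square: "s \<in> S \<Longrightarrow> T s * T s = scale (q - inverse q) (T s) + 1"
  using T_down[of s s] S_square length_gen S_carrier T_one by auto

lemma T_right:
  assumes "s \<in> S" "w \<in> carrier W"
  shows "T w * T s = T (w \<otimes> s) + (if \<ell> (w \<otimes> s) < \<ell> w then scale (q - inverse q) (T w) else 0)"
proof (cases "\<ell> (w \<otimes> s) < \<ell> w")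
  case True
  define v where "v = w \<otimes> s"
  have v: "v \<in> carrier W" "v \<otimes> s = w"
    using assms S_carrier S_cancel_right by (auto simp: v_def)
  have "T w = T v * T s"
    using T_right_up[OF assms(1) v(1)] True v(2) unfolding v_def[symmetric] by simp
  then have "T w * T s = T v * (T s * T s)" by (simp add: mult.assoc)
  also have "\<dots> = scale (q - inverse q) (T v * T s) + T v"
    by (simp add: T_square assms distrib_left algebra)
  finally show ?thesis using True \<open>T w = T v * T s\<close> by (simp add: v_def)
next
  case False
  then show ?thesis using T_right_up[OF assms] length_right_cases[OF assms] by auto
qed

lemma q_minus_inverse: "q - inverse q \<noteq> 0"
proof
  assume "q - inverse q = 0"
  then have "q * q = q * inverse q" by simp
  then have "q ^ 2 = 1" by (simp add: power2_eq_square)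
  then have "monom 1 2 = (1 :: complex poly)"
    unfolding q_power by (simp add: One_fract_def eq_fract)
  then have "degree (monom 1 2 :: complex poly) = 0" by simp
  then show False by (simp add: degree_monom_eq)
qed

text \<open>Associativity \<open>(T\<^sub>s T\<^sub>w) T\<^sub>t = T\<^sub>s (T\<^sub>w T\<^sub>t)\<close> replaces the geometric representation in the proof
  of the exchange condition.\<close>

lemma folding:
  assumes "s \<in> S" "t \<in> S" "w \<in> carrier W" "\<ell> w < \<ell> (s \<otimes> w)" "\<ell> w < \<ell> (w \<otimes> t)"
    and "\<ell> (s \<otimes> (w \<otimes> t)) < \<ell> (w \<otimes> t)"
  shows "s \<otimes> w = w \<otimes> t"
proof -
  have c: "s \<in> carrier W" "t \<in> carrier W" using assms S_carrier by auto
  have e: "s \<otimes> w \<otimes> t = s \<otimes> (w \<otimes> t)" using c assms m_assoc by auto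
  have l: "\<ell> (s \<otimes> w) = Suc (\<ell> w)" "\<ell> (w \<otimes> t) = Suc (\<ell> w)"
    using length_left_cases[OF assms(1,3)] length_right_cases[OF assms(2,3)] assms by auto
  have "(T s * T w) * T t = T (s \<otimes> w) * T t"
    using T_up assms by simp
  also have "\<dots> = T (s \<otimes> (w \<otimes> t)) + scale (q - inverse q) (T (s \<otimes> w))"
    using T_right[of t "s \<otimes> w"] assms c e l by simp
  finally have 1: "(T s * T w) * T t = T (s \<otimes> (w \<otimes> t)) + scale (q - inverse q) (T (s \<otimes> w))" .
  have "T s * (T w * T t) = T s * T (w \<otimes> t)"
    using T_right_up assms by simp
  also have "\<dots> = T (s \<otimes> (w \<otimes> t)) + scale (q - inverse q) (T (w \<otimes> t))"
    using T_left[of s "w \<otimes> t"] assms c by simp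
  \<comment> \<open>Cancelling the common term \<open>T (s \<otimes> (w \<otimes> t))\<close> and
    then the non-zero \<open>q - inverse q\<close> leaves an equality of two basis elements.\<close>
  finally have "scale (q - inverse q) (T (s \<otimes> w)) = scale (q - inverse q) (T (w \<otimes> t))"
    using 1 by (metis add_left_cancel mult.assoc)
  then have "T (s \<otimes> w) = T (w \<otimes> t)"
    using q_minus_inverse scale_left_imp_eq by blast
  then show ?thesis
    using T_basis(1) assms c by (auto simp: inj_on_def)
qed

text \<open>Induction on the word from its right end. Either \<open>s\<close> already shortens the
  prefix \<open>v\<close>, or it starts to shorten only with the last letter \<open>t\<close>; then
  \<open>folding\<close> gives \<open>s \<otimes> v = v \<otimes> t\<close>, and \<open>t\<close> is
  the letter to delete.\<close>

lemma left_exchange: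
  assumes "s \<in> S" "ws \<in> lists S" "length ws = \<ell> (word_prod W ws)"
    and "\<ell> (s \<otimes> word_prod W ws) < \<ell> (word_prod W ws)"
  shows "\<exists>xs t ys. ws = xs @ t # ys \<and> s \<otimes> word_prod W ws = word_prod W (xs @ ys)"
  using assms(2-)
proof (induction ws rule: rev_induct)
  case (snoc t ws)
  define v where "v = word_prod W ws"
  have in_S: "ws \<in> lists S" "t \<in> S" using snoc.prems by auto
  have c: "v \<in> carrier W" "s \<in> carrier W" "t \<in> carrier W"
    using in_S word_prod_closed S_carrier assms(1) by (auto simp: v_def)
  have e: "word_prod W (ws @ [t]) = v \<otimes> t"
    using in_S word_prod_append'[of ws "[t]"] c by (simp add: v_def)
  have l: "\<ell> v = length ws" "\<ell> (v \<otimes> t) = Suc (\<ell> v)"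
    using snoc.prems(2) length_word_prod_le[OF in_S(1)] length_right_le[OF in_S(2) c(1)]
    unfolding e by (auto simp: v_def)
  show ?case
  proof (cases "\<ell> (s \<otimes> v) < \<ell> v")
    case True
    then obtain xs t' ys where *: "ws = xs @ t' # ys" "s \<otimes> v = word_prod W (xs @ ys)"
      using snoc.IH in_S l unfolding v_def by auto
    have "s \<otimes> (v \<otimes> t) = word_prod W (xs @ ys) \<otimes> t"
      using *(2) c by (metis m_assoc)
    then have "s \<otimes> (v \<otimes> t) = word_prod W (xs @ (ys @ [t]))"
      using word_prod_append'[of "xs @ ys" "[t]"] * in_S c by (auto simp: in_lists_conv_set)
    then show ?thesis
      unfolding e using *(1) by (intro exI[of _ xs] exI[of _ t'] exI[of _ "ys @ [t]"]) simp
  next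
    case False
    then have "\<ell> v < \<ell> (s \<otimes> v)"
      using length_left_cases[OF assms(1) c(1)] by auto
    then have "s \<otimes> v = v \<otimes> t"
      using snoc.prems(3) l c in_S assms(1) unfolding e by (intro folding) auto
    then have "s \<otimes> (v \<otimes> t) = v"
      using S_cancel_left assms(1) c by metis
    then show ?thesis
      unfolding e v_def by (intro exI[of _ ws] exI[of _ t] exI[of _ "[]"]) simp
  qed
qed simp

lemma right_exchange:
  assumes "s \<in> S" "ws \<in> lists S" "length ws = \<ell> (word_prod W ws)"
    and "\<ell> (word_prod W ws \<otimes> s) < \<ell> (word_prod W ws)"
  shows "\<exists>xs t ys. ws = xs @ t # ys \<and> word_prod W ws \<otimes> s = word_prod W (xs @ ys)"
  using assms(2-)
proof (induction ws rule: list.induct)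
  case (Cons t ws)
  define v where "v = word_prod W ws"
  have in_S: "ws \<in> lists S" "t \<in> S" using Cons.prems(1) by simp_all
  have c: "v \<in> carrier W" "s \<in> carrier W" "t \<in> carrier W"
    using in_S word_prod_closed S_carrier assms(1) by (auto simp: v_def)
  have e: "word_prod W (t # ws) = t \<otimes> v"
    by (simp add: v_def)
  have l: "\<ell> v = length ws" "\<ell> (t \<otimes> v) = Suc (\<ell> v)"
    using Cons.prems(2) length_word_prod_le[OF in_S(1)] length_left_le[OF in_S(2) c(1)]
    unfolding e by (auto simp: v_def)
  show ?case
  proof (cases "\<ell> (v \<otimes> s) < \<ell> v")
    case True
    then obtain xs t' ys where *: "ws = xs @ t' # ys" "v \<otimes> s = word_prod W (xs @ ys)"
      using Cons.IH in_S l unfolding v_def by auto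
    have "t \<otimes> v \<otimes> s = word_prod W ((t # xs) @ ys)"
      using *(2) c by (simp add: m_assoc)
    then show ?thesis
      unfolding e using *(1) by (intro exI[of _ "t # xs"] exI[of _ t'] exI[of _ ys]) simp
  next
    case False
    then have 1: "\<ell> v < \<ell> (v \<otimes> s)"
      using length_right_cases[OF assms(1) c(1)] by auto
    have 2: "\<ell> (t \<otimes> (v \<otimes> s)) < \<ell> (v \<otimes> s)"
      using Cons.prems(3) l 1 length_right_cases[OF assms(1) c(1)] c unfolding e by (simp add: m_assoc)
    have "t \<otimes> v = v \<otimes> s"
      using l c in_S assms(1) 1 2 by (intro folding) auto
    then have "t \<otimes> v \<otimes> s = v"
      using S_cancel_right assms(1) c by metis
    then show ?thesis
      unfolding e v_def by (intro exI[of _ "[]"] exI[of _ t] exI[of _ ws]) simp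
  qed
qed simp

section \<open>Elements without descents in a double coset\<close>

lemma append3_split:
  "p @ w @ r = xs @ t # ys \<Longrightarrow>
    (\<exists>p1. p = xs @ t # p1 \<and> ys = p1 @ w @ r) \<or>
    (\<exists>w1 w2. w = w1 @ t # w2 \<and> xs = p @ w1 \<and> ys = w2 @ r) \<or>
    (\<exists>r1. r = r1 @ t # ys \<and> xs = p @ w @ r1)"
  by (auto simp: append_eq_append_conv2 append_eq_Cons_conv Cons_eq_append_conv)

definition no_descent :: "'w set \<Rightarrow> 'w \<Rightarrow> bool" where
  "no_descent J x \<longleftrightarrow> (\<forall>s \<in> J. \<ell> x < \<ell> (s \<otimes> x) \<and> \<ell> x < \<ell> (x \<otimes> s))"

context
  fixes J w
  assumes J: "J \<subseteq> S" and w: "w \<in> lists S" "length w = \<ell> (word_prod W w)"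
    and minimal: "\<And>u v. u \<in> generate W J \<Longrightarrow> v \<in> generate W J \<Longrightarrow>
      \<ell> (word_prod W w) \<le> \<ell> (u \<otimes> word_prod W w \<otimes> v)"
begin

text \<open>A reduced word for \<open>x\<close> with the fixed word \<open>w\<close> in the middle
  and letters of \<open>J\<close> around it: a length-additive factorisation through the minimal
  element of the double coset.\<close>

definition has_split :: "'w \<Rightarrow> bool" where
  "has_split x \<longleftrightarrow> (\<exists>p \<in> lists J. \<exists>r \<in> lists J.
    x = word_prod W (p @ w @ r) \<and> length (p @ w @ r) = \<ell> x)"

lemma word_prod_split:
  assumes "p \<in> lists J" "v \<in> lists S" "r \<in> lists J"
  shows "word_prod W (p @ v @ r) = word_prod W p \<otimes> word_prod W v \<otimes> word_prod W r"
    and "word_prod W p \<in> carrier W" "word_prod W v \<in> carrier W" "word_prod W r \<in> carrier W"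
    and "p @ v @ r \<in> lists S"
proof -
  have "p \<in> lists S" "r \<in> lists S" using assms J by auto
  then show "word_prod W (p @ v @ r) = word_prod W p \<otimes> word_prod W v \<otimes> word_prod W r"
    "word_prod W p \<in> carrier W" "word_prod W v \<in> carrier W" "word_prod W r \<in> carrier W"
    "p @ v @ r \<in> lists S"
    using assms(2) by (simp_all add: word_prod_append' word_prod_closed m_assoc in_lists_conv_set ball_Un)
qed

text \<open>Exchange deletes one letter. In \<open>p\<close> or \<open>r\<close> this keeps the
  shape, and the bound on \<open>\<ell> y\<close> makes the shorter word reduced. In
  \<open>w\<close> it would leave a middle factor shorter than \<open>w\<close>, against minimality,
  which \<open>inner\<close> states in the required form.\<close>

lemma has_split_step:
  assumes "p \<in> lists J" "r \<in> lists J" "length (p @ w @ r) = \<ell> (word_prod W (p @ w @ r))"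
    and "p @ w @ r = xs @ t # ys" "y = word_prod W (xs @ ys)"
    and y: "\<ell> (word_prod W (p @ w @ r)) \<le> Suc (\<ell> y)"
    and inner: "\<And>d. d \<in> carrier W \<Longrightarrow> y = word_prod W p \<otimes> d \<otimes> word_prod W r \<Longrightarrow>
      \<ell> (word_prod W w) \<le> \<ell> d"
  shows "has_split y"
  using append3_split[OF assms(4)]
proof (elim disjE exE conjE)
  fix p1 assume *: "p = xs @ t # p1" "ys = p1 @ w @ r"
  have in_J: "xs @ p1 \<in> lists J" using * assms(1) by (auto simp: in_lists_conv_set)
  have "length ((xs @ p1) @ w @ r) = \<ell> y"
    using length_word_prod_le[OF word_prod_split(5)[OF in_J w(1) assms(2)]] y assms(3,5) *
    by simp
  then show ?thesis
    unfolding has_split_def using in_J assms(2,5) *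
    by (intro bexI[of _ "xs @ p1"] bexI[of _ r]) simp_all
next
  fix r1 assume *: "r = r1 @ t # ys" "xs = p @ w @ r1"
  have in_J: "r1 @ ys \<in> lists J" using * assms(2) by (auto simp: in_lists_conv_set)
  have "length (p @ w @ (r1 @ ys)) = \<ell> y"
    using length_word_prod_le[OF word_prod_split(5)[OF assms(1) w(1) in_J]] y assms(3,5) *
    by simp
  then show ?thesis
    unfolding has_split_def using in_J assms(1,5) *
    by (intro bexI[of _ p] bexI[of _ "r1 @ ys"]) simp_all
next
  fix w1 w2 assume *: "w = w1 @ t # w2" "xs = p @ w1" "ys = w2 @ r"
  have in_S: "w1 @ w2 \<in> lists S" using * w by (auto simp: in_lists_conv_set)
  have "\<ell> (word_prod W w) \<le> \<ell> (word_prod W (w1 @ w2))"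
    using word_prod_split[OF assms(1) in_S assms(2)] * assms(5) by (intro inner) auto
  also have "\<dots> < length w" using length_word_prod_le[OF in_S] * by simp
  finally show ?thesis using w by simp
qed

lemma has_split_left: assumes "has_split x" "s \<in> J" shows "has_split (s \<otimes> x)"
proof -
  obtain p r where pr: "p \<in> lists J" "r \<in> lists J" and x: "x = word_prod W (p @ w @ r)"
    and l: "length (p @ w @ r) = \<ell> x"
    using assms unfolding has_split_def by blast
  note ws = word_prod_split[OF pr(1) w(1) pr(2)]
  have s: "s \<in> S" "s \<in> carrier W" using assms J S_carrier by auto
  have xc: "x \<in> carrier W" using ws x by auto
  have subJ: "subgroup (generate W J) W"
    using generate_is_subgroup J generators(1) by blast
  show ?thesis
  proof (cases "\<ell> (s \<otimes> x) < \<ell> x")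
    case True
    then obtain xs t ys where *: "p @ w @ r = xs @ t # ys" "s \<otimes> x = word_prod W (xs @ ys)"
      using left_exchange[OF s(1) ws(5)] l x by auto
    show ?thesis
    proof (rule has_split_step[OF pr _ *])
      fix d assume d: "d \<in> carrier W" "s \<otimes> x = word_prod W p \<otimes> d \<otimes> word_prod W r"
      let ?p = "word_prod W p" let ?r = "word_prod W r" let ?w = "word_prod W w"
      have "s \<otimes> ?p \<otimes> ?w \<otimes> ?r = ?p \<otimes> d \<otimes> ?r"
        using d ws s x by (simp add: m_assoc)
      then have "s \<otimes> ?p \<otimes> ?w = ?p \<otimes> d"
        using ws s d by (meson m_closed right_cancel)
      then have "d = inv ?p \<otimes> (s \<otimes> ?p \<otimes> ?w)"
        using ws d s by (simp add: m_assoc[symmetric])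
      \<comment> \<open>Moving \<open>s\<close> past \<open>?p\<close> turns it into a conjugate
        inside \<open>generate W J\<close>, so \<open>d\<close> lies in the double coset of the
        minimal element.\<close>
      then have "d = (inv ?p \<otimes> s \<otimes> ?p) \<otimes> ?w \<otimes> \<one>"
        using ws d s by (simp add: m_assoc)
      moreover have "inv ?p \<otimes> s \<otimes> ?p \<in> generate W J"
        using word_generate[OF J pr(1)] generate.incl[OF assms(2), of W] subJ
        by (simp add: subgroup.m_closed subgroup.m_inv_closed)
      ultimately show "\<ell> ?w \<le> \<ell> d"
        using minimal generate.one by metis
    qed (use l x length_left_cases[OF s(1) xc] in auto)
  next
    case False
    then have "length ((s # p) @ w @ r) = \<ell> (s \<otimes> x)"
      using l length_left_cases[OF s(1) xc] by auto
    then show ?thesis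
      unfolding has_split_def using pr assms(2) x
      by (intro bexI[of _ "s # p"] bexI[of _ r]) simp_all
  qed
qed

lemma has_split_right: assumes "has_split x" "s \<in> J" shows "has_split (x \<otimes> s)"
proof -
  obtain p r where pr: "p \<in> lists J" "r \<in> lists J" and x: "x = word_prod W (p @ w @ r)"
    and l: "length (p @ w @ r) = \<ell> x"
    using assms unfolding has_split_def by blast
  note ws = word_prod_split[OF pr(1) w(1) pr(2)]
  have s: "s \<in> S" "s \<in> carrier W" using assms J S_carrier by auto
  have xc: "x \<in> carrier W" using ws x by auto
  have subJ: "subgroup (generate W J) W"
    using generate_is_subgroup J generators(1) by blast
  show ?thesis
  proof (cases "\<ell> (x \<otimes> s) < \<ell> x")
    case True
    then obtain xs t ys where *: "p @ w @ r = xs @ t # ys" "x \<otimes> s = word_prod W (xs @ ys)"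
      using right_exchange[OF s(1) ws(5)] l x by auto
    show ?thesis
    proof (rule has_split_step[OF pr _ *])
      fix d assume d: "d \<in> carrier W" "x \<otimes> s = word_prod W p \<otimes> d \<otimes> word_prod W r"
      let ?p = "word_prod W p" let ?r = "word_prod W r" let ?w = "word_prod W w"
      have "?p \<otimes> (?w \<otimes> (?r \<otimes> s)) = ?p \<otimes> (d \<otimes> ?r)"
        using d ws s x by (simp add: m_assoc)
      then have "?w \<otimes> (?r \<otimes> s) = d \<otimes> ?r"
        using ws s d by (metis m_closed Units_eq Units_l_cancel)
      then have "d = ?w \<otimes> (?r \<otimes> s) \<otimes> inv ?r"
        using ws d s by (simp add: m_assoc)
      then have "d = \<one> \<otimes> ?w \<otimes> (?r \<otimes> s \<otimes> inv ?r)"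
        using ws d s by (simp add: m_assoc)
      moreover have "?r \<otimes> s \<otimes> inv ?r \<in> generate W J"
        using word_generate[OF J pr(2)] generate.incl[OF assms(2), of W] subJ
        by (simp add: subgroup.m_closed subgroup.m_inv_closed)
      ultimately show "\<ell> ?w \<le> \<ell> d"
        using minimal generate.one by metis
    qed (use l x length_right_cases[OF s(1) xc] in auto)
  next
    case False
    then have "length (p @ w @ (r @ [s])) = \<ell> (x \<otimes> s)"
      using l length_right_cases[OF s(1) xc] by auto
    moreover have "word_prod W (p @ w @ (r @ [s])) = x \<otimes> s"
      using word_prod_append'[of "p @ w @ r" "[s]"] ws(5) s x by simp
    ultimately show ?thesis
      unfolding has_split_def using pr assms(2)
      by (intro bexI[of _ p] bexI[of _ "r @ [s]"]) simp_all
  qed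
qed

lemma has_split_double_coset:
  assumes "u \<in> generate W J" "v \<in> generate W J"
  shows "has_split (u \<otimes> word_prod W w \<otimes> v)"
proof -
  obtain us vs where u: "us \<in> lists J" "u = word_prod W us" and v: "vs \<in> lists J" "v = word_prod W vs"
    using generate_word[OF J] assms by metis
  have c: "word_prod W w \<in> carrier W" using w word_prod_closed by auto
  have 0: "has_split (word_prod W w)"
    unfolding has_split_def using w by (intro bexI[of _ "[]"]) auto
  have "has_split (word_prod W us \<otimes> word_prod W w)"
    using u(1)
  proof (induction us)
    case Nil then show ?case using 0 c by simp
  next
    case (Cons s us)
    moreover have "word_prod W us \<in> carrier W" "s \<in> carrier W"
      using Cons J word_prod_closed[of us] S_carrier by auto
    ultimately show ?case using has_split_left[of _ s] c by (simp add: m_assoc)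
  qed
  then have 1: "has_split (u \<otimes> word_prod W w)" using u by simp
  have uc: "u \<otimes> word_prod W w \<in> carrier W"
    using u c J word_prod_closed[of us] by auto
  have "has_split (u \<otimes> word_prod W w \<otimes> word_prod W vs)"
    using v(1)
  proof (induction vs rule: rev_induct)
    case Nil then show ?case using 1 uc by simp
  next
    case (snoc s vs)
    then have vs: "vs \<in> lists S" "s \<in> S" "s \<in> carrier W" using J S_carrier by auto
    then have "word_prod W (vs @ [s]) = word_prod W vs \<otimes> s" "word_prod W vs \<in> carrier W"
      using word_prod_append'[of vs "[s]"] word_prod_closed by auto
    then show ?case using snoc has_split_right[of _ s] uc vs by (simp add: m_assoc[symmetric])
  qed
  then show ?thesis using v by simp
qed

text \<open>In a split reduced word the first letter of a non-empty \<open>p\<close> would be a left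
  descent in \<open>J\<close>, and the last letter of a non-empty \<open>r\<close> a right
  one.\<close>

lemma minimal_unique:
  assumes "u \<in> generate W J" "v \<in> generate W J" "no_descent J (u \<otimes> word_prod W w \<otimes> v)"
  shows "u \<otimes> word_prod W w \<otimes> v = word_prod W w"
proof -
  let ?x = "u \<otimes> word_prod W w \<otimes> v"
  obtain p r where pr: "p \<in> lists J" "r \<in> lists J" and x: "?x = word_prod W (p @ w @ r)"
    and l: "length (p @ w @ r) = \<ell> ?x"
    using has_split_double_coset[OF assms(1,2)] unfolding has_split_def by blast
  have "p = []"
  proof (cases p)
    case (Cons s p')
    then have *: "s \<in> J" "s \<in> S" "p' \<in> lists J" using pr J by auto
    note ws = word_prod_split[OF *(3) w(1) pr(2)]
    have "s \<otimes> ?x = word_prod W (p' @ w @ r)"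
      using x Cons * ws word_prod_closed[OF ws(5)] by (simp add: S_cancel_left)
    then have "\<ell> (s \<otimes> ?x) < \<ell> ?x"
      using l Cons length_word_prod_le[OF ws(5)] by simp
    then show ?thesis using assms(3) * by (auto simp: no_descent_def)
  qed
  moreover have "r = []"
  proof (cases r rule: rev_cases)
    case (snoc r' s)
    then have *: "s \<in> J" "s \<in> S" "r' \<in> lists J" using pr J by auto
    note ws = word_prod_split[OF pr(1) w(1) *(3)]
    have "?x = word_prod W (p @ w @ r') \<otimes> s"
      using x snoc word_prod_append'[of "p @ w @ r'" "[s]"] ws * S_carrier by simp
    then have "?x \<otimes> s = word_prod W (p @ w @ r')"
      using word_prod_closed[OF ws(5)] * by (simp add: S_cancel_right)
    then have "\<ell> (?x \<otimes> s) < \<ell> ?x"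
      using l snoc length_word_prod_le[OF ws(5)] by simp
    then show ?thesis using assms(3) * by (auto simp: no_descent_def)
  qed simp
  ultimately show ?thesis using x by simp
qed

end

lemma no_descent_of_minimal:
  assumes "J \<subseteq> S" "x \<in> carrier W" "\<And>s. s \<in> J \<Longrightarrow> \<ell> x \<le> \<ell> (s \<otimes> x) \<and> \<ell> x \<le> \<ell> (x \<otimes> s)"
  shows "no_descent J x"
  unfolding no_descent_def
proof
  fix s assume s: "s \<in> J"
  then show "\<ell> x < \<ell> (s \<otimes> x) \<and> \<ell> x < \<ell> (x \<otimes> s)"
    using assms(3)[OF s] length_left_cases[of s x] length_right_cases[of s x] assms(1,2) by auto
qed

lemma double_coset_eq:
  assumes "J \<subseteq> S" "D \<in> double_cosets W J" "d \<in> D"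
  shows "d \<in> carrier W" "D = {u \<otimes> d \<otimes> v | u v. u \<in> generate W J \<and> v \<in> generate W J}"
proof -
  let ?J = "generate W J"
  have Jc: "J \<subseteq> carrier W" using assms(1) generators by auto
  interpret JJ: subgroup ?J W using generate_is_subgroup[OF Jc] .
  obtain w where w: "w \<in> carrier W" "D = (?J #> w) <#> ?J"
    using assms(2) unfolding double_cosets_def by blast
  have D: "D = {u \<otimes> w \<otimes> v | u v. u \<in> ?J \<and> v \<in> ?J}"
    unfolding w r_coset_def set_mult_def by blast
  then obtain a b where ab: "a \<in> ?J" "b \<in> ?J" "d = a \<otimes> w \<otimes> b"
    using assms(3) by blast
  note c = w(1) ab(1,2)[THEN JJ.mem_carrier]
  show dc: "d \<in> carrier W" using ab c by simp
  have cancel: "x \<otimes> (inv x \<otimes> y) = y" "inv x \<otimes> (x \<otimes> y) = y"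
    if "x \<in> carrier W" "y \<in> carrier W" for x y
    using that by (simp_all add: m_assoc[symmetric])
  have eq1: "u \<otimes> d \<otimes> v = (u \<otimes> a) \<otimes> w \<otimes> (b \<otimes> v)" if "u \<in> ?J" "v \<in> ?J" for u v
    using that[THEN JJ.mem_carrier] c by (simp add: ab(3) m_assoc)
  have eq2: "u \<otimes> w \<otimes> v = (u \<otimes> inv a) \<otimes> d \<otimes> (inv b \<otimes> v)" if "u \<in> ?J" "v \<in> ?J" for u v
    using that[THEN JJ.mem_carrier] c by (simp add: ab(3) m_assoc cancel)
  show "D = {u \<otimes> d \<otimes> v | u v. u \<in> ?J \<and> v \<in> ?J}"
    unfolding D
  proof (intro equalityI subsetI)
    fix x assume "x \<in> {u \<otimes> w \<otimes> v | u v. u \<in> ?J \<and> v \<in> ?J}"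
    then obtain u v where uv: "u \<in> ?J" "v \<in> ?J" "x = u \<otimes> w \<otimes> v" by blast
    then have "u \<otimes> inv a \<in> ?J" "inv b \<otimes> v \<in> ?J" using ab by simp_all
    then show "x \<in> {u \<otimes> d \<otimes> v | u v. u \<in> ?J \<and> v \<in> ?J}" using uv eq2[OF uv(1,2)] by auto
  next
    fix x assume "x \<in> {u \<otimes> d \<otimes> v | u v. u \<in> ?J \<and> v \<in> ?J}"
    then obtain u v where uv: "u \<in> ?J" "v \<in> ?J" "x = u \<otimes> d \<otimes> v" by blast
    then have "u \<otimes> a \<in> ?J" "b \<otimes> v \<in> ?J" using ab by simp_all
    then show "x \<in> {u \<otimes> w \<otimes> v | u v. u \<in> ?J \<and> v \<in> ?J}" using uv eq1[OF uv(1,2)] by auto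
  qed
qed

text \<open>Justifies the definite description in \<open>min_rep\<close>: an element of least length
  has no descents in \<open>J\<close>, and by \<open>minimal_unique\<close> an element of
  \<open>D\<close> without descents is that one.\<close>

lemma min_rep_eq:
  assumes "J \<subseteq> S" "D \<in> double_cosets W J"
  shows "min_rep W S D \<in> D" "\<And>x. x \<in> D \<Longrightarrow> no_descent J x \<longleftrightarrow> x = min_rep W S D"
proof -
  let ?J = "generate W J"
  have Jc: "J \<subseteq> carrier W" using assms(1) generators by auto
  interpret JJ: subgroup ?J W using generate_is_subgroup[OF Jc] .
  have "\<exists>w \<in> carrier W. w \<in> D"
  proof -
    obtain w where w: "w \<in> carrier W" "D = (?J #> w) <#> ?J"
      using assms(2) unfolding double_cosets_def by blast
    then have "\<one> \<otimes> w \<otimes> \<one> \<in> D"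
      unfolding r_coset_def set_mult_def using JJ.one_closed by blast
    then show ?thesis using w by auto
  qed
  then obtain d where d: "d \<in> D" "\<And>x. x \<in> D \<Longrightarrow> \<ell> d \<le> \<ell> x"
    using ex_has_least_nat[of "\<lambda>x. x \<in> D" _ \<ell>] by blast
  note D = double_coset_eq[OF assms d(1)]
  obtain w where w: "w \<in> lists S" "length w = \<ell> d" "word_prod W w = d"
    using reduced_word D(1) by blast
  have uniq: "x = d" if "x \<in> D" "no_descent J x" for x
  proof -
    obtain u v where "u \<in> ?J" "v \<in> ?J" "x = u \<otimes> d \<otimes> v" using \<open>x \<in> D\<close> D(2) by blast
    then show ?thesis
      using minimal_unique[OF assms(1) w(1), of u v] w d D(2) that by auto
  qed
  have closed: "x \<in> carrier W" "s \<otimes> x \<in> D" "x \<otimes> s \<in> D" if "x \<in> D" "s \<in> J" for x s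
  proof -
    note X = double_coset_eq[OF assms \<open>x \<in> D\<close>]
    have s: "s \<in> ?J" "s \<in> carrier W" using \<open>s \<in> J\<close> Jc by (auto intro: generate.incl)
    show "x \<in> carrier W" by fact
    have "s \<otimes> x = s \<otimes> x \<otimes> \<one>" "x \<otimes> s = \<one> \<otimes> x \<otimes> s" using s X(1) by auto
    then show "s \<otimes> x \<in> D" "x \<otimes> s \<in> D"
      using s JJ.one_closed X(2) by blast+
  qed
  have nd: "no_descent J x" if "x \<in> D" "\<And>y. y \<in> D \<Longrightarrow> \<ell> x \<le> \<ell> y" for x
  proof (rule no_descent_of_minimal[OF assms(1) double_coset_eq(1)[OF assms that(1)]])
    fix s assume "s \<in> J"
    then show "\<ell> x \<le> \<ell> (s \<otimes> x) \<and> \<ell> x \<le> \<ell> (x \<otimes> s)"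
      using that(2) closed(2,3)[OF that(1)] by blast
  qed
  have eq: "min_rep W S D = d"
    unfolding min_rep_def
  proof (rule the_equality)
    show "d \<in> D \<and> (\<forall>w \<in> D. \<ell> d \<le> \<ell> w)" using d by blast
    show "x = d" if "x \<in> D \<and> (\<forall>w \<in> D. \<ell> x \<le> \<ell> w)" for x
      using that uniq nd by blast
  qed
  show "min_rep W S D \<in> D" using eq d by simp
  show "no_descent J x \<longleftrightarrow> x = min_rep W S D" if "x \<in> D" for x
    unfolding eq using uniq[OF that] nd[OF d] by blast
qed

text \<open>Replaces minimality over a double coset by a local condition on \<open>x\<close>, the
  form in which \<open>X\<close> meets the eigenvalue arguments.\<close>

lemma min_reps_iff:
  assumes "J \<subseteq> S"
  shows "x \<in> min_reps W S J \<longleftrightarrow> x \<in> carrier W \<and> no_descent J x"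
proof
  assume "x \<in> min_reps W S J"
  then obtain D where "D \<in> double_cosets W J" "x = min_rep W S D"
    unfolding min_reps_def by blast
  then show "x \<in> carrier W \<and> no_descent J x"
    using min_rep_eq[OF assms] double_coset_eq(1)[OF assms] by blast
next
  assume x: "x \<in> carrier W \<and> no_descent J x"
  let ?D = "(generate W J #> x) <#> generate W J"
  have "?D \<in> double_cosets W J" using x unfolding double_cosets_def by blast
  moreover have "\<one> \<otimes> x \<otimes> \<one> \<in> ?D"
    unfolding r_coset_def set_mult_def using generate.one by blast
  then have "x \<in> ?D" using x by simp
  ultimately show "x \<in> min_reps W S J"
    unfolding min_reps_def using min_rep_eq(2)[OF assms] x by blast
qed

end


section \<open>Descents and the Kazhdan-Lusztig basis\<close>

lemma bruhat_less_imp: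
  assumes "bruhat_less W S x y"
  shows "x \<in> carrier W \<and> cox_length W S x < cox_length W S y"
  using assms unfolding bruhat_less_def by (induction rule: tranclp_induct) auto

context coxeter_hecke
begin

lemma max_length_obtain:
  assumes "finite F" "F \<noteq> {}"
  obtains w where "w \<in> F" "\<And>x. x \<in> F \<Longrightarrow> \<ell> x \<le> \<ell> w"
proof -
  have "Max (\<ell> ` F) \<in> \<ell> ` F" using assms by simp
  then obtain w where "w \<in> F" "\<ell> w = Max (\<ell> ` F)" by auto
  then show thesis using that[of w] assms by simp
qed

abbreviation tc :: "'h \<Rightarrow> 'w \<Rightarrow> ratfun" where "tc \<equiv> coord T (carrier W)"

lemma T_span [simp]: "h \<in> span (T ` carrier W)"
  using T_basis by simp

lemmas tc_simps = coord_add[OF basis_T] coord_diff[OF basis_T] coord_scale[OF basis_T]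
  coord_zero[OF basis_T] coord_base[OF basis_T] coord_sum[OF basis_T]

lemma lattice_mult:
  assumes R: "scalar_ring R" "q \<in> R" "inverse q \<in> R"
    and x: "x \<in> lincombs R scale T (carrier W)" and y: "y \<in> lincombs R scale T (carrier W)"
  shows "x * y \<in> lincombs R scale T (carrier W)"
proof -
  let ?H = "lincombs R scale T (carrier W)"
  have step: "T s * h \<in> ?H" if "s \<in> S" "h \<in> ?H" for s h
    using that(2)
  proof (induction rule: lincombs_induct)
    case (base w)
    have "T (s \<otimes> w) \<in> ?H" "scale (q - inverse q) (T w) \<in> ?H"
      using base that R S_carrier
      by (auto intro!: lincombs_incl lincombs_scale scalar_ring_diff)
    then show ?case
      using T_left[OF that(1) base] R by (auto intro: lincombs_add simp: lincombs_zero)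
  qed (use R in \<open>auto simp: lincombs_zero distrib_left algebra intro: lincombs_add lincombs_scale\<close>)
  have word: "T w * h \<in> ?H" if "w \<in> carrier W" "h \<in> ?H" for w h
    using that(1)
  proof (induction "\<ell> w" arbitrary: w)
    case 0
    then have "w = \<one>" using length_eq_0 by auto
    then show ?case using that(2) by (simp add: T_one)
  next
    case (Suc n)
    then have "w \<noteq> \<one>" by auto
    then obtain s v where sv: "s \<in> S" "v \<in> carrier W" "w = s \<otimes> v" "\<ell> w = Suc (\<ell> v)"
      using left_descent_exists Suc.prems by metis
    then have "T w = T s * T v" "T v * h \<in> ?H" using T_up[of s v] Suc by auto
    then show ?case using step sv by (simp add: mult.assoc)
  qed
  show ?thesis
    using x
  proof (induction rule: lincombs_induct)
    case (base w) then show ?case using word y by simp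
  qed (use R in \<open>auto simp: lincombs_zero distrib_right algebra intro: lincombs_add lincombs_scale\<close>)
qed

text \<open>Left and right multiplication by \<open>T\<^sub>s\<close> are treated at once.\<close>

definition hecke_op :: "('w \<Rightarrow> 'w) \<Rightarrow> ('h \<Rightarrow> 'h) \<Rightarrow> bool" where
  "hecke_op \<sigma> L \<longleftrightarrow> (\<forall>w \<in> carrier W. \<sigma> w \<in> carrier W \<and> \<sigma> (\<sigma> w) = w \<and> \<ell> (\<sigma> w) \<noteq> \<ell> w) \<and>
    (\<forall>x y. L (x + y) = L x + L y) \<and> (\<forall>a x. L (scale a x) = scale a (L x)) \<and>
    (\<forall>w \<in> carrier W. L (T w) =
      T (\<sigma> w) + (if \<ell> (\<sigma> w) < \<ell> w then scale (q - inverse q) (T w) else 0))"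

lemma length_neq:
  assumes "s \<in> S" "w \<in> carrier W"
  shows "\<ell> (s \<otimes> w) \<noteq> \<ell> w" "\<ell> (w \<otimes> s) \<noteq> \<ell> w"
  using length_left_cases[OF assms] length_right_cases[OF assms] by auto

lemma hecke_op_left:
  assumes "s \<in> S" shows "hecke_op (\<lambda>w. s \<otimes> w) (\<lambda>h. T s * h)"
  unfolding hecke_op_def
  using assms S_carrier T_left length_neq
  by (auto simp: S_cancel_left algebra distrib_left)

lemma hecke_op_right:
  assumes "s \<in> S" shows "hecke_op (\<lambda>w. w \<otimes> s) (\<lambda>h. h * T s)"
  unfolding hecke_op_def
  using assms S_carrier T_right length_neq
  by (auto simp: S_cancel_right algebra distrib_right)

context
  fixes \<sigma> L assumes op: "hecke_op \<sigma> L"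
begin

lemma hecke_op_perm: "w \<in> carrier W \<Longrightarrow> \<sigma> w \<in> carrier W" "w \<in> carrier W \<Longrightarrow> \<sigma> (\<sigma> w) = w"
    "w \<in> carrier W \<Longrightarrow> \<ell> (\<sigma> w) \<noteq> \<ell> w"
  and hecke_op_add: "L (x + y) = L x + L y"
  and hecke_op_scale: "L (scale a x) = scale a (L x)"
  and hecke_op_T: "w \<in> carrier W \<Longrightarrow>
    L (T w) = T (\<sigma> w) + (if \<ell> (\<sigma> w) < \<ell> w then scale (q - inverse q) (T w) else 0)"
  using op unfolding hecke_op_def by blast+

lemma hecke_op_zero: "L 0 = 0"
  using hecke_op_scale[of 0 0] by simp

lemma hecke_op_diff: "L (x - y) = L x - L y"
  using hecke_op_add[of "x - y" y] by simp

lemma hecke_op_sum: "L (sum f F) = (\<Sum>i \<in> F. L (f i))"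
  by (induction F rule: infinite_finite_induct) (auto simp: hecke_op_add hecke_op_zero)

text \<open>The transposed action: as \<open>\<sigma>\<close> is an involution, only
  \<open>T (\<sigma> y)\<close> and \<open>T y\<close> contribute to the coefficient at
  \<open>y\<close>.\<close>

lemma hecke_op_coord:
  assumes y: "y \<in> carrier W"
  shows "tc (L h) y = tc h (\<sigma> y) + (if \<ell> (\<sigma> y) < \<ell> y then (q - inverse q) * tc h y else 0)"
proof (induction h rule: T_induct)
  case (base w)
  have "\<sigma> y = w \<longleftrightarrow> y = \<sigma> w" using hecke_op_perm y base by metis
  then show ?case
    using base y hecke_op_perm by (auto simp: hecke_op_T tc_simps)
qed (simp_all add: hecke_op_add hecke_op_scale hecke_op_zero tc_simps algebra_simps)

text \<open>If \<open>\<sigma>\<close> lengthened \<open>y\<close>, comparing coefficients at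
  \<open>y\<close> would put \<open>\<sigma> y\<close> into the support as well. So
  \<open>\<sigma>\<close> shortens the longest elements in the support of an eigenvector for
  -q^-1.\<close>

lemma hecke_op_descent:
  assumes "L h = scale (- inverse q) h" and y: "y \<in> carrier W" "tc h y \<noteq> 0"
    and max: "\<And>x. x \<in> carrier W \<Longrightarrow> tc h x \<noteq> 0 \<Longrightarrow> \<ell> x \<le> \<ell> y"
  shows "\<ell> (\<sigma> y) < \<ell> y"
proof (rule ccontr)
  assume n: "\<not> \<ell> (\<sigma> y) < \<ell> y"
  then have "tc h (\<sigma> y) = - inverse q * tc h y"
    using hecke_op_coord[OF y(1), of h] assms(1) by (simp add: tc_simps del: scale_minus_left)
  then have "tc h (\<sigma> y) \<noteq> 0" using y by simp
  then have "\<ell> (\<sigma> y) \<le> \<ell> y" using max hecke_op_perm y by blast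
  then show False using n hecke_op_perm(3)[OF y(1)] by simp
qed

end

end

locale hecke_kl = coxeter_hecke W S scale T
  for W :: "('w, 'z) monoid_scheme" (structure) and S :: "'w set"
    and scale :: "ratfun \<Rightarrow> 'h \<Rightarrow> 'h::ring_1" and T :: "'w \<Rightarrow> 'h" +
  fixes J :: "'w set" and bar dagger :: "'h \<Rightarrow> 'h" and C :: "'w \<Rightarrow> 'h"
  assumes J: "J \<subseteq> S" "J \<noteq> {}" "finite (generate W J)"
    and bar: "bar_involution (hecke_form W S J scale T) S scale T bar"
    and KL: "kazhdan_lusztig_basis W S scale T bar C"
    and dagger: "dagger_automorphism (hecke_form W S J scale T) S scale T dagger"
begin

abbreviation A where "A \<equiv> coeff_ring W S J"
abbreviation H where "H \<equiv> hecke_form W S J scale T"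

lemma A_ring: "scalar_ring A"
  by (rule coeff_ring_ring)

lemma H_iff: "h \<in> H \<longleftrightarrow> (\<forall>w \<in> carrier W. tc h w \<in> A)"
  unfolding hecke_form_def using lincombs_iff[OF basis_T, of "carrier W" A h] scalar_ring_0[OF A_ring]
  by auto

lemma H_0: "0 \<in> H" and H_add: "x \<in> H \<Longrightarrow> y \<in> H \<Longrightarrow> x + y \<in> H"
  and H_scale: "a \<in> A \<Longrightarrow> x \<in> H \<Longrightarrow> scale a x \<in> H"
  and H_diff: "x \<in> H \<Longrightarrow> y \<in> H \<Longrightarrow> x - y \<in> H"
  and H_mult: "x \<in> H \<Longrightarrow> y \<in> H \<Longrightarrow> x * y \<in> H"
  and H_T: "w \<in> carrier W \<Longrightarrow> T w \<in> H"
  unfolding hecke_form_def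
  by (simp_all add: A_ring q_coeff_ring lincombs_zero lincombs_add lincombs_scale lincombs_diff
      lattice_mult lincombs_incl)

lemma H_1: "1 \<in> H"
  using H_T[OF one_closed] by (simp add: T_one)

lemma H_sum: "(\<And>i. i \<in> F \<Longrightarrow> f i \<in> H) \<Longrightarrow> sum f F \<in> H"
  by (induction F rule: infinite_finite_induct) (auto simp: H_0 H_add)

text \<open>The length filtration of the \<open>A\<close>-form, in which the error terms of
  triangular expansions are collected.\<close>

definition lower :: "nat \<Rightarrow> 'h set" where
  "lower n = lincombs A scale T {x \<in> carrier W. \<ell> x < n}"

lemma lower_iff:
  "h \<in> lower n \<longleftrightarrow> (\<forall>w \<in> carrier W. tc h w \<in> A \<and> (tc h w \<noteq> 0 \<longrightarrow> \<ell> w < n))"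
  unfolding lower_def
  using lincombs_iff[OF basis_T, of "{x \<in> carrier W. \<ell> x < n}" A h] scalar_ring_0[OF A_ring]
  by auto

lemma lower_0: "0 \<in> lower n" and lower_add: "x \<in> lower n \<Longrightarrow> y \<in> lower n \<Longrightarrow> x + y \<in> lower n"
  and lower_scale: "a \<in> A \<Longrightarrow> x \<in> lower n \<Longrightarrow> scale a x \<in> lower n"
  and lower_diff: "x \<in> lower n \<Longrightarrow> y \<in> lower n \<Longrightarrow> x - y \<in> lower n"
  and lower_T: "w \<in> carrier W \<Longrightarrow> \<ell> w < n \<Longrightarrow> T w \<in> lower n"
  unfolding lower_def using A_ring
  by (auto intro: lincombs_zero lincombs_add lincombs_scale lincombs_diff lincombs_incl)

lemma lower_mono: "h \<in> lower n \<Longrightarrow> n \<le> m \<Longrightarrow> h \<in> lower m"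
  unfolding lower_iff by (meson order_less_le_trans)

lemma T_mult_lower:
  assumes "s \<in> S" "h \<in> lower n" shows "T s * h \<in> lower (Suc n)"
  using assms(2) unfolding lower_def
proof (induction rule: lincombs_induct)
  case (base w)
  then have w: "w \<in> carrier W" "\<ell> w < n" by auto
  then have "T (s \<otimes> w) \<in> lower (Suc n)" "scale (q - inverse q) (T w) \<in> lower (Suc n)"
    using assms(1) S_carrier length_left_le[of s w] q_coeff_ring A_ring
    by (auto intro!: lower_T lower_scale scalar_ring_diff)
  then show ?case
    using T_left[OF assms(1) w(1)] unfolding lower_def[symmetric]
    by (auto intro: lower_add simp: lower_0)
qed (use A_ring in \<open>auto simp: lincombs_zero distrib_left algebra intro: lincombs_add lincombs_scale\<close>)

section \<open>Ring automorphisms of the \<open>A\<close>-form that invert \<open>q\<close>\<close>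

context
  fixes f :: "'h \<Rightarrow> 'h"
  assumes f: "ring_automorphism_on H f" "f (scale q 1) = scale (inverse q) 1"
begin

lemma auto_in: "x \<in> H \<Longrightarrow> f x \<in> H" and auto_one: "f 1 = 1"
  and auto_add: "x \<in> H \<Longrightarrow> y \<in> H \<Longrightarrow> f (x + y) = f x + f y"
  and auto_mult: "x \<in> H \<Longrightarrow> y \<in> H \<Longrightarrow> f (x * y) = f x * f y"
  using f unfolding ring_automorphism_on_def bij_betw_def by blast+

lemma auto_zero: "f 0 = 0"
  using auto_add[of 0 0] H_0 by simp

lemma auto_diff: "x \<in> H \<Longrightarrow> y \<in> H \<Longrightarrow> f (x - y) = f x - f y"
  using auto_add[of "x - y" y] H_diff by simp

lemma auto_sum: "(\<And>i. i \<in> F \<Longrightarrow> g i \<in> H) \<Longrightarrow> f (sum g F) = (\<Sum>i \<in> F. f (g i))"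
  by (induction F rule: infinite_finite_induct) (auto simp: auto_zero auto_add H_sum)

lemma auto_inverse_q: "f (scale (inverse q) 1) = scale q 1"
proof -
  have "1 = f (scale q 1 * scale (inverse q) 1)"
    by (simp add: scale_one_mult auto_one)
  also have "\<dots> = scale (inverse q) (f (scale (inverse q) 1))"
    using f(2) by (subst auto_mult) (auto simp: scale_one_mult H_scale H_1 q_coeff_ring)
  finally have "scale q 1 = scale q (scale (inverse q) (f (scale (inverse q) 1)))" by simp
  then show ?thesis by simp
qed

text \<open>The automorphisms are ring maps with a prescribed value at \<open>q\<close>; their
  semilinearity over a subring of scalars has to be propagated from its generators.\<close>

lemma auto_scalar:
  assumes "X \<subseteq> A" and "\<And>x. x \<in> X \<Longrightarrow> \<exists>y \<in> subring_gen Y. f (scale x 1) = scale y 1"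
    and "a \<in> subring_gen X"
  shows "\<exists>b \<in> subring_gen Y. f (scale a 1) = scale b 1"
  using assms(3)
proof induction
  case one
  then show ?case by (intro bexI[of _ 1]) (auto simp: auto_one intro: subring_gen.one)
next
  case (diff x y)
  then obtain x' y' where *: "x' \<in> subring_gen Y" "f (scale x 1) = scale x' 1"
    "y' \<in> subring_gen Y" "f (scale y 1) = scale y' 1" by blast
  have "x \<in> A" "y \<in> A" using diff subring_gen_subset[OF A_ring assms(1)] by auto
  then have "f (scale (x - y) 1) = scale (x' - y') 1"
    using * by (simp add: scale_left_diff_distrib auto_diff H_scale H_1)
  then show ?case using * subring_gen.diff by blast
next
  case (mult x y)
  then obtain x' y' where *: "x' \<in> subring_gen Y" "f (scale x 1) = scale x' 1"
    "y' \<in> subring_gen Y" "f (scale y 1) = scale y' 1" by blast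
  have "x \<in> A" "y \<in> A" using mult subring_gen_subset[OF A_ring assms(1)] by auto
  then have "f (scale x 1 * scale y 1) = scale x' 1 * scale y' 1"
    using * by (simp add: auto_mult H_scale H_1)
  then have "f (scale (x * y) 1) = scale (x' * y') 1"
    by (simp add: scale_one_mult mult.commute)
  then show ?case using * subring_gen.mult by blast
qed (use assms in blast)

lemma auto_laurent:
  "a \<in> subring_gen {q, inverse q} \<Longrightarrow> \<exists>b \<in> subring_gen {q, inverse q}. f (scale a 1) = scale b 1"
  by (rule auto_scalar) (auto simp: q_coeff_ring f auto_inverse_q intro: subring_gen.incl)

lemma auto_neg:
  "a \<in> subring_gen {inverse q} \<Longrightarrow> \<exists>b \<in> subring_gen {q}. f (scale a 1) = scale b 1"
  by (rule auto_scalar) (auto simp: q_coeff_ring f auto_inverse_q intro: subring_gen.incl)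

lemma auto_scale:
  "a \<in> A \<Longrightarrow> x \<in> H \<Longrightarrow> f (scale a 1) = scale b 1 \<Longrightarrow> f (scale a x) = scale b (f x)"
  using auto_mult[of "scale a 1" x] by (simp add: scale_one_mult H_scale H_1)

end

lemma bar_auto: "ring_automorphism_on H bar" "bar (scale q 1) = scale (inverse q) 1"
  and bar_T_inverse: "s \<in> S \<Longrightarrow> bar (T s) * T s = 1"
  using bar by (auto simp: bar_involution_def)

lemma dagger_auto: "ring_automorphism_on H dagger" "dagger (scale q 1) = scale (inverse q) 1"
  and dagger_T: "s \<in> S \<Longrightarrow> dagger (T s) = - T s"
  using dagger by (auto simp: dagger_automorphism_def)

lemma bar_T: assumes "s \<in> S" shows "bar (T s) = T s - scale (q - inverse q) 1"
proof -
  have "T s * (T s - scale (q - inverse q) 1) = 1"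
    using T_square[OF assms] by (simp add: right_diff_distrib scale_one_mult)
  then have "bar (T s) = (bar (T s) * T s) * (T s - scale (q - inverse q) 1)"
    by (simp add: mult.assoc)
  then show ?thesis using bar_T_inverse[OF assms] by simp
qed

text \<open>Bar is unitriangular for the length: \<open>bar (T s)\<close> differs from
  \<open>T s\<close> by a scalar, so every correction loses at least one letter.\<close>

lemma bar_T_lower: "w \<in> carrier W \<Longrightarrow> bar (T w) - T w \<in> lower (\<ell> w)"
proof (induction "\<ell> w" arbitrary: w)
  case 0
  then have "w = \<one>" using length_eq_0 by auto
  then show ?case by (simp add: T_one auto_one[OF bar_auto] lower_0)
next
  case (Suc n)
  then have "w \<noteq> \<one>" by auto
  then obtain s v where sv: "s \<in> S" "v \<in> carrier W" "w = s \<otimes> v" "\<ell> w = Suc (\<ell> v)"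
    using left_descent_exists Suc.prems by metis
  have Tw: "T w = T s * T v" using T_up[of s v] sv by auto
  define l where "l = bar (T v) - T v"
  have l: "l \<in> lower (\<ell> v)" using Suc sv by (auto simp: l_def)
  have bv: "bar (T v) = T v + l" by (simp add: l_def)
  have "bar (T w) = bar (T s) * bar (T v)"
    unfolding Tw by (rule auto_mult[OF bar_auto]) (auto intro!: H_T sv S_carrier)
  also have "\<dots> - T w = T s * l - scale (q - inverse q) (T v + l)"
    by (simp add: Tw bv bar_T[OF sv(1)] left_diff_distrib distrib_left scale_one_mult
        scale_right_distrib)
  finally have "bar (T w) - T w = T s * l - scale (q - inverse q) (T v + l)" .
  moreover have "T v + l \<in> lower (\<ell> w)"
    using l sv by (auto intro!: lower_add lower_T intro: lower_mono)
  moreover have "T s * l \<in> lower (\<ell> w)"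
    using T_mult_lower[OF sv(1) l] sv by simp
  ultimately show ?case
    using A_ring q_coeff_ring by (auto intro!: lower_diff lower_scale scalar_ring_diff)
qed

lemma dagger_T_sign: "w \<in> carrier W \<Longrightarrow> dagger (T w) = scale ((-1) ^ \<ell> w) (T w)"
proof (induction "\<ell> w" arbitrary: w)
  case 0
  then have "w = \<one>" using length_eq_0 by auto
  then show ?case by (simp add: T_one auto_one[OF dagger_auto])
next
  case (Suc n)
  then have "w \<noteq> \<one>" by auto
  then obtain s v where sv: "s \<in> S" "v \<in> carrier W" "w = s \<otimes> v" "\<ell> w = Suc (\<ell> v)"
    using left_descent_exists Suc.prems by metis
  have Tw: "T w = T s * T v" using T_up[of s v] sv by auto
  have "dagger (T w) = dagger (T s) * dagger (T v)"
    unfolding Tw by (rule auto_mult[OF dagger_auto]) (auto intro!: H_T sv S_carrier)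
  also have "\<dots> = - scale ((-1) ^ \<ell> v) (T w)"
  proof -
    have "dagger (T v) = scale ((-1) ^ \<ell> v) (T v)" using Suc sv by auto
    then show ?thesis by (simp add: dagger_T[OF sv(1)] Tw algebra)
  qed
  finally show ?case by (simp add: sv(4))
qed

text \<open>By unitriangularity, the coefficient of \<open>bar E\<close> at a \<open>y\<close> of
  maximal length is the conjugate of the coefficient of \<open>E\<close>; nothing from other terms
  reaches \<open>y\<close>.\<close>

lemma bar_fixed_top:
  assumes E: "\<And>w. w \<in> carrier W \<Longrightarrow> tc E w \<in> subring_gen {q, inverse q}" "bar E = E"
    and y: "y \<in> carrier W" "\<And>x. x \<in> carrier W \<Longrightarrow> tc E x \<noteq> 0 \<Longrightarrow> \<ell> x \<le> \<ell> y"
  shows "bar (scale (tc E y) 1) = scale (tc E y) 1"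
proof -
  \<comment> \<open>\<open>y\<close> is inserted because its coefficient in \<open>E\<close> may be
    zero.\<close>
  define F where "F = insert y {x \<in> carrier W. tc E x \<noteq> 0}"
  have F: "finite F" "F \<subseteq> carrier W" "\<And>x. x \<in> F \<Longrightarrow> \<ell> x \<le> \<ell> y"
    using coord_finite[OF basis_T, of E] y by (auto simp: F_def)
  have "\<forall>w \<in> carrier W. \<exists>b. bar (scale (tc E w) 1) = scale b 1"
    using auto_laurent[OF bar_auto] E(1) by blast
  then obtain b where b: "\<And>w. w \<in> carrier W \<Longrightarrow> bar (scale (tc E w) 1) = scale (b w) 1"
    by metis
  have in_A: "tc E w \<in> A" if "w \<in> carrier W" for w
    using E(1)[OF that] laurent_subset_coeff_ring by blast
  have "E = (\<Sum>x \<in> F. scale (tc E x) (T x))"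
    by (subst coord_expand[OF basis_T, of E], simp, rule sum.mono_neutral_left)
      (use F in \<open>auto simp: F_def\<close>)
  then have "bar E = bar (\<Sum>x \<in> F. scale (tc E x) (T x))" by simp
  also have "\<dots> = (\<Sum>x \<in> F. bar (scale (tc E x) (T x)))"
    by (rule auto_sum[OF bar_auto]) (use F in_A in \<open>auto intro!: H_scale H_T\<close>)
  also have "\<dots> = (\<Sum>x \<in> F. scale (b x) (bar (T x)))"
    by (rule sum.cong) (use F b in_A in \<open>auto intro!: auto_scale[OF bar_auto] H_T\<close>)
  finally have "tc E y = tc (\<Sum>x \<in> F. scale (b x) (bar (T x))) y"
    using E(2) by simp
  also have "\<dots> = (\<Sum>x \<in> F. b x * tc (bar (T x)) y)"
    by (simp add: tc_simps)
  also have "\<dots> = (\<Sum>x \<in> F. if y = x then b x else 0)"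
  proof (rule sum.cong)
    fix x assume x: "x \<in> F"
    then have "tc (bar (T x) - T x) y = 0"
      using bar_T_lower[of x] F y(1) unfolding lower_iff by fastforce
    then have "tc (bar (T x)) y = tc (T x) y"
      by (simp add: tc_simps)
    then show "b x * tc (bar (T x)) y = (if y = x then b x else 0)"
      using x F y(1) by (auto simp: tc_simps)
  qed simp
  also have "\<dots> = b y" using F by (simp add: F_def)
  finally show ?thesis using b[OF y(1)] by simp
qed

lemma bar_C: "w \<in> carrier W \<Longrightarrow> bar (C w) = C w"
  and C_lincomb: "w \<in> carrier W \<Longrightarrow>
    C w - T w \<in> lincombs neg_coeffs scale T {x \<in> carrier W. bruhat_less W S x w}"
  using KL by (auto simp: kazhdan_lusztig_basis_def)

lemma tc_C:
  assumes "w \<in> carrier W" "x \<in> carrier W"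
  shows "x \<noteq> w \<Longrightarrow> tc (C w) x \<in> neg_coeffs" "tc (C w) w = 1"
    "tc (C w) x \<in> subring_gen {inverse q}"
proof -
  have *: "tc (C w - T w) z \<in> neg_coeffs \<and> (tc (C w - T w) z \<noteq> 0 \<longrightarrow> \<ell> z < \<ell> w)"
    if "z \<in> carrier W" for z
    using C_lincomb[OF assms(1)] that bruhat_less_imp[of W S z w]
      lincombs_iff[OF basis_T, of "{x \<in> carrier W. bruhat_less W S x w}" neg_coeffs "C w - T w"]
    by (auto simp: neg_coeffs_0)
  show one: "tc (C w) w = 1" using *[OF assms(1)] assms by (auto simp: tc_simps)
  show neg: "tc (C w) x \<in> neg_coeffs" if "x \<noteq> w"
    using *[OF assms(2)] assms that by (auto simp: tc_simps)
  show "tc (C w) x \<in> subring_gen {inverse q}"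
    using one neg neg_coeffs_subset subring_gen.one by (cases "x = w") auto
qed

lemma C_H: "w \<in> carrier W \<Longrightarrow> C w \<in> H"
  using tc_C(3)[of w] subring_gen_subset[OF A_ring, of "{inverse q}" ] q_coeff_ring[of W S J]
  unfolding H_iff by blast

text \<open>\<open>(L - q) C\<^sub>w\<close> is bar-invariant, while its top coefficients lie in \<open>q\<^sup>-\<^sup>1 \<int>[q\<^sup>-\<^sup>1]\<close>; so it
  vanishes.\<close>

lemma hecke_op_C:
  assumes op: "hecke_op \<sigma> L" and w: "w \<in> carrier W" "\<ell> (\<sigma> w) < \<ell> w"
    and compat: "bar (L (C w)) = L (C w) - scale (q - inverse q) (C w)" and "L (C w) \<in> H"
  shows "L (C w) = scale q (C w)"
proof -
  define E where "E = L (C w) - scale q (C w)"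
  note perm = hecke_op_perm[OF op]
  have "bar E = L (C w) - scale (q - inverse q) (C w) - scale (inverse q) (C w)"
  proof -
    have "scale q (C w) \<in> H" using w C_H q_coeff_ring by (intro H_scale) auto
    moreover have "bar (scale q (C w)) = scale (inverse q) (bar (C w))"
      using w C_H q_coeff_ring by (intro auto_scale[OF bar_auto _ _ bar_auto(2)]) auto
    ultimately show ?thesis
      unfolding E_def using auto_diff[OF bar_auto assms(5)] compat bar_C[OF w(1)] by simp
  qed
  then have bar_E: "bar E = E"
    by (simp add: E_def scale_left_diff_distrib)
  have e: "tc E y = tc (C w) (\<sigma> y) +
      (if \<ell> (\<sigma> y) < \<ell> y then - inverse q * tc (C w) y else - q * tc (C w) y)"
    if "y \<in> carrier W" for y
    using that by (simp add: E_def tc_simps hecke_op_coord[OF op] algebra_simps)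
  have neg_laurent: "subring_gen {inverse q} \<subseteq> subring_gen {q, inverse q}"
    by (intro subring_gen_subset) (auto intro: subring_gen.incl)
  have laurent: "tc E y \<in> subring_gen {q, inverse q}" if "y \<in> carrier W" for y
  proof -
    have "tc (C w) (\<sigma> y) \<in> subring_gen {q, inverse q}" "tc (C w) y \<in> subring_gen {q, inverse q}"
      using tc_C(3)[OF w(1)] perm(1) that neg_laurent by blast+
    moreover have "q \<in> subring_gen {q, inverse q}" "inverse q \<in> subring_gen {q, inverse q}"
      by (auto intro: subring_gen.incl)
    ultimately show ?thesis
      unfolding e[OF that] by (simp add: scalar_ring_diff scalar_ring_mult)
  qed
  have "E = 0"
  proof (rule ccontr)
    assume "E \<noteq> 0"
    define Y where "Y = {x \<in> carrier W. tc E x \<noteq> 0}"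
    have "Y \<noteq> {}"
    proof
      assume "Y = {}"
      then have "E = 0" using coord_expand[OF basis_T, of E] by (simp add: Y_def)
      then show False using \<open>E \<noteq> 0\<close> by simp
    qed
    moreover have "finite Y" unfolding Y_def by (rule coord_finite[OF basis_T])
    ultimately obtain y where y: "y \<in> Y" "\<And>x. x \<in> Y \<Longrightarrow> \<ell> x \<le> \<ell> y"
      using max_length_obtain by metis
    have yc: "y \<in> carrier W" "tc E y \<noteq> 0" using y by (auto simp: Y_def)
    \<comment> \<open>\<open>E\<close> behaves as an eigenvector for -q^-1: its coefficients at
      \<open>y\<close> and \<open>\<sigma> y\<close> are proportional, so a longest \<open>y\<close>
      in the support cannot be lengthened by \<open>\<sigma>\<close>.\<close>
    have down: "\<ell> (\<sigma> y) < \<ell> y"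
    proof (rule ccontr)
      assume "\<not> \<ell> (\<sigma> y) < \<ell> y"
      then have up: "\<ell> y < \<ell> (\<sigma> y)" using perm(3)[OF yc(1)] by simp
      have "tc E y = - q * tc E (\<sigma> y)"
        unfolding e[OF yc(1)] e[OF perm(1)[OF yc(1)]] using up perm(2)[OF yc(1)]
        by (simp add: right_diff_distrib)
      then have "\<sigma> y \<in> Y" using yc perm(1)[OF yc(1)] by (auto simp: Y_def)
      then show False using y(2) up by fastforce
    qed
    \<comment> \<open>This excludes the leading coefficient 1 of \<open>C w\<close>, the only one
      outside \<open>neg_coeffs\<close>.\<close>
    have "\<sigma> y \<noteq> w" using down w(2) perm(2)[OF yc(1)] by auto
    then have "tc (C w) (\<sigma> y) - inverse q * tc (C w) y \<in> neg_coeffs"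
      using tc_C[OF w(1)] perm(1) yc(1) by (intro neg_coeffs_diff neg_coeffs_mult) auto
    then have neg: "tc E y \<in> neg_coeffs"
      using e[OF yc(1)] down by simp
    then obtain b where b: "b \<in> subring_gen {q}" "bar (scale (tc E y) 1) = scale b 1"
      using auto_neg[OF bar_auto] neg_coeffs_subset by blast
    moreover have "bar (scale (tc E y) 1) = scale (tc E y) 1"
      using laurent bar_E yc y by (intro bar_fixed_top) (auto simp: Y_def)
    ultimately have "scale (tc E y - b) (1 :: 'h) = 0"
      by (simp add: scale_left_diff_distrib)
    then have "tc E y = b" by simp
    then show False using neg_coeffs_inter_nonneg[OF neg] b yc by simp
  qed
  then show ?thesis by (simp add: E_def)
qed

section \<open>The dagger basis and its descents\<close>

abbreviation B :: "'w \<Rightarrow> 'h" where "B w \<equiv> dagger (C w)"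

lemma B_H: "w \<in> carrier W \<Longrightarrow> B w \<in> H"
  by (rule auto_in[OF dagger_auto C_H])

text \<open>Dagger inverts \<open>q\<close> and changes the sign of \<open>T s\<close>, which turns
  the eigenvalue q into -q^-1.\<close>

lemma dagger_eigen:
  assumes "w \<in> carrier W" "x \<in> H" "dagger x = - y" "x = scale q (C w)"
  shows "y = scale (- inverse q) (B w)"
proof -
  have "dagger (scale q (C w)) = scale (inverse q) (B w)"
    using assms C_H q_coeff_ring by (intro auto_scale[OF dagger_auto _ _ dagger_auto(2)]) auto
  then show ?thesis using assms by simp
qed

lemma B_left_descent:
  assumes "s \<in> S" "w \<in> carrier W" "\<ell> (s \<otimes> w) < \<ell> w"
  shows "T s * B w = scale (- inverse q) (B w)"
proof -
  have H: "T s \<in> H" "C w \<in> H" "T s * C w \<in> H"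
    using assms by (auto intro!: H_mult H_T C_H S_carrier)
  have "T s * C w = scale q (C w)"
    using hecke_op_C[OF hecke_op_left[OF assms(1)] assms(2,3) _ H(3)] H assms
    by (simp add: auto_mult[OF bar_auto] bar_T bar_C left_diff_distrib scale_one_mult)
  moreover have "dagger (T s * C w) = - (T s * B w)"
    using H by (simp add: auto_mult[OF dagger_auto] dagger_T assms)
  ultimately show ?thesis using dagger_eigen assms H by blast
qed

lemma B_right_descent:
  assumes "s \<in> S" "w \<in> carrier W" "\<ell> (w \<otimes> s) < \<ell> w"
  shows "B w * T s = scale (- inverse q) (B w)"
proof -
  have H: "T s \<in> H" "C w \<in> H" "C w * T s \<in> H"
    using assms by (auto intro!: H_mult H_T C_H S_carrier)
  have "C w * T s = scale q (C w)"
    using hecke_op_C[OF hecke_op_right[OF assms(1)] assms(2,3) _ H(3)] H assms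
    by (simp add: auto_mult[OF bar_auto] bar_T bar_C right_diff_distrib scale_one_mult)
  moreover have "dagger (C w * T s) = - (B w * T s)"
    using H by (simp add: auto_mult[OF dagger_auto] dagger_T assms)
  ultimately show ?thesis using dagger_eigen assms H by blast
qed

lemma B_lower:
  assumes w: "w \<in> carrier W"
  shows "B w - scale ((-1) ^ \<ell> w) (T w) \<in> lower (\<ell> w)"
proof -
  \<comment> \<open>The coefficients are kept in Z[q, q^-1], where the effect of
    \<open>dagger\<close> on scalars is under control.\<close>
  have D: "C w - T w \<in> lincombs (subring_gen {q, inverse q}) scale T {x \<in> carrier W. \<ell> x < \<ell> w}"
  proof -
    have "neg_coeffs \<subseteq> subring_gen {q, inverse q}"
      using neg_coeffs_subset subring_gen_subset[of "subring_gen {q, inverse q}" "{inverse q}"]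
      by (auto intro: subring_gen.incl)
    then show ?thesis
      using C_lincomb[OF w] bruhat_less_imp[of W S _ w]
        lincombs_mono[of neg_coeffs "subring_gen {q, inverse q}"
          "{x \<in> carrier W. bruhat_less W S x w}" "{x \<in> carrier W. \<ell> x < \<ell> w}" T] by blast
  qed
  have "h \<in> H \<and> dagger h \<in> lower (\<ell> w)"
    if "h \<in> lincombs (subring_gen {q, inverse q}) scale T {x \<in> carrier W. \<ell> x < \<ell> w}" for h
    using that
  proof (induction rule: lincombs_induct)
    case zero then show ?case by (simp add: auto_zero[OF dagger_auto] H_0 lower_0)
  next
    case (add x y) then show ?case by (simp add: auto_add[OF dagger_auto] H_add lower_add)
  next
    case (scale a x)
    obtain b where b: "b \<in> subring_gen {q, inverse q}" "dagger (scale a 1) = scale b 1"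
      using auto_laurent[OF dagger_auto scale(1)] by blast
    have "a \<in> A" "b \<in> A" using scale(1) b laurent_subset_coeff_ring by auto
    then show ?case
      using scale auto_scale[OF dagger_auto _ _ b(2)] by (auto simp: H_scale lower_scale)
  next
    case (base x)
    then show ?case
      using A_ring by (auto simp: dagger_T_sign H_T intro!: lower_scale lower_T scalar_ring_intros)
  qed
  from this[OF D] have "dagger (C w - T w) \<in> lower (\<ell> w)" by simp
  then show ?thesis
    using w by (simp add: auto_diff[OF dagger_auto] C_H H_T dagger_T_sign)
qed

lemma tc_B:
  assumes "w \<in> carrier W" "x \<in> carrier W"
  shows "\<not> \<ell> x < \<ell> w \<Longrightarrow> tc (B w) x = (if x = w then (-1) ^ \<ell> w else 0)"
  using B_lower[OF assms(1)] assms unfolding lower_iff by (auto simp: tc_simps)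

text \<open>A longest index \<open>w\<close> of the sum owns the coefficient of \<open>T w\<close>,
  up to sign, and bounds the length of the whole \<open>T\<close>-support. This transfers leading
  terms between the two bases.\<close>

lemma tc_B_sum:
  assumes F: "finite F" "F \<subseteq> carrier W" and w: "w \<in> F" "\<And>x. x \<in> F \<Longrightarrow> \<ell> x \<le> \<ell> w"
  shows "tc (\<Sum>i \<in> F. scale (c i) (B i)) w = c w * (-1) ^ \<ell> w"
    and "\<And>x. x \<in> carrier W \<Longrightarrow> tc (\<Sum>i \<in> F. scale (c i) (B i)) x \<noteq> 0 \<Longrightarrow> \<ell> x \<le> \<ell> w"
proof -
  have wc: "w \<in> carrier W" using F w by auto
  have sum: "tc (\<Sum>i \<in> F. scale (c i) (B i)) x = (\<Sum>i \<in> F. c i * tc (B i) x)" for x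
    by (simp add: tc_simps)
  have "(\<Sum>i \<in> F. c i * tc (B i) w) = (\<Sum>i \<in> F. if w = i then c i * (-1) ^ \<ell> w else 0)"
    by (rule sum.cong) (use tc_B F w wc in \<open>auto simp: subset_iff not_less\<close>)
  then show "tc (\<Sum>i \<in> F. scale (c i) (B i)) w = c w * (-1) ^ \<ell> w"
    using F w by (simp add: sum)
  show "\<ell> x \<le> \<ell> w" if "x \<in> carrier W" "tc (\<Sum>i \<in> F. scale (c i) (B i)) x \<noteq> 0" for x
  proof (rule ccontr)
    assume n: "\<not> \<ell> x \<le> \<ell> w"
    have "c i * tc (B i) x = 0" if i: "i \<in> F" for i
    proof -
      have "\<ell> i < \<ell> x" using n w(2)[OF i] by simp
      moreover have "i \<in> carrier W" using i F by auto
      ultimately show ?thesis using tc_B[of i x] \<open>x \<in> carrier W\<close> by auto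
    qed
    then show False using that(2) unfolding sum by (metis (no_types, lifting) sum.neutral)
  qed
qed

lemma basis_B: "basis_on B (carrier W)"
proof (rule basis_onI, rule ccontr)
  fix F c assume F: "finite F" "F \<subseteq> carrier W" "(\<Sum>i \<in> F. scale (c i) (B i)) = 0"
    and n: "\<not> (\<forall>i \<in> F. c i = 0)"
  define G where "G = {i \<in> F. c i \<noteq> 0}"
  have G: "finite G" "G \<subseteq> carrier W" "G \<noteq> {}" using F n by (auto simp: G_def)
  obtain w where w: "w \<in> G" "\<And>x. x \<in> G \<Longrightarrow> \<ell> x \<le> \<ell> w"
    using max_length_obtain[OF G(1,3)] by blast
  have "(\<Sum>i \<in> G. scale (c i) (B i)) = 0"
    using F by (subst F(3)[symmetric], intro sum.mono_neutral_left) (auto simp: G_def)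
  then have "c w * (-1) ^ \<ell> w = 0"
    using tc_B_sum(1)[OF G(1,2) w, of c] by (simp add: tc_simps)
  then show False using w by (simp add: G_def)
qed

text \<open>Inverts the triangular expansion of \<open>B\<close>. Its diagonal entries are signs, so
  the coefficients stay in \<open>A\<close>.\<close>

lemma T_lincomb_B: "w \<in> carrier W \<Longrightarrow> T w \<in> lincombs A scale B (carrier W)"
proof (induction "\<ell> w" arbitrary: w rule: less_induct)
  case less
  define l where "l = B w - scale ((-1) ^ \<ell> w) (T w)"
  have "lower (\<ell> w) \<subseteq> lincombs A scale B (carrier W)"
    unfolding lower_def by (rule lincombs_subset[OF A_ring]) (use less in auto)
  then have "l \<in> lincombs A scale B (carrier W)"
    unfolding l_def using B_lower[OF less.prems] by blast
  then have "scale ((-1) ^ \<ell> w) (B w - l) \<in> lincombs A scale B (carrier W)"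
    using less.prems A_ring
    by (intro lincombs_scale lincombs_diff lincombs_incl scalar_ring_intros) auto
  moreover have "scale ((-1) ^ \<ell> w) (B w - l) = T w"
    by (simp add: l_def power_mult_distrib[symmetric] flip: power_add mult_2)
  ultimately show ?case by simp
qed

lemma H_eq: "H = lincombs A scale B (carrier W)"
proof
  show "H \<subseteq> lincombs A scale B (carrier W)"
    unfolding hecke_form_def by (rule lincombs_subset[OF A_ring T_lincomb_B])
  show "lincombs A scale B (carrier W) \<subseteq> H"
    unfolding hecke_form_def
    by (rule lincombs_subset[OF A_ring]) (simp add: B_H flip: hecke_form_def)
qed

lemma B_span [simp]: "h \<in> span (B ` carrier W)"
proof -
  have "T ` carrier W \<subseteq> span (B ` carrier W)"
    using T_lincomb_B lincombs_subset_span by blast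
  then show ?thesis using T_span span_mono span_span by blast
qed

abbreviation bc :: "'h \<Rightarrow> 'w \<Rightarrow> ratfun" where "bc \<equiv> coord B (carrier W)"

lemmas bc_simps = coord_add[OF basis_B] coord_diff[OF basis_B] coord_scale[OF basis_B]
  coord_zero[OF basis_B] coord_base[OF basis_B] coord_sum[OF basis_B]

lemma lincombs_B_iff:
  "I \<subseteq> carrier W \<Longrightarrow> 0 \<in> R \<Longrightarrow> h \<in> lincombs R scale B I \<longleftrightarrow>
    (\<forall>w \<in> carrier W. bc h w \<in> R \<and> (bc h w \<noteq> 0 \<longrightarrow> w \<in> I))"
  using lincombs_iff[OF basis_B] by simp

lemma bc_expand: "h = (\<Sum>w | w \<in> carrier W \<and> bc h w \<noteq> 0. scale (bc h w) (B w))"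
  by (rule coord_expand[OF basis_B]) simp

lemma bc_finite: "finite {w \<in> carrier W. bc h w \<noteq> 0}"
  by (rule coord_finite[OF basis_B])

lemma H_iff_bc: "h \<in> H \<longleftrightarrow> (\<forall>w \<in> carrier W. bc h w \<in> A)"
  unfolding H_eq using lincombs_B_iff[of "carrier W" A h] scalar_ring_0[OF A_ring] by auto

text \<open>Removing from \<open>h\<close> the part \<open>g D\<close> supported on descents leaves
  an eigenvector \<open>g U\<close>. Its longest index is also longest in its
  \<open>T\<close>-support, where \<open>hecke_op_descent\<close> forces a descent; so
  \<open>U\<close> is empty.\<close>

lemma bc_descent:
  assumes op: "hecke_op \<sigma> L"
    and desc: "\<And>w. w \<in> carrier W \<Longrightarrow> \<ell> (\<sigma> w) < \<ell> w \<Longrightarrow> L (B w) = scale (- inverse q) (B w)"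
    and h: "L h = scale (- inverse q) h" and w: "w \<in> carrier W" "bc h w \<noteq> 0"
  shows "\<ell> (\<sigma> w) < \<ell> w"
proof -
  define F where "F = {w \<in> carrier W. bc h w \<noteq> 0}"
  define D where "D = {w \<in> F. \<ell> (\<sigma> w) < \<ell> w}"
  define U where "U = {w \<in> F. \<not> \<ell> (\<sigma> w) < \<ell> w}"
  define g where "g G = (\<Sum>w \<in> G. scale (bc h w) (B w))" for G
  have fin: "finite F" unfolding F_def by (rule bc_finite)
  have "g (U \<union> D) = g U + g D"
    unfolding g_def by (rule sum.union_disjoint) (use fin in \<open>auto simp: U_def D_def\<close>)
  moreover have "U \<union> D = F" by (auto simp: U_def D_def)
  moreover have "g F = h" unfolding g_def F_def by (rule bc_expand[symmetric])
  ultimately have gU: "g U = h - g D" by simp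
  have "L (g D) = scale (- inverse q) (g D)"
  proof -
    have "L (g D) = (\<Sum>w \<in> D. scale (bc h w) (L (B w)))"
      by (simp add: g_def hecke_op_sum[OF op] hecke_op_scale[OF op])
    also have "\<dots> = (\<Sum>w \<in> D. scale (- inverse q) (scale (bc h w) (B w)))"
      by (rule sum.cong) (auto simp: D_def F_def desc mult.commute)
    also have "\<dots> = scale (- inverse q) (g D)"
      by (simp only: g_def scale_sum_right)
    finally show ?thesis .
  qed
  then have LgU: "L (g U) = scale (- inverse q) (g U)"
    unfolding gU hecke_op_diff[OF op] h by (simp only: scale_right_diff_distrib)
  have "U = {}"
  proof (rule ccontr)
    assume "U \<noteq> {}"
    moreover have U: "finite U" "U \<subseteq> carrier W" using fin by (simp_all add: U_def) (auto simp: F_def)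
    ultimately obtain u where u: "u \<in> U" "\<And>x. x \<in> U \<Longrightarrow> \<ell> x \<le> \<ell> u"
      using max_length_obtain by blast
    have "tc (g U) u \<noteq> 0"
      using tc_B_sum(1)[OF U u, of "bc h"] u(1) unfolding g_def by (auto simp: U_def F_def)
    then have "\<ell> (\<sigma> u) < \<ell> u"
      using U u tc_B_sum(2)[OF U u, of _ "bc h"] LgU
      by (intro hecke_op_descent[OF op, of "g U"]) (auto simp: g_def)
    then show False using u by (simp add: U_def)
  qed
  then show ?thesis using w by (auto simp: U_def F_def)
qed

lemma bc_left_descent:
  "s \<in> S \<Longrightarrow> T s * h = scale (- inverse q) h \<Longrightarrow> w \<in> carrier W \<Longrightarrow> bc h w \<noteq> 0 \<Longrightarrow>
    \<ell> (s \<otimes> w) < \<ell> w"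
  using bc_descent[OF hecke_op_left] B_left_descent by blast

lemma bc_right_descent:
  "s \<in> S \<Longrightarrow> h * T s = scale (- inverse q) h \<Longrightarrow> w \<in> carrier W \<Longrightarrow> bc h w \<noteq> 0 \<Longrightarrow>
    \<ell> (w \<otimes> s) < \<ell> w"
  using bc_descent[OF hecke_op_right] B_right_descent by blast

end


section \<open>The corner algebra\<close>

definition add_subgroup :: "'h::ring_1 set \<Rightarrow> bool" where
  "add_subgroup N \<longleftrightarrow> 0 \<in> N \<and> (\<forall>x \<in> N. \<forall>y \<in> N. x - y \<in> N)"

lemma add_subgroup_0: "add_subgroup N \<Longrightarrow> 0 \<in> N"
  and add_subgroup_diff: "add_subgroup N \<Longrightarrow> x \<in> N \<Longrightarrow> y \<in> N \<Longrightarrow> x - y \<in> N"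
  by (auto simp: add_subgroup_def)

lemma add_subgroup_uminus: "add_subgroup N \<Longrightarrow> x \<in> N \<Longrightarrow> - x \<in> N"
  using add_subgroup_diff[of N 0 x] add_subgroup_0 by auto

lemma add_subgroup_add: "add_subgroup N \<Longrightarrow> x \<in> N \<Longrightarrow> y \<in> N \<Longrightarrow> x + y \<in> N"
  using add_subgroup_diff[of N x "- y"] add_subgroup_uminus by auto

lemma in_coset_iff: "y \<in> x +o N \<longleftrightarrow> y - x \<in> N" for x :: "'h::ring_1"
  unfolding elt_set_plus_def by (auto simp: algebra_simps intro: bexI[of _ "y - x"])

lemma coset_eq_iff:
  assumes "add_subgroup N" shows "x +o N = y +o N \<longleftrightarrow> x - y \<in> N"
proof
  assume "x +o N = y +o N"
  moreover have "x \<in> x +o N" by (simp add: in_coset_iff add_subgroup_0 assms)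
  ultimately show "x - y \<in> N" by (simp add: in_coset_iff)
next
  assume *: "x - y \<in> N"
  show "x +o N = y +o N"
  proof (intro Set.set_eqI)
    fix z
    have "z - x \<in> N \<longleftrightarrow> z - y \<in> N"
      using add_subgroup_add[OF assms _ *, of "z - x"] add_subgroup_diff[OF assms _ *, of "z - y"]
      by auto
    then show "z \<in> x +o N \<longleftrightarrow> z \<in> y +o N" by (simp add: in_coset_iff)
  qed
qed

lemma coset_zero: "0 +o N = N" for N :: "'h::ring_1 set"
  by (simp add: elt_set_plus_def)

lemma coset_add:
  assumes "add_subgroup N" shows "(x +o N) + (y +o N) = (x + y) +o N"
proof (intro Set.set_eqI iffI)
  fix z assume "z \<in> (x +o N) + (y +o N)"
  then obtain a b where "a - x \<in> N" "b - y \<in> N" "z = a + b"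
    by (auto simp: set_plus_def in_coset_iff)
  then show "z \<in> (x + y) +o N"
    using add_subgroup_add[OF assms, of "a - x" "b - y"] by (simp add: in_coset_iff algebra_simps)
next
  fix z assume "z \<in> (x + y) +o N"
  then have "z - y \<in> x +o N" by (simp add: in_coset_iff algebra_simps)
  moreover have "y \<in> y +o N" by (simp add: in_coset_iff add_subgroup_0 assms)
  ultimately have "z - y + y \<in> (x +o N) + (y +o N)" by (rule set_plus_intro)
  then show "z \<in> (x +o N) + (y +o N)" by simp
qed

lemma coset_act:
  assumes N: "add_subgroup N" "\<And>n. n \<in> N \<Longrightarrow> h * n \<in> N"
  shows "h *o (x +o N) + N = (h * x) +o N"
proof (intro Set.set_eqI iffI)
  fix z assume "z \<in> h *o (x +o N) + N"
  then obtain a b where "a - x \<in> N" "b \<in> N" "z = h * a + b"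
    by (auto simp: set_plus_def elt_set_times_def in_coset_iff)
  then show "z \<in> (h * x) +o N"
    using add_subgroup_add[OF N(1) N(2)[of "a - x"], of b] by (simp add: in_coset_iff algebra_simps)
next
  fix z assume z: "z \<in> (h * x) +o N"
  have "x \<in> x +o N" by (simp add: in_coset_iff add_subgroup_0 N)
  then have "h * x \<in> h *o (x +o N)" by (auto simp: elt_set_times_def)
  then have "h * x + (z - h * x) \<in> h *o (x +o N) + N"
    using z by (intro set_plus_intro) (simp_all add: in_coset_iff)
  then show "z \<in> h *o (x +o N) + N" by simp
qed

text \<open>The map sends \<open>x + N'\<close> to \<open>e m + N\<close> for any \<open>m \<in> M\<close> with \<open>e m e \<in> x + N'\<close>.\<close>

lemma rep_iso_corner:
  assumes M: "add_subgroup M" and N: "add_subgroup N" "N \<subseteq> M"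
    and M': "add_subgroup M'" and N': "add_subgroup N'" "N' \<subseteq> M'"
    and e: "\<And>m. m \<in> M \<Longrightarrow> e * m \<in> M" "\<And>n. n \<in> N \<Longrightarrow> e * n \<in> N" "e * e = e"
    and H: "\<And>h. h \<in> H \<Longrightarrow> e * h = h \<and> h * e = h"
      "\<And>h m. h \<in> H \<Longrightarrow> m \<in> M \<Longrightarrow> h * m \<in> M" "\<And>h n. h \<in> H \<Longrightarrow> n \<in> N \<Longrightarrow> h * n \<in> N"
      "\<And>h m. h \<in> H \<Longrightarrow> m \<in> M' \<Longrightarrow> h * m \<in> M'" "\<And>h n. h \<in> H \<Longrightarrow> n \<in> N' \<Longrightarrow> h * n \<in> N'"
    and lift: "\<And>x. x \<in> M' \<Longrightarrow> \<exists>m \<in> M. e * m * e = x"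
    and lift_N: "\<And>x. x \<in> N' \<Longrightarrow> \<exists>n \<in> N. e * n * e = x"
    and kernel: "\<And>z. z \<in> M \<Longrightarrow> z * e = 0 \<Longrightarrow> z \<in> N"
    and meet: "\<And>n. n \<in> N \<Longrightarrow> e * n * e \<in> M' \<Longrightarrow> e * n * e \<in> N'"
    and onto: "\<And>m. m \<in> M \<Longrightarrow> \<exists>m' \<in> M. e * m' * e \<in> M' \<and> e * m - e * m' \<in> N"
  shows "rep_iso H (quotient_rep M' N') (idem_image e (quotient_rep M N))"
proof -
  define f where "f Z = (e * (SOME m. m \<in> M \<and> e * m * e \<in> Z)) +o N" for Z
  \<comment> \<open>The choice of \<open>m\<close> does not matter: the difference of two candidates
    is corrected by a lift \<open>n\<close> of the error in \<open>N'\<close>, after which right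
    multiplication by \<open>e\<close> kills it and \<open>kernel\<close> applies.\<close>
  have unique: "e * m - e * m' \<in> N"
    if "m \<in> M" "m' \<in> M" "e * m * e - x \<in> N'" "e * m' * e - x \<in> N'" for m m' x
  proof -
    have "(e * m * e - x) - (e * m' * e - x) \<in> N'"
      using that N' add_subgroup_diff by blast
    then obtain n where n: "n \<in> N" "e * n * e = e * m * e - e * m' * e"
      using lift_N by auto
    have "e * m - e * m' - e * n \<in> M"
      using that n N(2) by (intro add_subgroup_diff M e) auto
    moreover have "(e * m - e * m' - e * n) * e = 0"
      using n(2) by (simp add: left_diff_distrib)
    ultimately have "e * m - e * m' - e * n \<in> N" by (rule kernel)
    then show ?thesis using add_subgroup_add[OF N(1) _ e(2)[OF n(1)]] by fastforce
  qed
  have f: "f (x +o N') = (e * m) +o N" if "m \<in> M" "e * m * e - x \<in> N'" for x m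
  proof -
    define m' where "m' = (SOME m. m \<in> M \<and> e * m * e \<in> x +o N')"
    have "m' \<in> M \<and> e * m' * e \<in> x +o N'"
      unfolding m'_def by (rule someI[of _ m]) (use that in \<open>simp add: in_coset_iff\<close>)
    then show ?thesis
      unfolding f_def m'_def[symmetric] using that unique[of m' m x] N
      by (auto simp: coset_eq_iff in_coset_iff)
  qed
  have f': "f ((e * m * e) +o N') = (e * m) +o N" if "m \<in> M" for m
    using f[OF that] N' by (simp add: add_subgroup_0)
  have carrier: "carrier (idem_image e (quotient_rep M N)) = (\<lambda>m. (e * m) +o N) ` M"
    by (simp add: idem_image_def quotient_rep_def image_image coset_act[OF N(1) e(2)])
  have surj: "f ` carrier (quotient_rep M' N') = (\<lambda>m. (e * m) +o N) ` M"
  proof (intro equalityI subsetI)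
    fix Y assume "Y \<in> f ` carrier (quotient_rep M' N')"
    then obtain x where x: "x \<in> M'" "Y = f (x +o N')" by (auto simp: quotient_rep_def)
    then obtain m where "m \<in> M" "e * m * e = x" using lift by blast
    then show "Y \<in> (\<lambda>m. (e * m) +o N) ` M" using x f' by blast
  next
    fix Y assume "Y \<in> (\<lambda>m. (e * m) +o N) ` M"
    then obtain m where m: "m \<in> M" "Y = (e * m) +o N" by blast
    \<comment> \<open>\<open>M'\<close> may be smaller than the corner of \<open>M\<close>, so
      \<open>m\<close> is first replaced, modulo \<open>N\<close>, by an element whose corner lies
      in \<open>M'\<close>.\<close>
    obtain m' where m': "m' \<in> M" "e * m' * e \<in> M'" "e * m - e * m' \<in> N"
      using onto[OF m(1)] by blast
    then have "Y = f ((e * m' * e) +o N')" using m f' N by (simp add: coset_eq_iff)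
    then show "Y \<in> f ` carrier (quotient_rep M' N')" using m' by (simp add: quotient_rep_def)
  qed
  have inj: "inj_on f (carrier (quotient_rep M' N'))"
  proof (rule inj_onI)
    fix Y Z assume "Y \<in> carrier (quotient_rep M' N')" "Z \<in> carrier (quotient_rep M' N')" "f Y = f Z"
    then obtain x y where xy: "x \<in> M'" "Y = x +o N'" "y \<in> M'" "Z = y +o N'"
      by (auto simp: quotient_rep_def)
    obtain m n where mn: "m \<in> M" "e * m * e = x" "n \<in> M" "e * n * e = y"
      using lift xy by metis
    have "(e * m) +o N = (e * n) +o N"
      using \<open>f Y = f Z\<close> f'[OF mn(1)] f'[OF mn(3)] mn xy by simp
    then have in_N: "e * m - e * n \<in> N" using N by (simp add: coset_eq_iff)
    \<comment> \<open>Multiplying by \<open>e\<close> on the right undoes the map, and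
      \<open>meet\<close> sends the result into \<open>N'\<close>.\<close>
    have "e * (e * m - e * n) * e = x - y"
      unfolding mn(2,4)[symmetric] by (simp add: algebra_simps e(3) flip: mult.assoc)
    then have "x - y \<in> N'"
      using meet[OF in_N] add_subgroup_diff[OF M' xy(1,3)] by simp
    then show "Y = Z" using xy N' by (simp add: coset_eq_iff)
  qed
  have add: "f (Y + Z) = f Y + f Z"
    if "Y \<in> carrier (quotient_rep M' N')" "Z \<in> carrier (quotient_rep M' N')" for Y Z
  proof -
    obtain x y where xy: "x \<in> M'" "Y = x +o N'" "y \<in> M'" "Z = y +o N'"
      using \<open>Y \<in> _\<close> \<open>Z \<in> _\<close> by (auto simp: quotient_rep_def)
    obtain m n where mn: "m \<in> M" "e * m * e = x" "n \<in> M" "e * n * e = y"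
      using lift xy by metis
    have "Y + Z = (e * (m + n) * e) +o N'"
      using xy mn N' by (simp add: coset_add distrib_left distrib_right)
    then have "f (Y + Z) = (e * (m + n)) +o N"
      using f'[of "m + n"] mn M add_subgroup_add by auto
    also have "\<dots> = f Y + f Z"
      using f'[OF mn(1)] f'[OF mn(3)] mn xy N by (simp add: coset_add distrib_left)
    finally show ?thesis .
  qed
  have act: "f (h *o Y + N') = h *o f Y + N"
    if h: "h \<in> H" and "Y \<in> carrier (quotient_rep M' N')" for h Y
  proof -
    obtain x where x: "x \<in> M'" "Y = x +o N'"
      using \<open>Y \<in> _\<close> by (auto simp: quotient_rep_def)
    obtain m where m: "m \<in> M" "e * m * e = x" using lift x by blast
    have eh: "e * h = h" "h * e = h" using H(1)[OF h] by auto
    have "h *o Y + N' = (h * x) +o N'"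
      unfolding x by (rule coset_act[OF N'(1) H(5)[OF h]])
    also have "h * x = e * (h * m) * e"
      using eh by (simp add: m(2)[symmetric] flip: mult.assoc)
    finally have "f (h *o Y + N') = (e * (h * m)) +o N"
      using f'[OF H(2)[OF h m(1)]] by simp
    also have "e * (h * m) = h * (e * m)"
      using eh by (simp flip: mult.assoc)
    also have "(h * (e * m)) +o N = h *o f Y + N"
      using f'[OF m(1)] m x by (simp add: coset_act[OF N(1) H(3)[OF h]])
    finally show ?thesis .
  qed
  show ?thesis
    unfolding rep_iso_def
  proof (intro exI[of _ f] conjI ballI)
    show "bij_betw f (carrier (quotient_rep M' N')) (carrier (idem_image e (quotient_rep M N)))"
      unfolding bij_betw_def carrier using inj surj by blast
  qed (use add act in \<open>simp_all add: quotient_rep_def idem_image_def\<close>)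
qed

context hecke_kl
begin

section \<open>The idempotent attached to \<open>J\<close>\<close>

abbreviation WJ where "WJ \<equiv> generate W J"
abbreviation eJ where "eJ \<equiv> idem W S J scale T"
abbreviation P where "P \<equiv> poincare W S J"

lemma J_S: "s \<in> J \<Longrightarrow> s \<in> S" and J_carrier: "s \<in> J \<Longrightarrow> s \<in> carrier W"
  using J S_carrier by auto

lemma WJ_subgroup: "subgroup WJ W"
  using generate_is_subgroup J(1) generators(1) by blast

lemma WJ_carrier: "w \<in> WJ \<Longrightarrow> w \<in> carrier W"
  by (rule subgroup.mem_carrier[OF WJ_subgroup])

lemma WJ_mult: "s \<in> J \<Longrightarrow> w \<in> WJ \<Longrightarrow> s \<otimes> w \<in> WJ" "s \<in> J \<Longrightarrow> w \<in> WJ \<Longrightarrow> w \<otimes> s \<in> WJ"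
  by (rule subgroup.m_closed[OF WJ_subgroup]; simp add: generate.incl)+

lemma WJ_induct_left [consumes 1, case_names one step]:
  assumes "w \<in> WJ" "Q \<one>" "\<And>s w. s \<in> J \<Longrightarrow> w \<in> WJ \<Longrightarrow> Q w \<Longrightarrow> Q (s \<otimes> w)"
  shows "Q w"
proof -
  obtain ws where ws: "ws \<in> lists J" "w = word_prod W ws"
    using generate_word[OF J(1) assms(1)] .
  show ?thesis
    unfolding ws(2) using ws(1)
  proof induction
    case (Cons s ws)
    then show ?case using assms(3) word_generate[OF J(1), of ws] by auto
  qed (use assms in simp)
qed

lemma WJ_induct_right [consumes 1, case_names one step]:
  assumes "w \<in> WJ" "Q \<one>" "\<And>s w. s \<in> J \<Longrightarrow> w \<in> WJ \<Longrightarrow> Q w \<Longrightarrow> Q (w \<otimes> s)"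
  shows "Q w"
proof -
  obtain ws where ws: "ws \<in> lists J" "w = word_prod W ws"
    using generate_word[OF J(1) assms(1)] .
  show ?thesis
    unfolding ws(2) using ws(1)
  proof (induction ws rule: rev_induct)
    case (snoc s ws)
    then have *: "s \<in> J" "ws \<in> lists J" "ws \<in> lists S" using J by auto
    then have "word_prod W (ws @ [s]) = word_prod W ws \<otimes> s"
      using word_prod_append'[of ws "[s]"] J_S J_carrier by simp
    then show ?case using assms(3) snoc * word_generate[OF J(1), of ws] by auto
  qed (use assms in simp)
qed

lemma P_nonzero: "P \<noteq> 0"
  unfolding poincare_def by (rule sum_q_powers_nonzero) (use J(3) generate.one in auto)

text \<open>Reindexing by \<open>\<sigma>\<close> places \<open>q ^ \<ell> (\<sigma> w)\<close> at
  \<open>T w\<close>. Where \<open>\<sigma>\<close> shortens \<open>w\<close>, the quadratic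
  relation supplies exactly what is missing to reach \<open>q * q ^ \<ell> w\<close>.\<close>

lemma hecke_op_sum_WJ:
  assumes op: "hecke_op \<sigma> L" and WJ: "\<And>w. w \<in> WJ \<Longrightarrow> \<sigma> w \<in> WJ"
    and len: "\<And>w. w \<in> WJ \<Longrightarrow> \<ell> (\<sigma> w) = Suc (\<ell> w) \<or> \<ell> w = Suc (\<ell> (\<sigma> w))"
  shows "L eJ = scale q eJ"
proof -
  let ?u = "\<Sum>w \<in> WJ. scale (q ^ \<ell> w) (T w)"
  have "L ?u = (\<Sum>w \<in> WJ. scale (q ^ \<ell> w) (T (\<sigma> w)) +
      (if \<ell> (\<sigma> w) < \<ell> w then scale (q ^ \<ell> w * (q - inverse q)) (T w) else 0))"
    unfolding hecke_op_sum[OF op]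
    by (rule sum.cong) (auto simp: hecke_op_scale[OF op] hecke_op_T[OF op] WJ_carrier scale_right_distrib)
  also have "\<dots> = (\<Sum>w \<in> WJ. scale (q ^ \<ell> w) (T (\<sigma> w))) +
      (\<Sum>w \<in> WJ. if \<ell> (\<sigma> w) < \<ell> w then scale (q ^ \<ell> w * (q - inverse q)) (T w) else 0)"
    by (rule sum.distrib)
  also have "(\<Sum>w \<in> WJ. scale (q ^ \<ell> w) (T (\<sigma> w))) = (\<Sum>w \<in> WJ. scale (q ^ \<ell> (\<sigma> w)) (T w))"
    by (rule sum.reindex_bij_witness[of _ \<sigma> \<sigma>])
      (auto simp: WJ hecke_op_perm(2)[OF op] WJ_carrier)
  also have "\<dots> + (\<Sum>w \<in> WJ. if \<ell> (\<sigma> w) < \<ell> w then scale (q ^ \<ell> w * (q - inverse q)) (T w) else 0)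
      = (\<Sum>w \<in> WJ. scale (q ^ \<ell> (\<sigma> w)) (T w) +
          (if \<ell> (\<sigma> w) < \<ell> w then scale (q ^ \<ell> w * (q - inverse q)) (T w) else 0))"
    by (rule sum.distrib[symmetric])
  also have "\<dots> = (\<Sum>w \<in> WJ. scale (q * q ^ \<ell> w) (T w))"
  proof (rule sum.cong)
    fix w assume "w \<in> WJ"
    then consider "\<ell> (\<sigma> w) = Suc (\<ell> w)" | "\<ell> w = Suc (\<ell> (\<sigma> w))" using len by blast
    then show "scale (q ^ \<ell> (\<sigma> w)) (T w) +
        (if \<ell> (\<sigma> w) < \<ell> w then scale (q ^ \<ell> w * (q - inverse q)) (T w) else 0) =
      scale (q * q ^ \<ell> w) (T w)"
    proof cases
      case 2
      have "q ^ n + q ^ Suc n * (q - inverse q) = q * q ^ Suc n" for n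
        by (simp add: right_diff_distrib)
      then show ?thesis using 2 by (simp flip: scale_left_distrib)
    qed simp
  qed simp
  also have "\<dots> = scale q ?u"
    by (simp add: scale_sum_right)
  finally show ?thesis
    unfolding idem_def by (simp add: hecke_op_scale[OF op] mult.commute)
qed

lemma T_eJ: assumes "s \<in> J" shows "T s * eJ = scale q eJ" "eJ * T s = scale q eJ"
  using hecke_op_sum_WJ[OF hecke_op_left[OF J_S[OF assms]]]
    hecke_op_sum_WJ[OF hecke_op_right[OF J_S[OF assms]]] assms
    length_left_cases[OF J_S[OF assms]] length_right_cases[OF J_S[OF assms]]
  by (auto simp: WJ_mult WJ_carrier)

text \<open>The induction runs over arbitrary words in \<open>J\<close>, so the length may also
  drop; in that case the quadratic relation is read backwards.\<close>

lemma T_WJ_eJ: "w \<in> WJ \<Longrightarrow> T w * eJ = scale (q ^ \<ell> w) eJ"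
proof (induction rule: WJ_induct_left)
  case one then show ?case by (simp add: T_one)
next
  case (step s w)
  note s = J_S[OF step(1)] WJ_carrier[OF step(2)]
  have "T s * (T w * eJ) = scale (q ^ \<ell> w) (T s * eJ)"
    by (simp add: step(3) algebra)
  then have *: "T s * T w * eJ = scale (q * q ^ \<ell> w) eJ"
    using T_eJ[OF step(1)] by (simp add: mult.assoc mult.commute)
  show ?case
  proof (cases "\<ell> (s \<otimes> w) < \<ell> w")
    case True
    then have l: "\<ell> w = Suc (\<ell> (s \<otimes> w))" using length_left_cases[OF s] by auto
    have "T (s \<otimes> w) = T s * T w - scale (q - inverse q) (T w)"
      using T_left[OF s] True by simp
    then have "T (s \<otimes> w) * eJ = scale (q * q ^ \<ell> w - (q - inverse q) * q ^ \<ell> w) eJ"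
      using step(3) * by (simp add: left_diff_distrib algebra flip: scale_left_diff_distrib)
    also have "q * q ^ \<ell> w - (q - inverse q) * q ^ \<ell> w = q ^ \<ell> (s \<otimes> w)"
      by (simp add: l left_diff_distrib)
    finally show ?thesis .
  next
    case False
    then show ?thesis using T_left[OF s] * length_left_cases[OF s] by auto
  qed
qed

text \<open>Explains the normalisation by \<open>W_J(q^2)\<close>: one factor
  \<open>q ^ \<ell> w\<close> is the weight in \<open>eJ\<close>, the other the eigenvalue of
  \<open>T w\<close> on \<open>eJ\<close>.\<close>

lemma eJ_idem: "eJ * eJ = eJ"
proof -
  have "eJ * eJ = scale (inverse P) ((\<Sum>w \<in> WJ. scale (q ^ \<ell> w) (T w)) * eJ)"
    by (subst (1) idem_def) (simp add: algebra)
  also have "(\<Sum>w \<in> WJ. scale (q ^ \<ell> w) (T w)) * eJ = (\<Sum>w \<in> WJ. scale (q ^ (2 * \<ell> w)) eJ)"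
    unfolding sum_distrib_right
    by (rule sum.cong) (auto simp: algebra T_WJ_eJ mult_2 power_add)
  also have "\<dots> = scale P eJ"
    by (simp add: poincare_def scale_sum_left)
  finally show ?thesis using P_nonzero by simp
qed

lemma eJ_H: "eJ \<in> H"
  unfolding idem_def using A_ring q_coeff_ring inverse_poincare_coeff_ring
  by (intro H_scale H_sum H_T scalar_ring_power WJ_carrier) auto

definition left_desc :: "'w \<Rightarrow> bool" where "left_desc w \<longleftrightarrow> (\<exists>s \<in> J. \<ell> (s \<otimes> w) < \<ell> w)"
definition right_desc :: "'w \<Rightarrow> bool" where "right_desc w \<longleftrightarrow> (\<exists>s \<in> J. \<ell> (w \<otimes> s) < \<ell> w)"

text \<open>Separates the two eigenvalues q and -q^-1 of \<open>T s\<close>.\<close>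

lemma q_plus_inverse: "q + inverse q \<noteq> 0"
proof
  assume "q + inverse q = 0"
  then have "q * (q + inverse q) = 0" by simp
  then have "q ^ 2 = - 1" by (simp add: power2_eq_square distrib_left eq_neg_iff_add_eq_0)
  then have "monom 1 2 = (- 1 :: complex poly)"
    unfolding q_power by (simp add: One_fract_def eq_fract)
  then have "degree (monom 1 2 :: complex poly) = 0" by simp
  then show False by (simp add: degree_monom_eq)
qed

lemma scale_q_eq: assumes "scale q x = scale (- inverse q) x" shows "x = 0"
proof -
  have "scale (q + inverse q) x = 0" using assms by (simp add: scale_left_distrib)
  then show ?thesis using q_plus_inverse by simp
qed

text \<open>\<open>T s\<close> between the factors acts by q through \<open>eJ\<close> and by -q^-1
  through \<open>B w\<close>.\<close>

lemma eJ_B_left_desc: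
  assumes "w \<in> carrier W" "left_desc w" shows "eJ * B w = 0"
proof -
  obtain s where s: "s \<in> J" "\<ell> (s \<otimes> w) < \<ell> w" using assms by (auto simp: left_desc_def)
  have "scale q (eJ * B w) = eJ * (T s * B w)"
    using T_eJ(2)[OF s(1)] by (simp add: algebra(1)[symmetric] flip: mult.assoc)
  also have "\<dots> = scale (- inverse q) (eJ * B w)"
    by (simp only: B_left_descent[OF J_S[OF s(1)] assms(1) s(2)] algebra(2))
  finally show ?thesis by (rule scale_q_eq)
qed

lemma B_eJ_right_desc:
  assumes "w \<in> carrier W" "right_desc w" shows "B w * eJ = 0"
proof -
  obtain s where s: "s \<in> J" "\<ell> (w \<otimes> s) < \<ell> w" using assms by (auto simp: right_desc_def)
  have "scale q (B w * eJ) = (B w * T s) * eJ"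
    using T_eJ(1)[OF s(1)] by (simp add: algebra(2)[symmetric] mult.assoc)
  also have "\<dots> = scale (- inverse q) (B w * eJ)"
    by (simp only: B_right_descent[OF J_S[OF s(1)] assms(1) s(2)] algebra(1))
  finally show ?thesis by (rule scale_q_eq)
qed

lemma lincombs_B_UNIV_iff:
  "I \<subseteq> carrier W \<Longrightarrow> h \<in> lincombs UNIV scale B I \<longleftrightarrow> (\<forall>w \<in> carrier W. bc h w \<noteq> 0 \<longrightarrow> w \<in> I)"
  using lincombs_B_iff[of I UNIV] by simp

text \<open>By the quadratic relation, \<open>T s * g - scale q g\<close> is an eigenvector for
  -q^-1, hence supported on left descents. The span allows every descent in \<open>J\<close>, so the
  errors of successive letters add up inside it.\<close>

lemma T_minus_q_left:
  assumes "w \<in> WJ"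
  shows "T w * h - scale (q ^ \<ell> w) h \<in> lincombs UNIV scale B {w \<in> carrier W. left_desc w}"
    (is "_ \<in> ?L")
  using assms
proof (induction rule: WJ_induct_left)
  case one then show ?case by (simp add: T_one lincombs_zero)
next
  case (step s w)
  note s = J_S[OF step(1)] WJ_carrier[OF step(2)]
  have base: "T s * g - scale q g \<in> ?L" for g
  proof -
    have "T s * (T s * g - scale q g) = scale (- inverse q) (T s * g - scale q g)"
      using T_square[OF s(1)]
      by (simp add: right_diff_distrib left_diff_distrib distrib_right algebra scale_left_diff_distrib
          scale_right_diff_distrib flip: mult.assoc)
    then show ?thesis
      using bc_left_descent[OF s(1)] step(1) by (subst lincombs_B_UNIV_iff) (auto simp: left_desc_def)
  qed
  show ?case
  proof (cases "\<ell> (s \<otimes> w) < \<ell> w")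
    case True
    then have l: "\<ell> w = Suc (\<ell> (s \<otimes> w))" using length_left_cases[OF s] by auto
    have "T (s \<otimes> w) = T s * T w - scale (q - inverse q) (T w)"
      using T_left[OF s] True by simp
    then have "T (s \<otimes> w) * h - scale (q ^ \<ell> (s \<otimes> w)) h =
      (T s * (T w * h) - scale q (T w * h)) + scale (inverse q) (T w * h - scale (q ^ \<ell> w) h)"
      by (simp add: l left_diff_distrib algebra scale_left_diff_distrib scale_right_diff_distrib
          mult.assoc)
    then show ?thesis using base[of "T w * h"] step(3) by (simp add: lincombs_add lincombs_scale)
  next
    case False
    then have l: "\<ell> (s \<otimes> w) = Suc (\<ell> w)" using length_left_cases[OF s] by auto
    then have "T (s \<otimes> w) * h - scale (q ^ \<ell> (s \<otimes> w)) h =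
      (T s * (T w * h) - scale q (T w * h)) + scale q (T w * h - scale (q ^ \<ell> w) h)"
      using T_left[OF s] by (simp add: scale_right_diff_distrib flip: mult.assoc)
    then show ?thesis using base[of "T w * h"] step(3) by (simp add: lincombs_add lincombs_scale)
  qed
qed

lemma T_minus_q_right:
  assumes "w \<in> WJ"
  shows "h * T w - scale (q ^ \<ell> w) h \<in> lincombs UNIV scale B {w \<in> carrier W. right_desc w}"
    (is "_ \<in> ?L")
  using assms
proof (induction rule: WJ_induct_right)
  case one then show ?case by (simp add: T_one lincombs_zero)
next
  case (step s w)
  note s = J_S[OF step(1)] WJ_carrier[OF step(2)]
  have base: "g * T s - scale q g \<in> ?L" for g
  proof -
    have "(g * T s - scale q g) * T s = scale (- inverse q) (g * T s - scale q g)"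
      using T_square[OF s(1)]
      by (simp add: left_diff_distrib right_diff_distrib distrib_left algebra scale_left_diff_distrib
          scale_right_diff_distrib mult.assoc)
    then show ?thesis
      using bc_right_descent[OF s(1)] step(1) by (subst lincombs_B_UNIV_iff) (auto simp: right_desc_def)
  qed
  show ?case
  proof (cases "\<ell> (w \<otimes> s) < \<ell> w")
    case True
    then have l: "\<ell> w = Suc (\<ell> (w \<otimes> s))" using length_right_cases[OF s] by auto
    have "T (w \<otimes> s) = T w * T s - scale (q - inverse q) (T w)"
      using T_right[OF s] True by simp
    then have "h * T (w \<otimes> s) - scale (q ^ \<ell> (w \<otimes> s)) h =
      (h * T w * T s - scale q (h * T w)) + scale (inverse q) (h * T w - scale (q ^ \<ell> w) h)"
      by (simp add: l right_diff_distrib algebra scale_left_diff_distrib scale_right_diff_distrib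
          mult.assoc)
    then show ?thesis using base[of "h * T w"] step(3) by (simp add: lincombs_add lincombs_scale)
  next
    case False
    then have l: "\<ell> (w \<otimes> s) = Suc (\<ell> w)" using length_right_cases[OF s] by auto
    then have "h * T (w \<otimes> s) - scale (q ^ \<ell> (w \<otimes> s)) h =
      (h * T w * T s - scale q (h * T w)) + scale q (h * T w - scale (q ^ \<ell> w) h)"
      using T_right[OF s] by (simp add: scale_right_diff_distrib mult.assoc)
    then show ?thesis using base[of "h * T w"] step(3) by (simp add: lincombs_add lincombs_scale)
  qed
qed

text \<open>The weights \<open>q ^ \<ell> w / P\<close> times the factors
  \<open>q ^ \<ell> w\<close> sum to 1, so averaging gives \<open>h\<close> modulo the span. An
  abstract linear \<open>M\<close> serves left and right multiplication alike.\<close>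

lemma eJ_average:
  fixes M :: "'h \<Rightarrow> 'h"
  assumes "\<And>x y. M (x + y) = M x + M y" "\<And>a x. M (scale a x) = scale a (M x)"
    and "\<And>w. w \<in> WJ \<Longrightarrow> M (T w) - scale (q ^ \<ell> w) h \<in> lincombs UNIV scale B I"
  shows "M eJ - h \<in> lincombs UNIV scale B I"
proof -
  have M0: "M 0 = 0" using assms(2)[of 0 0] by simp
  have M_sum: "M (sum f F) = (\<Sum>i \<in> F. M (f i))" for f and F :: "'w set"
    by (induction F rule: infinite_finite_induct) (auto simp: assms(1) M0)
  have 1: "M eJ = scale (inverse P) (\<Sum>w \<in> WJ. scale (q ^ \<ell> w) (M (T w)))"
    unfolding idem_def by (simp add: assms(2) M_sum)
  have "(\<Sum>w \<in> WJ. scale (q ^ \<ell> w) (scale (q ^ \<ell> w) h)) = scale P h"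
    by (simp add: poincare_def scale_sum_left mult_2 power_add)
  then have 2: "scale (inverse P) (\<Sum>w \<in> WJ. scale (q ^ \<ell> w) (scale (q ^ \<ell> w) h)) = h"
    using P_nonzero by simp
  have "scale (inverse P) (\<Sum>w \<in> WJ. scale (q ^ \<ell> w) (M (T w) - scale (q ^ \<ell> w) h)) = M eJ - h"
    by (simp only: scale_right_diff_distrib sum_subtractf 1 2)
  moreover have "scale (inverse P) (\<Sum>w \<in> WJ. scale (q ^ \<ell> w) (M (T w) - scale (q ^ \<ell> w) h))
      \<in> lincombs UNIV scale B I"
    using assms(3) by (intro lincombs_scale lincombs_sum) auto
  ultimately show ?thesis by simp
qed

lemma bc_eJ_left:
  assumes "w \<in> carrier W" "bc (eJ * h - h) w \<noteq> 0" shows "left_desc w"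
proof -
  have "eJ * h - h \<in> lincombs UNIV scale B {w \<in> carrier W. left_desc w}"
    using eJ_average[of "\<lambda>x. x * h"] T_minus_q_left by (simp add: distrib_right algebra)
  then show ?thesis using assms by (subst (asm) lincombs_B_UNIV_iff) auto
qed

lemma bc_eJ_right:
  assumes "w \<in> carrier W" "bc (h * eJ - h) w \<noteq> 0" shows "right_desc w"
proof -
  have "h * eJ - h \<in> lincombs UNIV scale B {w \<in> carrier W. right_desc w}"
    using eJ_average[of "\<lambda>x. h * x"] T_minus_q_right by (simp add: distrib_left algebra)
  then show ?thesis using assms by (subst (asm) lincombs_B_UNIV_iff) auto
qed

lemma right_annihilator:
  assumes "h * eJ = 0" "w \<in> carrier W" "bc h w \<noteq> 0" shows "right_desc w"
proof -
  have "bc (h * eJ - h) w \<noteq> 0"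
    using assms(3) unfolding coord_diff[OF basis_B B_span B_span] assms(1) by (simp add: bc_simps)
  then show ?thesis by (rule bc_eJ_right[OF assms(2)])
qed

text \<open>A non-zero coefficient of \<open>h\<close> at \<open>w\<close> either changes under left
  multiplication by \<open>eJ\<close>, forcing a left descent, or persists in \<open>eJ * h\<close>,
  which \<open>eJ\<close> annihilates from the right.\<close>

lemma two_sided_annihilator:
  assumes "eJ * h * eJ = 0" "w \<in> carrier W" "bc h w \<noteq> 0" shows "left_desc w \<or> right_desc w"
proof -
  have "bc (eJ * h - h) w \<noteq> 0 \<or> bc (eJ * h) w \<noteq> 0"
    using assms(3) by (auto simp: bc_simps)
  then show ?thesis
    using bc_eJ_left[OF assms(2)] right_annihilator[OF assms(1,2)] by blast
qed

section \<open>The basis of the corner algebra\<close>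

abbreviation X where "X \<equiv> min_reps W S J"
abbreviation b :: "'w \<Rightarrow> 'h" where "b d \<equiv> eJ * dagger (C d) * eJ"
abbreviation HJ where "HJ \<equiv> corner eJ H"

lemma X_iff: "w \<in> X \<longleftrightarrow> w \<in> carrier W \<and> \<not> left_desc w \<and> \<not> right_desc w"
proof -
  have "\<ell> w < \<ell> (s \<otimes> w) \<longleftrightarrow> \<not> \<ell> (s \<otimes> w) < \<ell> w" "\<ell> w < \<ell> (w \<otimes> s) \<longleftrightarrow> \<not> \<ell> (w \<otimes> s) < \<ell> w"
    if "w \<in> carrier W" "s \<in> J" for s
    using length_neq[OF J_S[OF that(2)] that(1)] by auto
  then show ?thesis
    unfolding min_reps_iff[OF J(1)] no_descent_def left_desc_def right_desc_def by blast
qed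

lemma X_carrier: "X \<subseteq> carrier W"
  using X_iff by blast

lemma corner_expand: "eJ * h * eJ = (\<Sum>w | w \<in> X \<and> bc h w \<noteq> 0. scale (bc h w) (b w))"
proof -
  have "eJ * h * eJ = eJ * (\<Sum>w | w \<in> carrier W \<and> bc h w \<noteq> 0. scale (bc h w) (B w)) * eJ"
    using bc_expand[of h] by simp
  also have "\<dots> = (\<Sum>w | w \<in> carrier W \<and> bc h w \<noteq> 0. scale (bc h w) (b w))"
    by (simp add: sum_distrib_left sum_distrib_right algebra)
  also have "\<dots> = (\<Sum>w | w \<in> X \<and> bc h w \<noteq> 0. scale (bc h w) (b w))"
  proof (rule sum.mono_neutral_right)
    show "\<forall>w \<in> {w \<in> carrier W. bc h w \<noteq> 0} - {w \<in> X. bc h w \<noteq> 0}. scale (bc h w) (b w) = 0"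
    proof
      fix w assume "w \<in> {w \<in> carrier W. bc h w \<noteq> 0} - {w \<in> X. bc h w \<noteq> 0}"
      then have w: "w \<in> carrier W" "left_desc w \<or> right_desc w" using X_iff by auto
      then have "b w = 0"
        using eJ_B_left_desc[OF w(1)] B_eJ_right_desc[OF w(1)] by (metis mult.assoc mult_zero_left mult_zero_right)
      then show "scale (bc h w) (b w) = 0" by simp
    qed
  qed (use X_carrier bc_finite in auto)
  finally show ?thesis .
qed

lemma basis_b: "basis_on b X"
proof (rule basis_onI)
  fix F c assume F: "finite F" "F \<subseteq> X" "(\<Sum>i \<in> F. scale (c i) (b i)) = 0"
  let ?h = "\<Sum>i \<in> F. scale (c i) (B i)"
  have Fc: "F \<subseteq> carrier W" using F X_carrier by blast
  have "eJ * ?h * eJ = (\<Sum>i \<in> F. scale (c i) (b i))"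
    by (simp add: sum_distrib_left sum_distrib_right algebra)
  then have 0: "eJ * ?h * eJ = 0" using F(3) by simp
  show "\<forall>i \<in> F. c i = 0"
  proof (rule ballI, rule ccontr)
    fix i assume i: "i \<in> F" "c i \<noteq> 0"
    then have "bc ?h i \<noteq> 0" using coord_lincomb[OF basis_B F(1) Fc, of i c] Fc by auto
    then have "left_desc i \<or> right_desc i" using two_sided_annihilator[OF 0, of i] i Fc by blast
    then show False using i F X_iff by blast
  qed
qed

abbreviation jc :: "'h \<Rightarrow> 'w \<Rightarrow> ratfun" where "jc \<equiv> coord b X"

lemma jc_corner: "x \<in> X \<Longrightarrow> jc (eJ * h * eJ) x = bc h x"
  unfolding corner_expand[of h]
  by (subst coord_lincomb[OF basis_b])
    (use X_carrier bc_finite[of h] in \<open>auto intro: finite_subset[of _ "{w \<in> carrier W. bc h w \<noteq> 0}"]\<close>)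

lemma corner_span: "eJ * h * eJ \<in> span (b ` X)"
  unfolding corner_expand[of h] by (intro span_sum span_scale span_base) auto

lemma corner_lincombs_iff:
  assumes "I \<subseteq> X" "0 \<in> R"
  shows "eJ * h * eJ \<in> lincombs R scale b I \<longleftrightarrow> (\<forall>x \<in> X. bc h x \<in> R \<and> (bc h x \<noteq> 0 \<longrightarrow> x \<in> I))"
  using lincombs_iff[OF basis_b assms] corner_span jc_corner by simp

lemma lincombs_b_lift:
  assumes "x \<in> lincombs R scale b I"
  obtains m where "m \<in> lincombs R scale B I" "eJ * m * eJ = x"
proof -
  obtain F c where x: "x = (\<Sum>i \<in> F. scale (c i) (b i))" "finite F" "F \<subseteq> I" "c ` F \<subseteq> R"
    using assms unfolding lincombs_def by blast
  show thesis
  proof (rule that)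
    show "(\<Sum>i \<in> F. scale (c i) (B i)) \<in> lincombs R scale B I"
      unfolding lincombs_def using x by blast
    show "eJ * (\<Sum>i \<in> F. scale (c i) (B i)) * eJ = x"
      unfolding x(1) by (simp add: sum_distrib_left sum_distrib_right algebra)
  qed
qed

lemma HJ_D: assumes "h \<in> HJ" shows "h \<in> H" "eJ * h = h" "h * eJ = h"
proof -
  obtain g where g: "g \<in> H" "h = eJ * g * eJ" using assms by (auto simp: corner_def)
  show "h \<in> H" using g by (simp add: H_mult eJ_H)
  show "eJ * h = h" using g eJ_idem by (simp flip: mult.assoc)
  show "h * eJ = h" using g eJ_idem by (simp add: mult.assoc)
qed

lemma HJ_mult_b:
  assumes "eJ * h = h" "h * eJ = h" shows "h * b d = eJ * (h * B d) * eJ"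
proof -
  have "h * b d = (h * eJ) * B d * eJ" by (simp add: mult.assoc)
  also have "\<dots> = (eJ * h) * B d * eJ" by (simp only: assms)
  finally show ?thesis by (simp add: mult.assoc)
qed

section \<open>The left preorders on \<open>W\<close> and on \<open>X\<close>\<close>

abbreviation le :: "'w \<Rightarrow> 'w \<Rightarrow> bool" where "le \<equiv> cell_le scale H B (carrier W)"
abbreviation leJ :: "'w \<Rightarrow> 'w \<Rightarrow> bool" where "leJ \<equiv> cell_le scale HJ b X"

lemma cell_step_iff:
  "cell_step scale H B (carrier W) j i \<longleftrightarrow>
    i \<in> carrier W \<and> j \<in> carrier W \<and> (\<exists>h \<in> H. bc (h * B i) j \<noteq> 0)"
  by (simp add: cell_step_def coord_def)

text \<open>Both preorders become conditions on \<open>bc\<close>; they differ only in the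
  multipliers and in the indices allowed.\<close>

lemma cell_stepJ_iff:
  "cell_step scale HJ b X j i \<longleftrightarrow> i \<in> X \<and> j \<in> X \<and> (\<exists>h \<in> HJ. bc (h * B i) j \<noteq> 0)"
proof -
  have "cell_step scale HJ b X j i \<longleftrightarrow> i \<in> X \<and> j \<in> X \<and> (\<exists>h \<in> HJ. jc (h * b i) j \<noteq> 0)"
    by (simp add: cell_step_def coord_def)
  moreover have "jc (h * b i) j = bc (h * B i) j" if "h \<in> HJ" "j \<in> X" for h
    using HJ_mult_b[OF HJ_D(2,3)[OF that(1)]] jc_corner[OF that(2)] by simp
  ultimately show ?thesis by auto
qed

lemma le_trans: "le x y \<Longrightarrow> le y z \<Longrightarrow> le x z"
  unfolding cell_le_def by (rule rtranclp_trans)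

lemma leJ_trans: "leJ x y \<Longrightarrow> leJ y z \<Longrightarrow> leJ x z"
  unfolding cell_le_def by (rule rtranclp_trans)

lemma le_step: "h \<in> H \<Longrightarrow> i \<in> carrier W \<Longrightarrow> j \<in> carrier W \<Longrightarrow> bc (h * B i) j \<noteq> 0 \<Longrightarrow> le j i"
  unfolding cell_le_def using cell_step_iff by blast

lemma leJ_step: "h \<in> HJ \<Longrightarrow> i \<in> X \<Longrightarrow> j \<in> X \<Longrightarrow> bc (h * B i) j \<noteq> 0 \<Longrightarrow> leJ j i"
  unfolding cell_le_def using cell_stepJ_iff by blast

text \<open>Multipliers from the corner are multipliers from \<open>H\<close>. The reverse
  implication is established only inside a cell, with the help of irreducibility.\<close>

lemma leJ_le: "leJ x y \<Longrightarrow> le x y"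
  unfolding cell_le_def
proof (erule rtranclp_mono[THEN predicate2D, rotated])
  show "cell_step scale HJ b X \<le> cell_step scale H B (carrier W)"
    by (rule predicate2I, unfold cell_stepJ_iff cell_step_iff) (use X_carrier HJ_D(1) in blast)
qed

text \<open>Left multiplication commutes with right multiplication by \<open>T s\<close>, so
  \<open>h * B i\<close> inherits the eigenvalue -q^-1, and all its terms the descent. The same
  \<open>s\<close> serves along the whole chain.\<close>

lemma le_right_desc:
  assumes "le x y" "right_desc y" shows "right_desc x"
proof -
  obtain s where s: "s \<in> J" "\<ell> (y \<otimes> s) < \<ell> y" using assms by (auto simp: right_desc_def)
  have "\<ell> (x \<otimes> s) < \<ell> x"
    using assms(1) unfolding cell_le_def
  proof (induction rule: converse_rtranclp_induct)
    case (step j i)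
    then obtain h where h: "i \<in> carrier W" "j \<in> carrier W" "bc (h * B i) j \<noteq> 0"
      using cell_step_iff by blast
    have "(h * B i) * T s = scale (- inverse q) (h * B i)"
      by (simp only: mult.assoc B_right_descent[OF J_S[OF s(1)] h(1) step.IH] algebra(2))
    then show ?case using bc_right_descent[OF J_S[OF s(1)]] h by blast
  qed (use s in simp)
  then show ?thesis using s by (auto simp: right_desc_def)
qed

lemma ideal_A:
  assumes I: "I \<subseteq> carrier W" "\<And>i j. i \<in> I \<Longrightarrow> j \<in> carrier W \<Longrightarrow> le j i \<Longrightarrow> j \<in> I"
    and "h \<in> H" "m \<in> lincombs A scale B I"
  shows "h * m \<in> lincombs A scale B I"
  using assms(4)
proof (induction rule: lincombs_induct)
  case (base i)
  then have i: "i \<in> carrier W" using I by blast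
  have "h * B i \<in> H" using assms(3) i by (simp add: H_mult B_H)
  then have "\<forall>w \<in> carrier W. bc (h * B i) w \<in> A" by (simp add: H_iff_bc)
  moreover have "w \<in> I" if "w \<in> carrier W" "bc (h * B i) w \<noteq> 0" for w
    using I(2)[OF base that(1) le_step[OF assms(3) i that]] .
  ultimately show ?case
    using lincombs_B_iff[OF I(1) scalar_ring_0[OF A_ring]] by blast
qed (use A_ring in \<open>auto simp: lincombs_zero distrib_left algebra intro: lincombs_add lincombs_scale\<close>)

text \<open>The preorder refers to the \<open>A\<close>-form, but \<open>h\<close> now has
  coefficients in C(q). By linearity it suffices to treat \<open>T w * B i\<close>, where
  \<open>ideal_A\<close> applies.\<close>

lemma ideal_UNIV:
  assumes I: "I \<subseteq> carrier W" "\<And>i j. i \<in> I \<Longrightarrow> j \<in> carrier W \<Longrightarrow> le j i \<Longrightarrow> j \<in> I"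
    and "m \<in> lincombs UNIV scale B I"
  shows "h * m \<in> lincombs UNIV scale B I"
proof (induction h rule: T_induct)
  case (base w)
  show ?case
    using assms(3)
  proof (induction rule: lincombs_induct)
    case (base i)
    have "T w * B i \<in> lincombs A scale B I"
      by (rule ideal_A[OF I H_T[OF \<open>w \<in> carrier W\<close>] lincombs_incl[OF A_ring base]])
    then show ?case using lincombs_mono[OF subset_UNIV subset_refl] by (rule subsetD[rotated])
  qed (auto simp: lincombs_zero distrib_left algebra intro: lincombs_add lincombs_scale)
qed (auto simp: lincombs_zero distrib_right algebra intro: lincombs_add lincombs_scale)

lemma idealJ_A:
  assumes I: "I \<subseteq> X" "\<And>i j. i \<in> I \<Longrightarrow> j \<in> X \<Longrightarrow> leJ j i \<Longrightarrow> j \<in> I"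
    and "h \<in> HJ" "m \<in> lincombs A scale b I"
  shows "h * m \<in> lincombs A scale b I"
  using assms(4)
proof (induction rule: lincombs_induct)
  case (base i)
  then have i: "i \<in> X" "i \<in> carrier W" using I X_carrier by blast+
  have "h * B i \<in> H" using HJ_D(1)[OF assms(3)] i by (simp add: H_mult B_H)
  then have "\<forall>w \<in> X. bc (h * B i) w \<in> A" using X_carrier H_iff_bc by blast
  moreover have "w \<in> I" if "w \<in> X" "bc (h * B i) w \<noteq> 0" for w
    using I(2)[OF base that(1) leJ_step[OF assms(3) i(1) that]] .
  ultimately have "eJ * (h * B i) * eJ \<in> lincombs A scale b I"
    using corner_lincombs_iff[OF I(1) scalar_ring_0[OF A_ring]] by blast
  then show ?case using HJ_mult_b[OF HJ_D(2,3)[OF assms(3)]] by simp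
qed (use A_ring in \<open>auto simp: lincombs_zero distrib_left algebra intro: lincombs_add lincombs_scale\<close>)

end

context hecke_kl
begin

text \<open>Both coefficients are coordinates of one and the same corner element, since
  \<open>eJ\<close> is idempotent.\<close>

lemma bc_eJ_X: assumes "x \<in> X" shows "bc (eJ * h) x = bc h x"
proof -
  have "eJ * (eJ * h) * eJ = eJ * h * eJ"
    using eJ_idem by (simp flip: mult.assoc)
  then show ?thesis using jc_corner[OF assms, of "eJ * h"] jc_corner[OF assms, of h] by simp
qed

lemma lincombs_add_subgroup: "scalar_ring R \<Longrightarrow> add_subgroup (lincombs R scale B' I)"
  by (simp add: add_subgroup_def lincombs_zero lincombs_diff)

section \<open>A left cell with irreducible representation\<close>

context
  fixes \<Gamma> d0
  assumes cell: "\<Gamma> \<in> left_cells scale H B (carrier W)" and d0: "d0 \<in> \<Gamma>" "d0 \<in> X"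
    and irred: "irreducible_rep UNIV (cell_rep UNIV scale H B (carrier W) \<Gamma>)"
begin

lemma cell_iff: "x \<in> \<Gamma> \<longleftrightarrow> x \<in> carrier W \<and> le d0 x \<and> le x d0"
proof -
  obtain i where "i \<in> carrier W" "\<Gamma> = {j \<in> carrier W. le i j \<and> le j i}"
    using cell unfolding left_cells_def quotient_def by auto
  then show ?thesis using d0(1) le_trans by blast
qed

lemma cell_no_right_desc: "x \<in> \<Gamma> \<Longrightarrow> \<not> right_desc x"
  using le_right_desc[of d0 x] d0(2) X_iff cell_iff by blast

definition up_to :: "'w set" where "up_to = {i \<in> carrier W. \<exists>y \<in> \<Gamma>. le i y}"
definition below :: "'w set" where "below = {i \<in> carrier W. \<exists>y \<in> \<Gamma>. le i y \<and> \<not> le y i}"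

lemma up_to_iff: "i \<in> up_to \<longleftrightarrow> i \<in> carrier W \<and> le i d0"
  unfolding up_to_def using cell_iff d0(1) le_trans by blast

lemma below_iff: "i \<in> below \<longleftrightarrow> i \<in> carrier W \<and> le i d0 \<and> \<not> le d0 i"
  unfolding below_def using cell_iff d0(1) le_trans by blast

lemma below_cases: "i \<in> below \<longleftrightarrow> i \<in> up_to \<and> i \<notin> \<Gamma>"
  using up_to_iff below_iff cell_iff by blast

lemma up_to_closed: "i \<in> up_to \<Longrightarrow> j \<in> carrier W \<Longrightarrow> le j i \<Longrightarrow> j \<in> up_to"
  unfolding up_to_iff using le_trans by blast

lemma below_closed: "i \<in> below \<Longrightarrow> j \<in> carrier W \<Longrightarrow> le j i \<Longrightarrow> j \<in> below"
  unfolding below_iff using le_trans by blast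

lemma sub_carrier: "up_to \<subseteq> carrier W" "below \<subseteq> carrier W"
  by (auto simp: up_to_def below_def)

lemma ideal_up_to: "h \<in> H \<Longrightarrow> m \<in> lincombs A scale B up_to \<Longrightarrow> h * m \<in> lincombs A scale B up_to"
  and ideal_up_to_UNIV: "m \<in> lincombs UNIV scale B up_to \<Longrightarrow> h * m \<in> lincombs UNIV scale B up_to"
  by (rule ideal_A[OF sub_carrier(1)] ideal_UNIV[OF sub_carrier(1)]; blast intro: up_to_closed)+

lemma ideal_below: "h \<in> H \<Longrightarrow> m \<in> lincombs A scale B below \<Longrightarrow> h * m \<in> lincombs A scale B below"
  and ideal_below_UNIV: "m \<in> lincombs UNIV scale B below \<Longrightarrow> h * m \<in> lincombs UNIV scale B below"
  by (rule ideal_A[OF sub_carrier(2)] ideal_UNIV[OF sub_carrier(2)]; blast intro: below_closed)+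

lemma cell_rep_eq: "cell_rep R scale H B (carrier W) \<Gamma> =
    quotient_rep (lincombs R scale B up_to) (lincombs R scale B below)"
  by (simp add: cell_rep_def up_to_def below_def)

text \<open>Inside the cell the finer preorder separates nothing: the multiplier that carries
  \<open>eJ * B d\<close> to \<open>B d'\<close> modulo smaller cells is moved first into the corner
  and then into the \<open>A\<close>-form.\<close>

lemma cell_leJ:
  assumes d: "d \<in> \<Gamma>" "d \<in> X" and d': "d' \<in> \<Gamma>" "d' \<in> X"
  shows "leJ d' d"
proof -
  define M where "M = lincombs UNIV scale B up_to"
  define N where "N = lincombs UNIV scale B below"
  have N: "add_subgroup N" unfolding N_def by (simp add: lincombs_add_subgroup)
  have ideal_M: "h * m \<in> M" if "m \<in> M" for h m
    using ideal_up_to_UNIV that unfolding M_def by blast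
  have ideal_N: "h * n \<in> N" if "n \<in> N" for h n
    using ideal_below_UNIV that unfolding N_def by blast
  have in_M: "B x \<in> M" if "x \<in> \<Gamma>" for x
    unfolding M_def using that cell_iff up_to_iff by (intro lincombs_incl) auto
  have N_bc: "bc n x = 0" if "n \<in> N" "x \<in> \<Gamma>" for n x
    using that below_cases cell_iff unfolding N_def lincombs_B_UNIV_iff[OF sub_carrier(2)] by blast
  define V where "V = quotient_rep M N"
  define U where "U = (\<lambda>h. (h * (eJ * B d)) +o N) ` UNIV"
  have "U \<subseteq> carrier V"
    unfolding U_def V_def quotient_rep_def using ideal_M in_M[OF d(1)] by auto
  moreover have "vzero V \<in> U"
    unfolding U_def V_def quotient_rep_def by (auto simp: coset_zero intro!: image_eqI[of _ _ 0])
  moreover have "vadd V u v \<in> U" if "u \<in> U" "v \<in> U" for u v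
  proof -
    obtain h g where "u = (h * (eJ * B d)) +o N" "v = (g * (eJ * B d)) +o N"
      using \<open>u \<in> U\<close> \<open>v \<in> U\<close> by (auto simp: U_def)
    then have "vadd V u v = ((h + g) * (eJ * B d)) +o N"
      unfolding V_def quotient_rep_def by (simp add: coset_add[OF N] distrib_right)
    then show ?thesis unfolding U_def by blast
  qed
  moreover have "act V h u \<in> U" if "u \<in> U" for h u
  proof -
    obtain g where "u = (g * (eJ * B d)) +o N" using \<open>u \<in> U\<close> by (auto simp: U_def)
    then have "act V h u = ((h * g) * (eJ * B d)) +o N"
      unfolding V_def quotient_rep_def using coset_act[OF N ideal_N, of h] by (simp add: mult.assoc)
    then show ?thesis unfolding U_def by blast
  qed
  moreover have "irreducible_rep UNIV V"
    using irred unfolding cell_rep_eq V_def M_def N_def .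
  ultimately have "U = {vzero V} \<or> U = carrier V"
    unfolding irreducible_rep_def by simp
  moreover have "U \<noteq> {vzero V}"
  proof
    assume "U = {vzero V}"
    moreover have "(1 * (eJ * B d)) +o N \<in> U" unfolding U_def by blast
    ultimately have "(eJ * B d) +o N = 0 +o N"
      by (simp add: V_def quotient_rep_def coset_zero)
    then have "eJ * B d \<in> N" by (simp only: coset_eq_iff[OF N] diff_zero)
    \<comment> \<open>By \<open>bc_eJ_X\<close> this coefficient is that of \<open>B d\<close> at
      \<open>d\<close>, which is 1.\<close>
    then have "bc (eJ * B d) d = 0" using N_bc d by blast
    then show False using d X_carrier by (simp add: bc_eJ_X bc_simps subset_iff)
  qed
  moreover have "B d' +o N \<in> carrier V"
    unfolding V_def quotient_rep_def using in_M[OF d'(1)] by simp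
  ultimately obtain h where "B d' +o N = (h * (eJ * B d)) +o N"
    unfolding U_def by blast
  then have "B d' - h * (eJ * B d) \<in> N" using coset_eq_iff[OF N] by blast
  then have "bc (B d' - h * (eJ * B d)) d' = 0" using N_bc d' by blast
  then have "bc (h * (eJ * B d)) d' \<noteq> 0"
    using d' X_carrier by (simp add: bc_simps subset_iff)
  \<comment> \<open>As \<open>d'\<close> lies in \<open>X\<close>, a further \<open>eJ\<close> on
    the left does not change the coefficient, and the multiplier becomes a corner element.\<close>
  then have h: "bc (eJ * h * eJ * B d) d' \<noteq> 0"
    using bc_eJ_X[OF d'(2), of "h * (eJ * B d)"] by (simp add: mult.assoc)
  \<comment> \<open>\<open>h\<close> has coefficients in C(q), while \<open>leJ\<close> asks for a
    multiplier over \<open>A\<close>. The coefficient is linear in \<open>h\<close>, so some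
    \<open>T w\<close> already detects it.\<close>
  have "\<exists>w \<in> carrier W. bc (eJ * T w * eJ * B d) d' \<noteq> 0"
  proof (rule ccontr)
    assume n: "\<not> ?thesis"
    have "bc (eJ * h * eJ * B d) d' = 0"
      by (induction h rule: T_induct)
        (use n in \<open>simp_all add: bc_simps distrib_left distrib_right algebra\<close>)
    then show False using h by simp
  qed
  then obtain w where w: "w \<in> carrier W" "bc (eJ * T w * eJ * B d) d' \<noteq> 0" by blast
  have "eJ * T w * eJ \<in> HJ" using H_T[OF w(1)] by (simp add: corner_def)
  then show ?thesis using leJ_step d(2) d'(2) w(2) by blast
qed

lemma cellJ_iff: "x \<in> \<Gamma> \<inter> X \<longleftrightarrow> x \<in> X \<and> leJ d0 x \<and> leJ x d0"
proof
  assume "x \<in> X \<and> leJ d0 x \<and> leJ x d0"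
  then show "x \<in> \<Gamma> \<inter> X" using leJ_le cell_iff X_carrier by blast
qed (use cell_leJ d0 in blast)

lemma cellJ: "\<Gamma> \<inter> X \<in> left_cells scale HJ b X"
proof -
  have "\<Gamma> \<inter> X = {(i, j) \<in> X \<times> X. leJ i j \<and> leJ j i} `` {d0}"
    using cellJ_iff d0 by auto
  then show ?thesis
    unfolding left_cells_def by (simp only: quotientI[OF d0(2)])
qed

definition up_toJ :: "'w set" where "up_toJ = {i \<in> X. \<exists>y \<in> \<Gamma> \<inter> X. leJ i y}"
definition belowJ :: "'w set" where "belowJ = {i \<in> X. \<exists>y \<in> \<Gamma> \<inter> X. leJ i y \<and> \<not> leJ y i}"

lemma up_toJ_iff: "i \<in> up_toJ \<longleftrightarrow> i \<in> X \<and> leJ i d0"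
  unfolding up_toJ_def using cellJ_iff d0 leJ_trans by blast

lemma belowJ_iff: "i \<in> belowJ \<longleftrightarrow> i \<in> X \<and> leJ i d0 \<and> \<not> leJ d0 i"
  unfolding belowJ_def using cellJ_iff d0 leJ_trans by blast

lemma cell_repJ_eq: "cell_rep R scale HJ b X (\<Gamma> \<inter> X) =
    quotient_rep (lincombs R scale b up_toJ) (lincombs R scale b belowJ)"
  by (simp add: cell_rep_def up_toJ_def belowJ_def)

text \<open>Inclusions are the most to expect here: \<open>leJ\<close> may be finer than
  \<open>le\<close>, so \<open>up_toJ\<close> may miss elements of \<open>up_to \<inter> X\<close>
  outside the cell.\<close>

lemma up_toJ_subset: "up_toJ \<subseteq> X" "up_toJ \<subseteq> up_to"
  using up_toJ_iff up_to_iff leJ_le X_carrier by blast+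

lemma belowJ_subset: "belowJ \<subseteq> X" "belowJ \<subseteq> up_toJ" "belowJ \<subseteq> below"
proof -
  show "belowJ \<subseteq> X" "belowJ \<subseteq> up_toJ" using belowJ_iff up_toJ_iff by auto
  show "belowJ \<subseteq> below"
  proof
    fix i assume "i \<in> belowJ"
    then have i: "i \<in> X" "leJ i d0" "\<not> leJ d0 i" using belowJ_iff by auto
    then have "i \<in> up_to" using up_toJ_iff up_toJ_subset by blast
    moreover have "i \<notin> \<Gamma>" using i cellJ_iff by blast
    ultimately show "i \<in> below" using below_cases by blast
  qed
qed

text \<open>An index with a left descent in \<open>J\<close> is killed by \<open>eJ\<close>. Without
  one it cannot lie in \<open>\<Gamma>\<close>, whose elements have no right descents and would then
  belong to \<open>X\<close>; so it lies in \<open>below\<close>, which spans an ideal.\<close>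

lemma eJ_outside_cell:
  assumes "m \<in> lincombs A scale B (up_to - \<Gamma> \<inter> X)"
  shows "eJ * m \<in> lincombs A scale B below"
  using assms
proof (induction rule: lincombs_induct)
  case (base i)
  then have i: "i \<in> carrier W" using sub_carrier by blast
  show ?case
  proof (cases "left_desc i")
    case True
    then show ?thesis using eJ_B_left_desc i by (simp add: lincombs_zero)
  next
    case False
    then have "i \<notin> \<Gamma>" using base i X_iff cell_no_right_desc by blast
    then have "i \<in> below" using base below_cases by blast
    then show ?thesis
      by (rule ideal_below[OF eJ_H lincombs_incl[OF A_ring]])
  qed
qed (use A_ring in \<open>auto simp: lincombs_zero distrib_left algebra intro: lincombs_add lincombs_scale\<close>)

lemma cell_rep_iso:
  "rep_iso HJ (cell_rep A scale HJ b X (\<Gamma> \<inter> X))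
    (idem_image eJ (cell_rep A scale H B (carrier W) \<Gamma>))"
  unfolding cell_rep_eq cell_repJ_eq
proof (rule rep_iso_corner)
  note zero_A = scalar_ring_0[OF A_ring]
  note bc_up = lincombs_B_iff[OF sub_carrier(1) zero_A]
    and bc_below = lincombs_B_iff[OF sub_carrier(2) zero_A]
  show "add_subgroup (lincombs A scale B up_to)" "add_subgroup (lincombs A scale B below)"
    "add_subgroup (lincombs A scale b up_toJ)" "add_subgroup (lincombs A scale b belowJ)"
    by (simp_all add: lincombs_add_subgroup A_ring)
  show "lincombs A scale B below \<subseteq> lincombs A scale B up_to"
    by (rule lincombs_mono) (use below_cases in auto)
  show "lincombs A scale b belowJ \<subseteq> lincombs A scale b up_toJ"
    by (rule lincombs_mono[OF subset_refl belowJ_subset(2)])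
  show "eJ * eJ = eJ" by (rule eJ_idem)
  show "eJ * m \<in> lincombs A scale B up_to" if "m \<in> lincombs A scale B up_to" for m
    by (rule ideal_up_to[OF eJ_H that])
  show "eJ * m \<in> lincombs A scale B below" if "m \<in> lincombs A scale B below" for m
    by (rule ideal_below[OF eJ_H that])
  show "eJ * h = h \<and> h * eJ = h" if "h \<in> HJ" for h
    using HJ_D[OF that] by simp
  show "h * m \<in> lincombs A scale B up_to" if "h \<in> HJ" "m \<in> lincombs A scale B up_to" for h m
    by (rule ideal_up_to[OF HJ_D(1)[OF that(1)] that(2)])
  show "h * m \<in> lincombs A scale B below" if "h \<in> HJ" "m \<in> lincombs A scale B below" for h m
    by (rule ideal_below[OF HJ_D(1)[OF that(1)] that(2)])
  show "h * m \<in> lincombs A scale b up_toJ" if "h \<in> HJ" "m \<in> lincombs A scale b up_toJ" for h m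
  proof (rule idealJ_A[OF up_toJ_subset(1) _ that])
    show "j \<in> up_toJ" if "i \<in> up_toJ" "j \<in> X" "leJ j i" for i j
      using that up_toJ_iff leJ_trans by blast
  qed
  show "h * m \<in> lincombs A scale b belowJ" if "h \<in> HJ" "m \<in> lincombs A scale b belowJ" for h m
  proof (rule idealJ_A[OF belowJ_subset(1) _ that])
    show "j \<in> belowJ" if "i \<in> belowJ" "j \<in> X" "leJ j i" for i j
      using that belowJ_iff leJ_trans by blast
  qed
  show "\<exists>m \<in> lincombs A scale B up_to. eJ * m * eJ = x" if x: "x \<in> lincombs A scale b up_toJ" for x
  proof -
    obtain m where m: "m \<in> lincombs A scale B up_toJ" "eJ * m * eJ = x"
      using lincombs_b_lift[OF x] .
    then have "m \<in> lincombs A scale B up_to"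
      by (intro subsetD[OF lincombs_mono[OF subset_refl up_toJ_subset(2)]])
    then show ?thesis using m(2) by (rule bexI[rotated])
  qed
  show "\<exists>m \<in> lincombs A scale B below. eJ * m * eJ = x" if x: "x \<in> lincombs A scale b belowJ" for x
  proof -
    obtain m where m: "m \<in> lincombs A scale B belowJ" "eJ * m * eJ = x"
      using lincombs_b_lift[OF x] .
    then have "m \<in> lincombs A scale B below"
      by (intro subsetD[OF lincombs_mono[OF subset_refl belowJ_subset(3)]])
    then show ?thesis using m(2) by (rule bexI[rotated])
  qed
  \<comment> \<open>By \<open>right_annihilator\<close> a coefficient of \<open>z\<close> at an
    element of \<open>\<Gamma>\<close> would produce a right descent in the cell.\<close>
  show "z \<in> lincombs A scale B below" if "z \<in> lincombs A scale B up_to" "z * eJ = 0" for z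
    unfolding bc_below
  proof
    fix w assume w: "w \<in> carrier W"
    show "bc z w \<in> A \<and> (bc z w \<noteq> 0 \<longrightarrow> w \<in> below)"
      using that(1) w right_annihilator[OF that(2) w] cell_no_right_desc below_cases
      unfolding bc_up by blast
  qed
  show "eJ * n * eJ \<in> lincombs A scale b belowJ"
    if "n \<in> lincombs A scale B below" "eJ * n * eJ \<in> lincombs A scale b up_toJ" for n
    unfolding corner_lincombs_iff[OF belowJ_subset(1) zero_A]
  proof
    fix x assume x: "x \<in> X"
    then have "x \<in> carrier W" using X_carrier by blast
    then have 1: "bc n x \<noteq> 0 \<longrightarrow> x \<in> below" using that(1) unfolding bc_below by blast
    have 2: "bc n x \<in> A \<and> (bc n x \<noteq> 0 \<longrightarrow> x \<in> up_toJ)"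
      using that(2) x unfolding corner_lincombs_iff[OF up_toJ_subset(1) zero_A] by blast
    \<comment> \<open>\<open>x \<in> up_toJ\<close> gives \<open>leJ x d0\<close>, while
      \<open>x \<in> below\<close> excludes \<open>le d0 x\<close> and therefore also
      \<open>leJ d0 x\<close>.\<close>
    show "bc n x \<in> A \<and> (bc n x \<noteq> 0 \<longrightarrow> x \<in> belowJ)"
      using 1 2 unfolding below_iff belowJ_iff up_toJ_iff using leJ_le by blast
  qed
  show "\<exists>m' \<in> lincombs A scale B up_to. eJ * m' * eJ \<in> lincombs A scale b up_toJ \<and>
      eJ * m - eJ * m' \<in> lincombs A scale B below"
    if m: "m \<in> lincombs A scale B up_to" for m
  proof -
    \<comment> \<open>Coefficients of \<open>m\<close> in \<open>X\<close> but off the cell may sit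
      outside \<open>up_toJ\<close>, so \<open>m\<close> is truncated to
      \<open>\<Gamma> \<inter> X\<close>; by \<open>eJ_outside_cell\<close> the discarded part goes
      to zero in the quotient.\<close>
    define F where "F = {w \<in> \<Gamma> \<inter> X. bc m w \<noteq> 0}"
    define m' where "m' = (\<Sum>w \<in> F. scale (bc m w) (B w))"
    have F: "finite F" "F \<subseteq> carrier W"
      using finite_subset[OF _ bc_finite[of m], of F] X_carrier by (auto simp: F_def)
    have bc_m': "bc m' w = (if w \<in> \<Gamma> \<inter> X then bc m w else 0)" if "w \<in> carrier W" for w
      unfolding m'_def using coord_lincomb[OF basis_B F that, of "bc m"] by (auto simp: F_def)
    have bc_m: "bc m w \<in> A" "bc m w \<noteq> 0 \<Longrightarrow> w \<in> up_to" if "w \<in> carrier W" for w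
      using m that unfolding bc_up by auto
    have "m' \<in> lincombs A scale B up_to"
      unfolding bc_up using bc_m bc_m' zero_A by simp
    moreover have "eJ * m' * eJ \<in> lincombs A scale b up_toJ"
      unfolding corner_lincombs_iff[OF up_toJ_subset(1) zero_A]
    proof
      fix x assume x: "x \<in> X"
      then have xc: "x \<in> carrier W" using X_carrier by blast
      have "x \<in> up_toJ" if "x \<in> \<Gamma>" using that x cellJ_iff up_toJ_iff by blast
      then show "bc m' x \<in> A \<and> (bc m' x \<noteq> 0 \<longrightarrow> x \<in> up_toJ)"
        using bc_m'[OF xc] bc_m[OF xc] zero_A by simp
    qed
    moreover have "m - m' \<in> lincombs A scale B (up_to - \<Gamma> \<inter> X)"
    proof -
      have "up_to - \<Gamma> \<inter> X \<subseteq> carrier W" using sub_carrier by blast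
      then show ?thesis
        using bc_m bc_m' zero_A by (subst lincombs_B_iff) (simp_all add: bc_simps)
    qed
    then have "eJ * m - eJ * m' \<in> lincombs A scale B below"
      using eJ_outside_cell by (simp flip: right_diff_distrib)
    ultimately show ?thesis by blast
  qed
qed

end

end

theorem proposition4p11:
  fixes W :: "('w, 'z) monoid_scheme" and S J \<Gamma> :: "'w set"
    and scale :: "ratfun \<Rightarrow> 'h \<Rightarrow> 'h::ring_1" and T C :: "'w \<Rightarrow> 'h"
    and bar dagger :: "'h \<Rightarrow> 'h"
  assumes "coxeter_system W S"
    and "J \<subseteq> S" and "J \<noteq> {}" and "finite (generate W J)"
    and "hecke_algebra W S scale T"
    and "bar_involution (hecke_form W S J scale T) S scale T bar"
    and "kazhdan_lusztig_basis W S scale T bar C"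
    and "dagger_automorphism (hecke_form W S J scale T) S scale T dagger"
    and "\<Gamma> \<in> left_cells scale (hecke_form W S J scale T) (\<lambda>w. dagger (C w)) (carrier W)"
    and "\<Gamma> \<inter> min_reps W S J \<noteq> {}"
    and "irreducible_rep UNIV
      (cell_rep UNIV scale (hecke_form W S J scale T) (\<lambda>w. dagger (C w)) (carrier W) \<Gamma>)"
  shows "let A = coeff_ring W S J; H = hecke_form W S J scale T; e = idem W S J scale T;
      HJ = corner e H; X = min_reps W S J;
      Cd = (\<lambda>w. dagger (C w)); CdJ = (\<lambda>d. e * dagger (C d) * e)
    in \<Gamma> \<inter> X \<in> left_cells scale HJ CdJ X \<and>
       rep_iso HJ (cell_rep A scale HJ CdJ X (\<Gamma> \<inter> X))
         (idem_image e (cell_rep A scale H Cd (carrier W) \<Gamma>))"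
proof -
  interpret coxeter_system W S by fact
  interpret hecke_algebra W S scale T by fact
  interpret hecke_kl W S scale T J bar dagger C
    by unfold_locales (use assms in auto)
  obtain d0 where "d0 \<in> \<Gamma>" "d0 \<in> min_reps W S J" using assms(10) by blast
  then show ?thesis
    unfolding Let_def using assms(9,11) cellJ cell_rep_iso by blast
qed

end
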